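(* Let $k$ be a field, $H_1=\langle a_1,\dots,a_\ell\rangle$ a numerical semigroup with $\gcd(a_1,\dots,a_\ell)=1$ minimally generated by $a_1,\dots,a_\ell$, $0<\alpha\in H_1$ an odd integer with $\alpha\ne a_i$ for all $i$, $H=\langle 2a_1,\dots,2a_\ell,\alpha\rangle$, $R_1=k[[H_1]]$, $R=k[[H]]\subseteq k[[t]]$, $K$ a canonical fractional ideal of $R$ and $\mathfrak c=R:R[K]$. Suppose that $R_1$ is an almost Gorenstein local ring but not Gorenstein. Then: (1) every Ulrich ideal $I$ of $R$ satisfies $\mu_R(I)=2$ or $I=\mathfrak c$; (2) the set of Ulrich ideals $I$ of $R$ with $\mu_R(I)=2$ which are generated by monomials in $t$ is $$\{(t^{2m},t^{\alpha})\mid 0<m\in H_1,\ \alpha-m\in H_1,\ 2(\alpha-2m)\in H\}.$$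
   Context: $k[[H]]=k[[t^h:h\in H]]$. For a one-dimensional Cohen–Macaulay local ring $B$ with canonical ideal $J$ (proper ideal $\cong\mathrm K_B$) containing a parameter ideal as a reduction, $B$ is almost Gorenstein but not Gorenstein iff $\mathrm e_1(J)=\mathrm e_0(J)-\ell_B(B/J)+1$ (Hilbert coefficients of $J$). A canonical fractional ideal of $R$ is an $R$-submodule $K\subseteq\mathrm Q(R)$ with $R\subseteq K\subseteq k[[t]]$ and $K\cong\mathrm K_R$. An $\mathfrak m$-primary ideal $I$ containing a parameter ideal $Q$ as a reduction is Ulrich if $I\ne Q$, $I^2=QI$, and $I/I^2$ is $R/I$-free. *)

theory Defs
  imports Main "HOL-Computational_Algebra.Formal_Laurent_Series"
begin

text \<open>Conventions. The field k is a type variable 'k of class field. The total ring of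
fractions Q(R) of a numerical semigroup ring R = k[[H]] is k((t)), modelled by the type
'k fls of formal Laurent series; k[[t]] is the set of Laurent series with no negative
powers, and t^n is fls_X ^ n. All rings, ideals and fractional ideals are subsets of 'k fls.\<close>

definition sg_gen :: "nat list \<Rightarrow> nat set" where
  "sg_gen as = {(\<Sum>i<length as. c i * as ! i) | c. True}"

definition min_gens_numsg :: "nat list \<Rightarrow> bool" where
  "min_gens_numsg as \<longleftrightarrow> as \<noteq> [] \<and> distinct as \<and> (\<forall>a\<in>set as. 0 < a)
     \<and> Gcd (set as) = 1
     \<and> (\<forall>i<length as. as ! i \<notin> sg_gen (take i as @ drop (Suc i) as))"

definition pow_series :: "'k::field fls set" where
  "pow_series = {f. \<forall>n<0. fls_nth f n = 0}"

definition sg_ring :: "nat set \<Rightarrow> 'k::field fls set" where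
  "sg_ring H = {f. \<forall>n. fls_nth f n \<noteq> 0 \<longrightarrow> 0 \<le> n \<and> nat n \<in> H}"

definition max_ideal :: "'k::field fls set \<Rightarrow> 'k fls set" where
  "max_ideal R = {f \<in> R. fls_nth f 0 = 0}"

definition is_ideal :: "'k::field fls set \<Rightarrow> 'k fls set \<Rightarrow> bool" where
  "is_ideal R I \<longleftrightarrow> I \<subseteq> R \<and> 0 \<in> I \<and> (\<forall>x\<in>I. \<forall>y\<in>I. x + y \<in> I)
     \<and> (\<forall>r\<in>R. \<forall>x\<in>I. r * x \<in> I)"

definition is_submodule :: "'k::field fls set \<Rightarrow> 'k fls set \<Rightarrow> bool" where
  "is_submodule R M \<longleftrightarrow> 0 \<in> M \<and> (\<forall>x\<in>M. \<forall>y\<in>M. x + y \<in> M)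
     \<and> (\<forall>r\<in>R. \<forall>x\<in>M. r * x \<in> M)"

text \<open>fractional ideal: finitely generated (equivalently, d M \<subseteq> R for some non-zerodivisor d)
  R-submodule of Q(R) containing a non-zerodivisor; nonzero elements of k((t)) are units\<close>
definition frac_ideal :: "'k::field fls set \<Rightarrow> 'k fls set \<Rightarrow> bool" where
  "frac_ideal R M \<longleftrightarrow> is_submodule R M \<and> (\<exists>d\<in>R. d \<noteq> 0 \<and> (\<forall>x\<in>M. d * x \<in> R))
     \<and> (\<exists>x\<in>M. x \<noteq> 0)"

definition colon :: "'k::field fls set \<Rightarrow> 'k fls set \<Rightarrow> 'k fls set" where
  "colon A B = {x. \<forall>b\<in>B. x * b \<in> A}"

definition mod_prod :: "'k::field fls set \<Rightarrow> 'k fls set \<Rightarrow> 'k fls set" where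
  "mod_prod I J = {(\<Sum>i<n. a i * b i) | (n::nat) a b. \<forall>i<n. a i \<in> I \<and> b i \<in> J}"

fun ideal_pow :: "'k::field fls set \<Rightarrow> 'k fls set \<Rightarrow> nat \<Rightarrow> 'k fls set" where
  "ideal_pow R I 0 = R"
| "ideal_pow R I (Suc n) = mod_prod I (ideal_pow R I n)"

definition gen_set :: "'k::field fls set \<Rightarrow> 'k fls set \<Rightarrow> 'k fls set" where
  "gen_set R S = {(\<Sum>i<n. r i * s i) | (n::nat) r s. \<forall>i<n. r i \<in> R \<and> s i \<in> S}"

definition gen :: "'k::field fls set \<Rightarrow> 'k fls list \<Rightarrow> 'k fls set" where
  "gen R xs = {(\<Sum>i<length xs. r i * xs ! i) | r. \<forall>i<length xs. r i \<in> R}"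

definition mu :: "'k::field fls set \<Rightarrow> 'k fls set \<Rightarrow> nat" where
  "mu R I = (LEAST n. \<exists>xs. length xs = n \<and> set xs \<subseteq> I \<and> gen R xs = I)"

definition m_primary :: "'k::field fls set \<Rightarrow> 'k fls set \<Rightarrow> bool" where
  "m_primary R I \<longleftrightarrow> is_ideal R I \<and> I \<noteq> R \<and> (\<exists>n. ideal_pow R (max_ideal R) n \<subseteq> I)"

text \<open>Q is a parameter ideal (R has dimension one: Q = (a) with Q m-primary) contained
  in I and is a reduction of I\<close>
definition param_reduction :: "'k::field fls set \<Rightarrow> 'k fls set \<Rightarrow> 'k fls set \<Rightarrow> bool" where
  "param_reduction R Q I \<longleftrightarrow> (\<exists>a\<in>R. Q = gen R [a]) \<and> m_primary R Q \<and> Q \<subseteq> I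
     \<and> (\<exists>r. ideal_pow R I (Suc r) = mod_prod Q (ideal_pow R I r))"

text \<open>I/I^2 is a free R/I-module: there are x_1..x_n in I whose images form a basis\<close>
definition quot_free :: "'k::field fls set \<Rightarrow> 'k fls set \<Rightarrow> bool" where
  "quot_free R I \<longleftrightarrow> (\<exists>xs. set xs \<subseteq> I
     \<and> (\<forall>x\<in>I. \<exists>r. (\<forall>i<length xs. r i \<in> R)
                 \<and> x - (\<Sum>i<length xs. r i * xs ! i) \<in> ideal_pow R I 2)
     \<and> (\<forall>r. (\<forall>i<length xs. r i \<in> R) \<longrightarrow> (\<Sum>i<length xs. r i * xs ! i) \<in> ideal_pow R I 2
            \<longrightarrow> (\<forall>i<length xs. r i \<in> I)))"

definition ulrich :: "'k::field fls set \<Rightarrow> 'k fls set \<Rightarrow> bool" where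
  "ulrich R I \<longleftrightarrow> m_primary R I \<and> (\<exists>Q. param_reduction R Q I \<and> I \<noteq> Q
      \<and> ideal_pow R I 2 = mod_prod Q I) \<and> quot_free R I"

text \<open>length l_R(R/I); the residue field of k[[H]] is k, so this is dim_k(R/I)\<close>
definition len :: "'k::field fls set \<Rightarrow> 'k fls set \<Rightarrow> nat" where
  "len R I = (LEAST n. \<exists>xs. length xs = n \<and> set xs \<subseteq> R
       \<and> (\<forall>f\<in>R. \<exists>c. f - (\<Sum>i<n. fls_const (c i) * xs ! i) \<in> I))"

definition hilb_coeffs :: "'k::field fls set \<Rightarrow> 'k fls set \<Rightarrow> int \<Rightarrow> int \<Rightarrow> bool" where
  "hilb_coeffs R I e0 e1 \<longleftrightarrow> (\<exists>N. \<forall>n\<ge>N. int (len R (ideal_pow R I (Suc n))) = e0 * int (Suc n) - e1)"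

text \<open>canonical module as a fractional ideal (one-dimensional CM case): K:(K:I) = I for
  every fractional ideal I\<close>
definition canonical_frac :: "'k::field fls set \<Rightarrow> 'k fls set \<Rightarrow> bool" where
  "canonical_frac R K \<longleftrightarrow> frac_ideal R K \<and> (\<forall>I. frac_ideal R I \<longrightarrow> colon K (colon K I) = I)"

definition canonical_fractional_ideal :: "'k::field fls set \<Rightarrow> 'k fls set \<Rightarrow> bool" where
  "canonical_fractional_ideal R K \<longleftrightarrow> canonical_frac R K \<and> R \<subseteq> K \<and> K \<subseteq> pow_series"

text \<open>canonical ideal: proper ideal isomorphic to K_R (isomorphisms between fractional
  ideals are multiplications by units x of Q(R))\<close>
definition canonical_ideal :: "'k::field fls set \<Rightarrow> 'k fls set \<Rightarrow> bool" where
  "canonical_ideal R J \<longleftrightarrow> is_ideal R J \<and> J \<noteq> R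
     \<and> (\<exists>K x. canonical_frac R K \<and> x \<noteq> 0 \<and> J = (\<lambda>y. x * y) ` K)"

definition almost_gor_not_gor :: "'k::field fls set \<Rightarrow> bool" where
  "almost_gor_not_gor R \<longleftrightarrow> (\<exists>J Q e0 e1. canonical_ideal R J \<and> param_reduction R Q J
     \<and> hilb_coeffs R J e0 e1 \<and> e1 = e0 - int (len R J) + 1)"

definition is_subring :: "'k::field fls set \<Rightarrow> bool" where
  "is_subring S \<longleftrightarrow> 1 \<in> S \<and> (\<forall>x\<in>S. \<forall>y\<in>S. x + y \<in> S \<and> x * y \<in> S \<and> - x \<in> S)"

definition ring_adj :: "'k::field fls set \<Rightarrow> 'k fls set \<Rightarrow> 'k fls set" where
  "ring_adj R K = \<Inter>{S. is_subring S \<and> R \<union> K \<subseteq> S}"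

end

theory Submission
  imports Defs
begin

text \<open>Write \<open>R = k[[H]]\<close> and \<open>R1 = k[[H1]]\<close>. The canonical module of \<open>k[[T]]\<close> is monomial (the
coefficient at \<open>F\<close> gives a perfect pairing on \<open>k((t))\<close>), so the Hilbert function of a canonical ideal
of \<open>R1\<close> can be read off from value sets. The hypothesis becomes \<open>M + A \<subseteq> M\<close>, \<open>A \<noteq> H1\<close>, with \<open>M = H1 - {0}\<close>
and \<open>A = {n. F - n \<notin> H1}\<close>. Since \<open>H = 2 H1 \<union> (\<alpha> + 2 H1)\<close>, the conductor \<open>R : R[K]\<close> then contains all
series with exponents in \<open>H - {0, \<alpha>}\<close>, an ideal of colength two.

Let \<open>I\<close> be an Ulrich ideal with \<open>I\<^sup>2 = a I\<close>. If \<open>I / I\<^sup>2\<close> has rank at least three, take two basis elements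
\<open>x, y\<close> independent of \<open>a\<close> and put \<open>B = R + R x/a\<close>. Then \<open>R : B = I\<close>, so \<open>y/a \<in> K : I = K B\<close>, and multiplying
by \<open>c \<in> R : K\<close> gives a relation between \<open>a, x, y\<close> over \<open>R\<close>, whence \<open>c \<in> I\<close>. Thus \<open>I\<close> contains the conductor,
which leaves only the conductor itself and the maximal ideal, and the latter is not Ulrich.

A two-generated monomial Ulrich ideal is \<open>(t^p, t^q)\<close> where, for \<open>d = q - p\<close>, the \<open>h \<in> H\<close> with
\<open>h + d \<in> H\<close> are exactly its exponents. If neither exponent is \<open>\<alpha>\<close>, then for \<open>f \<in> A - H1\<close> the elements
\<open>2 f - d\<close> and \<open>2 (F - f) + d\<close> lie in \<open>H\<close>, and so does their sum \<open>2 F\<close>, a contradiction.\<close>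

text \<open>Canonical modules are given only by a duality over all fractional ideals, so the given
  \<open>K\<close> and \<open>J\<close> need not be monomial. Uniqueness up to a factor from
  \<open>k((t))\<close> transports facts from the monomial model: for \<open>J\<close> it determines
  the value sets of all powers, for \<open>K\<close> it leaves a factor whose exponents can again be
  controlled. The conductor is never computed: it is squeezed between the monomial ideal on
  \<open>H - {0, \<alpha>}\<close> and \<open>I\<close>. With \<open>R1\<close> embedded by t ->
  t^2, \<open>R\<close> is \<open>R1 + t^\<alpha> R1\<close>; hence the Frobenius number of
  \<open>H\<close> is \<open>\<alpha> + 2 F\<close>, and parity separates membership questions. The
  hypothesis that \<alpha> is not a generator enters as \<open>2 b < \<alpha>\<close>, with
  \<open>b\<close> the least generator: a principal reduction of the maximal ideal then has even
  order, which is what excludes this ideal. The element \<open>a\<close> need not be a monomial even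
  when \<open>I\<close> is monomial, so arguments about it use orders, or make it a unit in a larger
  monomial ring after division by a power of t.\<close>

unbundle fps_syntax

section \<open>Laurent series with prescribed support\<close>

lemma fls_times_nth_nonzeroE:
  fixes f g :: "'k::field fls"
  assumes "(f * g) $$ n \<noteq> 0"
  obtains i where "f $$ i \<noteq> 0" "g $$ (n - i) \<noteq> 0"
proof -
  have "(\<Sum>i = fls_subdegree f..n - fls_subdegree g. f $$ i * g $$ (n - i)) \<noteq> 0"
    using assms by (simp add: fls_times_nth(2))
  then obtain i where "f $$ i * g $$ (n - i) \<noteq> 0" by (meson sum.not_neutral_contains_not_neutral)
  then show thesis using that by auto
qed

lemma fls_times_nth_single:
  fixes f g :: "'k::field fls"
  assumes "\<And>i. i \<noteq> p \<Longrightarrow> f $$ i \<noteq> 0 \<Longrightarrow> g $$ (n - i) = 0"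
  shows "(f * g) $$ n = f $$ p * g $$ (n - p)"
proof -
  let ?A = "{fls_subdegree f..n - fls_subdegree g}"
  have z: "f $$ i * g $$ (n - i) = 0" if "i \<noteq> p" for i
    using assms[OF that] by auto
  have "(f * g) $$ n = (\<Sum>i\<in>?A. f $$ i * g $$ (n - i))"
    by (rule fls_times_nth(2))
  also have "\<dots> = (\<Sum>i\<in>?A. if i = p then f $$ p * g $$ (n - p) else 0)"
    by (rule sum.cong) (auto simp: z)
  also have "\<dots> = (if p \<in> ?A then f $$ p * g $$ (n - p) else 0)"
    by (subst sum.delta) auto
  also have "\<dots> = f $$ p * g $$ (n - p)"
    by auto
  finally show ?thesis .
qed

text \<open>Integer exponents, unlike in \<open>fls_X ^ n\<close>: the pairing at \<open>F\<close>
  and division by a monomial of least order use negative powers.\<close>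

definition tpow :: "int \<Rightarrow> 'k::field fls" where
  "tpow i = fls_shift (- i) 1"

lemma tpow_nth [simp]: "tpow i $$ n = (if n = i then 1 else 0)"
  by (simp add: tpow_def)

lemma tpow_nonzero [simp]: "tpow i \<noteq> 0"
  by (metis tpow_nth zero_neq_one fls_zero_nth)

lemma tpow_mult: "tpow i * tpow j = tpow (i + j)"
  by (simp add: tpow_def fls_X_intpow_times_fls_X_intpow)

lemma tpow_0: "tpow 0 = 1"
  by (simp add: tpow_def)

lemma tpow_times_nth [simp]: "(tpow i * f) $$ n = f $$ (n - i)"
  by (subst fls_times_nth_single[of i]) auto

lemma tpow_subdegree [simp]: "fls_subdegree (tpow i) = i"
  by (rule fls_subdegree_eqI) auto

lemma fls_X_power_eq_tpow: "fls_X ^ n = tpow (int n)"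
  by (rule fls_eqI) simp

text \<open>One notation for the semigroup ring, its monomial ideals and its monomial fractional
  ideals, with infinite sums included.\<close>

definition supp_in :: "int set \<Rightarrow> 'k::field fls set" where
  "supp_in G = {f. \<forall>n. f $$ n \<noteq> 0 \<longrightarrow> n \<in> G}"

lemma supp_inI: "(\<And>n. f $$ n \<noteq> 0 \<Longrightarrow> n \<in> G) \<Longrightarrow> f \<in> supp_in G"
  by (simp add: supp_in_def)

lemma supp_inD: "f \<in> supp_in G \<Longrightarrow> f $$ n \<noteq> 0 \<Longrightarrow> n \<in> G"
  by (simp add: supp_in_def)

lemma supp_in_nth_eq_0: "f \<in> supp_in G \<Longrightarrow> n \<notin> G \<Longrightarrow> f $$ n = 0"
  by (auto simp: supp_in_def)

lemma supp_in_zero [simp]: "0 \<in> supp_in G"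
  by (simp add: supp_in_def)

lemma supp_in_add: "f \<in> supp_in G \<Longrightarrow> g \<in> supp_in G \<Longrightarrow> f + g \<in> supp_in G"
  by (force simp: supp_in_def)

lemma supp_in_diff: "f \<in> supp_in G \<Longrightarrow> g \<in> supp_in G \<Longrightarrow> f - g \<in> supp_in G"
  by (force simp: supp_in_def)

lemma supp_in_uminus: "f \<in> supp_in G \<Longrightarrow> - f \<in> supp_in G"
  by (force simp: supp_in_def)

lemma supp_in_sum: "(\<And>i. i \<in> A \<Longrightarrow> f i \<in> supp_in G) \<Longrightarrow> sum f A \<in> supp_in G"
  by (induction A rule: infinite_finite_induct) (auto intro: supp_in_add)

lemma supp_in_mono: "G \<subseteq> G' \<Longrightarrow> supp_in G \<subseteq> supp_in G'"
  by (auto simp: supp_in_def)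

lemma supp_in_mult:
  assumes "f \<in> supp_in A" "g \<in> supp_in B" "\<And>a b. a \<in> A \<Longrightarrow> b \<in> B \<Longrightarrow> a + b \<in> C"
  shows "f * g \<in> supp_in C"
proof (rule supp_inI)
  fix n assume "(f * g) $$ n \<noteq> 0"
  then obtain i where "f $$ i \<noteq> 0" "g $$ (n - i) \<noteq> 0" by (rule fls_times_nth_nonzeroE)
  then have "i + (n - i) \<in> C" using assms by (meson supp_inD)
  then show "n \<in> C" by simp
qed

lemma tpow_in_supp_in [simp]: "tpow i \<in> supp_in G \<longleftrightarrow> i \<in> G"
  by (auto simp: supp_in_def)

lemma fls_const_in_supp_in: "0 \<in> G \<Longrightarrow> fls_const c \<in> supp_in G"
  by (auto simp: supp_in_def)

lemma const_times_in_supp_in: "f \<in> supp_in G \<Longrightarrow> fls_const c * f \<in> supp_in G"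
  by (auto simp: supp_in_def)

lemma in_supp_in_atLeastI: "f \<noteq> 0 \<Longrightarrow> N \<le> fls_subdegree f \<Longrightarrow> f \<in> supp_in {N..}"
  by (rule supp_inI) (use fls_subdegree_leI in force)

lemma in_supp_in_subdegree: "f \<noteq> 0 \<Longrightarrow> f \<in> supp_in G \<Longrightarrow> fls_subdegree f \<in> G"
  by (meson nth_fls_subdegree_nonzero supp_inD)

text \<open>Let \<open>m\<close> be the least exponent of the inverse outside \<open>G\<close>. In
  the coefficient of the product at \<open>m\<close> every term but
  \<open>f $$ 0 * inverse f $$ m\<close> vanishes, since otherwise \<open>m\<close> would be a sum
  of two elements of \<open>G\<close>. As \<open>m\<close> is not 0, that coefficient of 1 is 0, a
  contradiction.\<close>

lemma inverse_in_supp_in: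
  assumes f: "f \<in> supp_in G" and f0: "f $$ 0 \<noteq> 0"
    and G: "\<And>n. n \<in> G \<Longrightarrow> 0 \<le> n" "0 \<in> G" "\<And>a b. a \<in> G \<Longrightarrow> b \<in> G \<Longrightarrow> a + b \<in> G"
  shows "inverse f \<in> supp_in G"
proof (rule ccontr)
  let ?g = "inverse f"
  assume "?g \<notin> supp_in G"
  then obtain n0 where n0: "?g $$ n0 \<noteq> 0" "n0 \<notin> G" by (auto simp: supp_in_def)
  have fnz: "f \<noteq> 0" using f0 by auto
  have "fls_subdegree f = 0"
    by (rule fls_subdegree_eqI[OF f0]) (use f G(1) supp_inD in force)
  then have "fls_subdegree ?g = 0" using fnz by simp
  then have ge0: "0 \<le> i" if "?g $$ i \<noteq> 0" for i using that fls_subdegree_leI by metis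
  define m where "m = (LEAST m. ?g $$ int m \<noteq> 0 \<and> int m \<notin> G)"
  have ex: "?g $$ int (nat n0) \<noteq> 0 \<and> int (nat n0) \<notin> G" using n0 ge0 by simp
  have m: "?g $$ int m \<noteq> 0" "int m \<notin> G" 
    using LeastI[of "\<lambda>m. ?g $$ int m \<noteq> 0 \<and> int m \<notin> G", OF ex] unfolding m_def by auto
  have least: "i \<in> G" if "?g $$ i \<noteq> 0" "i < int m" for i
    using not_less_Least[of "nat i" "\<lambda>m. ?g $$ int m \<noteq> 0 \<and> int m \<notin> G"] that ge0[OF that(1)]
    unfolding m_def by (auto simp: nat_less_iff)
  have "(f * ?g) $$ int m = f $$ 0 * ?g $$ (int m - 0)"
  proof (rule fls_times_nth_single)
    fix i assume i: "i \<noteq> 0" "f $$ i \<noteq> 0"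
    then have "i \<in> G" using f supp_inD by blast
    then have "0 < i" using G(1) i by fastforce
    show "?g $$ (int m - i) = 0"
    proof (rule ccontr)
      assume "?g $$ (int m - i) \<noteq> 0"
      then have "int m - i \<in> G" using least \<open>0 < i\<close> by simp
      then show False using G(3)[OF \<open>i \<in> G\<close>] m by fastforce
    qed
  qed
  moreover have "m \<noteq> 0" using m G(2) by (metis of_nat_0)
  moreover have "f * ?g = 1" using fnz by simp
  ultimately show False using m f0 by simp
qed

lemma sg_ring_eq_supp_in: "sg_ring H = supp_in (int ` H)"
proof -
  have "0 \<le> n \<and> nat n \<in> H \<longleftrightarrow> n \<in> int ` H" for n by force
  then show ?thesis unfolding sg_ring_def supp_in_def by simp
qed

lemma const_times_tpow_nth: "(fls_const c * tpow i) $$ n = (if n = i then c else 0)"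
  by simp

lemma supp_in_finite_part:
  fixes N :: int
  assumes "f \<in> supp_in G"
  defines "A \<equiv> {n \<in> G. fls_subdegree f \<le> n \<and> n < N}"
  shows "f - (\<Sum>i\<in>A. fls_const (f $$ i) * tpow i) \<in> supp_in (G \<inter> {N..})"
proof (rule supp_inI)
  have fin: "finite A" unfolding A_def by (rule finite_subset[of _ "{fls_subdegree f..N}"]) auto
  fix n
  have "(\<Sum>i\<in>A. fls_const (f $$ i) * tpow i) $$ n = (\<Sum>i\<in>A. if n = i then f $$ n else 0)"
    unfolding fls_nth_sum const_times_tpow_nth by (rule sum.cong) auto
  also have "\<dots> = (if n \<in> A then f $$ n else 0)" by (rule sum.delta'[OF fin])
  finally have eq: "(f - (\<Sum>i\<in>A. fls_const (f $$ i) * tpow i)) $$ n = (if n \<in> A then 0 else f $$ n)"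
    by simp
  assume "(f - (\<Sum>i\<in>A. fls_const (f $$ i) * tpow i)) $$ n \<noteq> 0"
  then have n: "f $$ n \<noteq> 0" "n \<notin> A" unfolding eq by (auto split: if_splits)
  then have "n \<in> G" using assms supp_inD by blast
  then show "n \<in> G \<inter> {N..}" using n fls_subdegree_leI[of f n] unfolding A_def by force
qed

text \<open>Replaces a closure argument: once \<open>I\<close> contains a full tail, only finitely
  many monomials of a series are left, and finite sums suffice.\<close>

lemma supp_in_subset_of_tpows:
  fixes I :: "'k::field fls set"
  assumes tail: "supp_in {N..} \<subseteq> I" and m: "\<And>i c. i \<in> G \<Longrightarrow> fls_const c * tpow i \<in> I"
    and add: "\<And>x y. x \<in> I \<Longrightarrow> y \<in> I \<Longrightarrow> x + y \<in> I" and z: "0 \<in> I"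
  shows "supp_in G \<subseteq> I"
proof
  fix f :: "'k fls" assume f: "f \<in> supp_in G"
  define A where "A = {n \<in> G. fls_subdegree f \<le> n \<and> n < N}"
  let ?s = "\<Sum>i\<in>A. fls_const (f $$ i) * tpow i"
  define h where "h i = fls_const (f $$ i) * tpow i" for i
  have h: "h i \<in> I" if "i \<in> G" for i unfolding h_def by (rule m[OF that])
  have "sum h B \<in> I" if "B \<subseteq> G" for B
    using that
  proof (induction B rule: infinite_finite_induct)
    case (insert x F)
    have "h x + sum h F \<in> I" by (rule add[OF h]) (use insert in auto)
    then show ?case using insert by simp
  qed (simp_all add: z)
  from this[of A] have "?s \<in> I" unfolding A_def h_def by simp
  moreover have "f - ?s \<in> I"
    using supp_in_finite_part[OF f, of N] tail supp_in_mono[of "G \<inter> {N..}" "{N..}"]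
    unfolding A_def by blast
  ultimately have "(f - ?s) + ?s \<in> I" by (rule add[rotated])
  then show "f \<in> I" by simp
qed

section \<open>A perfect pairing on Laurent series\<close>

lemma is_submoduleD:
  assumes "is_submodule R M"
  shows "0 \<in> M" "x \<in> M \<Longrightarrow> y \<in> M \<Longrightarrow> x + y \<in> M" "r \<in> R \<Longrightarrow> x \<in> M \<Longrightarrow> r * x \<in> M"
  using assms by (auto simp: is_submodule_def)

lemma colonI: "(\<And>b. b \<in> B \<Longrightarrow> x * b \<in> A) \<Longrightarrow> x \<in> colon A B"
  by (simp add: colon_def)

lemma colonD: "x \<in> colon A B \<Longrightarrow> b \<in> B \<Longrightarrow> x * b \<in> A"
  by (simp add: colon_def)

definition fls_subspace :: "'k::field fls set \<Rightarrow> bool" where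
  "fls_subspace M \<longleftrightarrow> 0 \<in> M \<and> (\<forall>x\<in>M. \<forall>y\<in>M. x + y \<in> M) \<and> (\<forall>c. \<forall>x\<in>M. fls_const c * x \<in> M)"

lemma fls_subspaceD:
  assumes "fls_subspace M"
  shows "0 \<in> M" "x \<in> M \<Longrightarrow> y \<in> M \<Longrightarrow> x + y \<in> M" "x \<in> M \<Longrightarrow> fls_const c * x \<in> M"
    "x \<in> M \<Longrightarrow> y \<in> M \<Longrightarrow> x - y \<in> M"
proof -
  show "x - y \<in> M" if "x \<in> M" "y \<in> M"
  proof -
    have "x + fls_const (- 1) * y \<in> M" using assms that unfolding fls_subspace_def by blast
    then show ?thesis by simp
  qed
qed (use assms in \<open>auto simp: fls_subspace_def\<close>)

lemma vector_space_fls: "vector_space (\<lambda>c (f::'k::field fls). fls_const c * f)"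
  by unfold_locales (simp_all add: algebra_simps flip: fls_plus_const fls_const_mult_const)

lemma vector_space_field: "vector_space ((*) :: 'k::field \<Rightarrow> 'k \<Rightarrow> 'k)"
  by unfold_locales (simp_all add: algebra_simps)

text \<open>A basis of \<open>M\<close> stays independent after adjoining \<open>x\<close>, so a
  linear map may send the basis to 0 and \<open>x\<close> to 1. No continuity is claimed; the tail
  in \<open>M\<close> makes up for it in \<open>double_perp\<close>.\<close>

lemma separating_functional:
  fixes M :: "'k::field fls set"
  assumes M: "fls_subspace M" and x: "x \<notin> M"
  obtains g :: "'k fls \<Rightarrow> 'k" where "\<And>u v. g (u + v) = g u + g v" "\<And>c u. g (fls_const c * u) = c * g u"
    "\<And>m. m \<in> M \<Longrightarrow> g m = 0" "g x \<noteq> 0"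
proof -
  interpret V: vector_space_pair "\<lambda>c (f::'k fls). fls_const c * f" "(*) :: 'k \<Rightarrow> 'k \<Rightarrow> 'k"
    by (intro vector_space_pair.intro vector_space_fls vector_space_field)
  obtain B where B: "B \<subseteq> M" "V.vs1.independent B" "M \<subseteq> V.vs1.span B"
    using V.vs1.maximal_independent_subset by blast
  have sM: "V.vs1.subspace M" using M unfolding fls_subspace_def V.vs1.subspace_def by blast
  have "V.vs1.span B \<subseteq> M" by (rule V.vs1.span_minimal[OF B(1) sM])
  then have "V.vs1.independent (insert x B)" using x B(2) by (intro V.vs1.independent_insertI) auto
  from V.linear_independent_extend[OF this, of "\<lambda>y. if y = x then 1 else 0"]
  obtain g where g: "Vector_Spaces.linear (\<lambda>c (f::'k fls). fls_const c * f) (*) g"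
    "\<forall>y\<in>insert x B. g y = (if y = x then 1 else 0)" by blast
  interpret g: Vector_Spaces.linear "\<lambda>c (f::'k fls). fls_const c * f" "(*)" g by (rule g(1))
  have "g m = 0" if "m \<in> M" for m
  proof (rule V.linear_eq_0_on_span[OF g(1)])
    show "m \<in> V.vs1.span B" using that B(3) by blast
    show "g b = 0" if "b \<in> B" for b using that g(2) B(1) x by auto
  qed
  then show thesis using that[of g] g.add g.scale g(2) by auto
qed

text \<open>Coefficientwise, the functional is multiplication by a Laurent series followed by taking
  the coefficient at \<open>F\<close>; hence the pairing \<open>(f, g) \<mapsto> (f g)_F\<close> is perfect.\<close>
lemma double_perp:
  fixes M :: "'k::field fls set"
  assumes M: "fls_subspace M" and tail: "supp_in {N..} \<subseteq> M"
    and x: "\<And>y. (\<And>m. m \<in> M \<Longrightarrow> (y * m) $$ F = 0) \<Longrightarrow> (y * x) $$ F = 0"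
  shows "x \<in> M"
proof (rule ccontr)
  assume "x \<notin> M"
  then obtain g :: "'k fls \<Rightarrow> 'k" where g: "\<And>u v. g (u + v) = g u + g v" "\<And>c u. g (fls_const c * u) = c * g u"
    "\<And>m. m \<in> M \<Longrightarrow> g m = 0" "g x \<noteq> 0" using separating_functional[OF M] by metis
  have g0: "g 0 = 0" using g(3) fls_subspaceD(1)[OF M] by blast
  have gsum: "g (sum h A) = (\<Sum>i\<in>A. g (h i))" for h and A :: "int set"
    by (induction A rule: infinite_finite_induct) (simp_all add: g0 g(1))
  \<comment> \<open>For \<open>n \<le> F - N\<close> the monomial \<open>tpow (F - n)\<close> lies
    in the tail, where \<open>g\<close> vanishes. The cutoff therefore loses nothing and makes
    \<open>c\<close> the coefficient sequence of a Laurent series.\<close>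
  define c where "c n = (if n > F - N then g (tpow (F - n)) else 0)" for n
  define y where "y = Abs_fls c"
  have y: "y $$ n = c n" for n unfolding y_def by (rule nth_Abs_fls_lower_bound[of "F - N"]) (simp add: c_def)
  have "(y * f) $$ F = g f" for f
  proof -
    define A where "A = {n \<in> UNIV. fls_subdegree f \<le> n \<and> n < N}"
    define s where "s = (\<Sum>i\<in>A. fls_const (f $$ i) * tpow i)"
    have "f \<in> supp_in UNIV" by (simp add: supp_in_def)
    from supp_in_finite_part[OF this, of N] have t: "f - s \<in> supp_in {N..}" by (simp add: s_def A_def)
    have "(y * (f - s)) $$ F = 0"
    proof (rule ccontr)
      assume "(y * (f - s)) $$ F \<noteq> 0"
      then obtain i where "y $$ i \<noteq> 0" "(f - s) $$ (F - i) \<noteq> 0" by (rule fls_times_nth_nonzeroE)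
      then show False using supp_inD[OF t, of "F - i"] by (auto simp: y c_def split: if_splits)
    qed
    moreover have "(y * f) $$ F = (y * (f - s)) $$ F + (y * s) $$ F"
      by (simp only: fls_plus_nth[symmetric] distrib_left[symmetric] diff_add_cancel)
    moreover have "(y * s) $$ F = (\<Sum>i\<in>A. f $$ i * g (tpow i))"
    proof -
      have "(y * s) $$ F = (\<Sum>i\<in>A. (fls_const (f $$ i) * (tpow i * y)) $$ F)"
        unfolding s_def sum_distrib_left fls_nth_sum by (rule sum.cong) (simp_all only: mult_ac)
      also have "\<dots> = (\<Sum>i\<in>A. f $$ i * g (tpow i))"
        by (rule sum.cong) (simp_all add: y c_def A_def)
      finally show ?thesis .
    qed
    moreover have "g f = g (f - s) + g s" by (simp only: g(1)[symmetric] diff_add_cancel)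
    moreover have "g (f - s) = 0" using t tail g(3) by blast
    moreover have "g s = (\<Sum>i\<in>A. f $$ i * g (tpow i))" unfolding s_def gsum g(2) ..
    ultimately show ?thesis by simp
  qed
  then show False using x[of y] g(3,4) by simp
qed

section \<open>Products of submodules as finite sums of products\<close>

lemma mod_prodI: "a \<in> I \<Longrightarrow> b \<in> J \<Longrightarrow> a * b \<in> mod_prod I J"
  unfolding mod_prod_def mem_Collect_eq
  by (intro exI[of _ "1::nat"] exI[of _ "\<lambda>_. a"] exI[of _ "\<lambda>_. b"]) auto

lemma mod_prod_subset:
  assumes "0 \<in> M" "\<And>x y. x \<in> M \<Longrightarrow> y \<in> M \<Longrightarrow> x + y \<in> M" "\<And>a b. a \<in> I \<Longrightarrow> b \<in> J \<Longrightarrow> a * b \<in> M"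
  shows "mod_prod I J \<subseteq> M"
proof
  fix x assume "x \<in> mod_prod I J"
  then obtain n a b where x: "x = (\<Sum>i<n. a i * b i)" "\<forall>i<(n::nat). a i \<in> I \<and> b i \<in> J"
    unfolding mod_prod_def by blast
  have "(\<Sum>i<k. a i * b i) \<in> M" if "k \<le> n" for k
    using that by (induction k) (use x assms in auto)
  then show "x \<in> M" using x by simp
qed

lemma zero_in_mod_prod: "0 \<in> mod_prod I J"
  unfolding mod_prod_def mem_Collect_eq by (intro exI[of _ "0::nat"]) auto

lemma mod_prod_add:
  assumes "x \<in> mod_prod I J" "y \<in> mod_prod I J"
  shows "x + y \<in> mod_prod I J"
proof -
  obtain n a b where x: "x = (\<Sum>i<n. a i * b i)" "\<forall>i<(n::nat). a i \<in> I \<and> b i \<in> J"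
    using assms(1) unfolding mod_prod_def by blast
  obtain m c d where y: "y = (\<Sum>i<m. c i * d i)" "\<forall>i<(m::nat). c i \<in> I \<and> d i \<in> J"
    using assms(2) unfolding mod_prod_def by blast
  define a' where "a' i = (if i < n then a i else c (i - n))" for i
  define b' where "b' i = (if i < n then b i else d (i - n))" for i
  have "(\<Sum>i<n+k. a' i * b' i) = x + (\<Sum>i<k. c i * d i)" for k
    by (induction k) (simp_all add: x(1) a'_def b'_def add.assoc)
  then have "x + y = (\<Sum>i<n+m. a' i * b' i)" using y by simp
  moreover have "\<forall>i<n+m. a' i \<in> I \<and> b' i \<in> J" using x y by (auto simp: a'_def b'_def)
  ultimately show ?thesis unfolding mod_prod_def by blast
qed

lemma mod_prod_scale:
  assumes "x \<in> mod_prod I J" "\<And>b. b \<in> J \<Longrightarrow> r * b \<in> J"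
  shows "r * x \<in> mod_prod I J"
proof -
  have "mod_prod I J \<subseteq> {x. r * x \<in> mod_prod I J}"
  proof (rule mod_prod_subset)
    fix a b assume "a \<in> I" "b \<in> J"
    then have "a * (r * b) \<in> mod_prod I J" by (intro mod_prodI assms)
    then show "a * b \<in> {x. r * x \<in> mod_prod I J}" by (simp add: mult_ac)
  qed (auto simp: distrib_left zero_in_mod_prod mod_prod_add)
  then show ?thesis using assms by blast
qed

section \<open>Canonical modules of numerical semigroup rings\<close>

lemma canonical_fracD:
  assumes "canonical_frac R K"
  shows "frac_ideal R K" "is_submodule R K" "frac_ideal R I \<Longrightarrow> colon K (colon K I) = I"
  using assms by (simp_all add: canonical_frac_def frac_ideal_def)

lemma frac_ideal_nonzero:
  assumes "frac_ideal R M"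
  obtains x where "x \<in> M" "x \<noteq> 0"
  using assms by (auto simp: frac_ideal_def)

lemma frac_ideal_denom:
  assumes "frac_ideal R M"
  obtains d where "d \<in> R" "d \<noteq> 0" "\<And>x. x \<in> M \<Longrightarrow> d * x \<in> R"
  using assms by (auto simp: frac_ideal_def)

text \<open>Semigroups live in the integers so that differences such as \<open>F - n\<close> are not
  truncated; \<open>cofinite\<close> takes the place of the gcd condition.\<close>

locale num_semigroup =
  fixes T :: "int set"
  assumes zero_mem: "0 \<in> T"
    and add_mem: "a \<in> T \<Longrightarrow> b \<in> T \<Longrightarrow> a + b \<in> T"
    and nonneg: "a \<in> T \<Longrightarrow> 0 \<le> a"
    and cofinite: "\<exists>N. {N..} \<subseteq> T"
begin

lemma ring_mult: "f \<in> supp_in T \<Longrightarrow> g \<in> supp_in T \<Longrightarrow> f * g \<in> supp_in T"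
  by (rule supp_in_mult[of f T g T]) (auto intro: add_mem)

lemma ring_const: "fls_const c \<in> supp_in T"
  by (simp add: fls_const_in_supp_in zero_mem)

lemma ring_one: "1 \<in> supp_in T"
  using ring_const[of 1] by simp

lemma ring_inverse: "f \<in> supp_in T \<Longrightarrow> f $$ 0 \<noteq> 0 \<Longrightarrow> inverse f \<in> supp_in T"
  by (rule inverse_in_supp_in) (auto intro: nonneg zero_mem add_mem)

lemma ring_nth_neg: "f \<in> supp_in T \<Longrightarrow> n < 0 \<Longrightarrow> f $$ n = 0"
  using nonneg by (force simp: supp_in_def)

lemma submodule_subspace: "is_submodule (supp_in T) M \<Longrightarrow> fls_subspace M"
  unfolding is_submodule_def fls_subspace_def using ring_const by blast

lemma submodule_diff: "is_submodule (supp_in T) M \<Longrightarrow> x \<in> M \<Longrightarrow> y \<in> M \<Longrightarrow> x - y \<in> M"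
  using submodule_subspace fls_subspaceD(4) by blast

text \<open>A series of order at least \<open>N + fls_subdegree x\<close> is a multiple of
  \<open>x\<close> whose cofactor has order at least \<open>N\<close>, hence lies in the
  ring.\<close>

lemma submodule_tail:
  assumes M: "is_submodule (supp_in T) M" and x: "x \<in> M" "x \<noteq> 0"
  obtains N where "supp_in {N..} \<subseteq> M"
proof -
  obtain N where N: "{N..} \<subseteq> T" using cofinite by blast
  have "f \<in> M" if f: "f \<in> supp_in {N + fls_subdegree x..}" for f
  proof (cases "f = 0")
    case True then show ?thesis using M is_submoduleD(1) by blast
  next
    case False
    have "N + fls_subdegree x \<le> fls_subdegree f" using in_supp_in_subdegree[OF False f] by simp
    moreover have "fls_subdegree (f * inverse x) = fls_subdegree f - fls_subdegree x"
      using False x by simp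
    ultimately have "f * inverse x \<in> supp_in {N..}" using False x by (intro in_supp_in_atLeastI) auto
    then have "f * inverse x \<in> supp_in T" using supp_in_mono[OF N] by blast
    then have "f * inverse x * x \<in> M" using M x is_submoduleD(3) by blast
    then show ?thesis using x by (simp add: mult.assoc)
  qed
  then show thesis using that by blast
qed

lemma frac_ideal_ring: "frac_ideal (supp_in T) (supp_in T)"
  unfolding frac_ideal_def is_submodule_def
proof (intro conjI ballI)
  show "\<exists>d\<in>supp_in T. d \<noteq> 0 \<and> (\<forall>x\<in>supp_in T. d * x \<in> supp_in T)"
    using ring_one by (intro bexI[of _ 1]) auto
  show "\<exists>x\<in>supp_in T. x \<noteq> 0" using ring_one by (intro bexI[of _ 1]) auto
qed (auto intro: ring_mult supp_in_add)

text \<open>A common denominator \<open>d\<close> bounds the orders in \<open>M\<close> from below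
  by \<open>- fls_subdegree d\<close>, so a least one is attained.\<close>

lemma frac_ideal_min_order:
  assumes "frac_ideal (supp_in T) M"
  obtains x where "x \<in> M" "x \<noteq> 0" "M \<subseteq> supp_in {fls_subdegree x..}"
proof -
  obtain d x0 where d: "d \<noteq> 0" "\<forall>x\<in>M. d * x \<in> supp_in T" and x0: "x0 \<in> M" "x0 \<noteq> 0"
    using assms unfolding frac_ideal_def by blast
  have ge: "0 \<le> fls_subdegree d + fls_subdegree x" if "x \<in> M" "x \<noteq> 0" for x
    using in_supp_in_subdegree[of "d * x" T] nonneg d that by fastforce
  obtain x where x: "x \<in> M \<and> x \<noteq> 0"
    "\<And>z. z \<in> M \<and> z \<noteq> 0 \<Longrightarrow> nat (fls_subdegree d + fls_subdegree x) \<le> nat (fls_subdegree d + fls_subdegree z)"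
    using ex_has_least_nat[of "\<lambda>x. x \<in> M \<and> x \<noteq> 0" x0 "\<lambda>x. nat (fls_subdegree d + fls_subdegree x)"] x0
    by auto
  have "z \<in> supp_in {fls_subdegree x..}" if "z \<in> M" for z
  proof (cases "z = 0")
    case False
    then show ?thesis using x(2)[of z] ge[of x] ge[of z] x(1) that by (intro in_supp_in_atLeastI) auto
  qed simp
  then show thesis using that x(1) by blast
qed

text \<open>The orthogonal complement of the ring under (f, g) -> (f g)_F. For the Frobenius number
  \<open>F\<close> it is the standard canonical fractional ideal; another \<open>F\<close> only
  shifts it by a power of t.\<close>

definition kan :: "int \<Rightarrow> 'k::field fls set" where
  "kan F = supp_in {n. F - n \<notin> T}"

lemma kan_iff: "f \<in> kan F \<longleftrightarrow> (\<forall>r\<in>supp_in T. (f * r) $$ F = 0)"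
proof (intro iffI ballI)
  fix r :: "'a fls" assume f: "f \<in> kan F" and r: "r \<in> supp_in T"
  show "(f * r) $$ F = 0"
  proof (rule ccontr)
    assume "(f * r) $$ F \<noteq> 0"
    then obtain i where "f $$ i \<noteq> 0" "r $$ (F - i) \<noteq> 0" by (rule fls_times_nth_nonzeroE)
    then show False using f r unfolding kan_def supp_in_def by blast
  qed
next
  assume a: "\<forall>r\<in>supp_in T. (f * r) $$ F = 0"
  show "f \<in> kan F" unfolding kan_def
  proof (rule supp_inI)
    fix n assume n: "f $$ n \<noteq> 0"
    have "(f * tpow (F - n)) $$ F = f $$ n" by (subst mult.commute) simp
    then show "n \<in> {n. F - n \<notin> T}" using a n by force
  qed
qed

lemma kan_submodule: "is_submodule (supp_in T) (kan F :: 'k::field fls set)"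
  unfolding is_submodule_def
proof (intro conjI ballI)
  fix r f :: "'k fls" assume r: "r \<in> supp_in T" and f: "f \<in> kan F"
  have "(r * f * s) $$ F = 0" if "s \<in> supp_in T" for s
    using f ring_mult[OF r that] unfolding kan_iff by (metis mult.commute mult.left_commute)
  then show "r * f \<in> kan F" by (simp add: kan_iff)
qed (auto simp: kan_def supp_in_add)

text \<open>Turns module duality into linear algebra: the ring factor in \<open>kan_iff\<close> is
  absorbed by \<open>M\<close>. Biduality of \<open>M\<close> thereby reduces to
  \<open>double_perp\<close>.\<close>

lemma colon_kan_iff:
  assumes "is_submodule (supp_in T) M"
  shows "y \<in> colon (kan F) M \<longleftrightarrow> (\<forall>m\<in>M. (y * m) $$ F = 0)"
proof (intro iffI ballI)
  fix m assume "y \<in> colon (kan F) M" "m \<in> M"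
  then show "(y * m) $$ F = 0" using ring_one unfolding colon_def kan_iff by fastforce
next
  assume a: "\<forall>m\<in>M. (y * m) $$ F = 0"
  show "y \<in> colon (kan F) M"
  proof (rule colonI)
    fix m assume "m \<in> M"
    then have "(y * (r * m)) $$ F = 0" if "r \<in> supp_in T" for r
      using a is_submoduleD(3)[OF assms] that by blast
    then show "y * m \<in> kan F" unfolding kan_iff by (simp add: mult_ac)
  qed
qed

theorem kan_canonical: "canonical_frac (supp_in T) (kan F :: 'k::field fls set)"
  unfolding canonical_frac_def
proof (intro conjI allI impI)
  obtain N where N: "{N..} \<subseteq> T" using cofinite by blast
  \<comment> \<open>Exponents \<open>n\<close> of \<open>kan F\<close> exceed \<open>F - N\<close>,
    so adding \<open>N + N - F\<close> brings them above \<open>N\<close>; the other entry of the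
    maximum puts \<open>d\<close> itself into \<open>T\<close>.\<close>
  define d where "d = max N (N + N - F)"
  have d: "d \<in> T" "d + n \<in> T" if "F - n \<notin> T" for n
  proof -
    have "F - n < N" using that N by (meson atLeast_iff leI subsetD)
    then have "N \<le> d + n" "N \<le> d" unfolding d_def by auto
    then show "d \<in> T" "d + n \<in> T" using N by auto
  qed
  have F1: "F - (F + 1) \<notin> T" using nonneg by force
  show "frac_ideal (supp_in T) (kan F :: 'k fls set)"
    unfolding frac_ideal_def
  proof (intro conjI kan_submodule bexI ballI)
    show "tpow d * x \<in> supp_in T" if "x \<in> kan F" for x :: "'k fls"
      using that d by (intro supp_in_mult[of _ "{d}" _ "{n. F - n \<notin> T}"]) (auto simp: kan_def)
    show "tpow d \<noteq> (0 :: 'k fls)" by simp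
    show "tpow d \<in> supp_in T" using d(1)[OF F1] by simp
    show "tpow (F + 1) \<noteq> (0 :: 'k fls)" by simp
    show "tpow (F + 1) \<in> kan F" unfolding kan_def using F1 by simp
  qed
  fix M :: "'k fls set" assume fr: "frac_ideal (supp_in T) M"
  then obtain x where M: "is_submodule (supp_in T) M" and x: "x \<in> M" "x \<noteq> 0"
    unfolding frac_ideal_def by blast
  obtain N' where N': "supp_in {N'..} \<subseteq> M" using submodule_tail[OF M x] by blast
  show "colon (kan F) (colon (kan F) M) = M"
  proof (intro equalityI subsetI)
    fix z assume "z \<in> M"
    then show "z \<in> colon (kan F) (colon (kan F) M)" by (auto simp: colon_def mult.commute)
  next
    fix z assume z: "z \<in> colon (kan F) (colon (kan F) M)"
    show "z \<in> M"
    proof (rule double_perp[OF submodule_subspace[OF M] N'])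
      fix y :: "'k fls" assume "\<And>m. m \<in> M \<Longrightarrow> (y * m) $$ F = 0"
      then have "y \<in> colon (kan F) M" using colon_kan_iff[OF M] by blast
      then have "z * y \<in> kan F" using z colonD by blast
      then have "(z * y * 1) $$ F = 0" using ring_one unfolding kan_iff by blast
      then show "(y * z) $$ F = 0" by (simp add: mult.commute)
    qed
  qed
qed

text \<open>\<open>K : R = K\<close>, so \<open>K : K = K : (K : R)\<close>, which is
  \<open>R\<close> by duality.\<close>

lemma canonical_colon_self:
  assumes "canonical_frac (supp_in T) K"
  shows "colon K K = supp_in T"
proof -
  note K = canonical_fracD(2)[OF assms]
  have "colon K (supp_in T) = K"
  proof (intro equalityI subsetI)
    fix x assume "x \<in> colon K (supp_in T)"
    then show "x \<in> K" using colonD[OF _ ring_one] by fastforce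
  qed (auto simp: colon_def mult.commute dest: is_submoduleD(3)[OF K])
  moreover have "colon K (colon K (supp_in T)) = supp_in T"
    by (rule canonical_fracD(3)[OF assms frac_ideal_ring])
  ultimately show ?thesis by simp
qed

text \<open>\<open>P = K : L\<close> satisfies \<open>P L = K\<close>, because both sides have the same \<open>K\<close>-dual.\<close>
lemma canonical_colon_prod:
  assumes K: "canonical_frac (supp_in T) K" and L: "canonical_frac (supp_in T) L"
  shows "mod_prod (colon K L) L = K"
proof -
  let ?P = "colon K L"
  let ?X = "mod_prod ?P L"
  note sK = canonical_fracD(2)[OF K] and sL = canonical_fracD(2)[OF L]
  have XK: "?X \<subseteq> K" by (rule mod_prod_subset[OF is_submoduleD(1,2)[OF sK] colonD])
  obtain d where d: "d \<noteq> 0" "\<And>x. x \<in> L \<Longrightarrow> d * x \<in> supp_in T"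
    using frac_ideal_denom[OF canonical_fracD(1)[OF L]] by metis
  obtain k where k: "k \<in> K" "k \<noteq> 0" using frac_ideal_nonzero[OF canonical_fracD(1)[OF K]] by metis
  have dk: "d * k \<in> ?P"
  proof (rule colonI)
    fix b assume "b \<in> L"
    then have "(d * b) * k \<in> K" using d k is_submoduleD(3)[OF sK] by blast
    then show "d * k * b \<in> K" by (simp add: mult_ac)
  qed
  obtain l where l: "l \<in> L" "l \<noteq> 0" using frac_ideal_nonzero[OF canonical_fracD(1)[OF L]] by metis
  have frX: "frac_ideal (supp_in T) ?X"
    unfolding frac_ideal_def is_submodule_def
  proof (intro conjI ballI)
    show "0 \<in> ?X" by (rule zero_in_mod_prod)
    show "r * x \<in> ?X" if "r \<in> supp_in T" "x \<in> ?X" for r x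
      by (rule mod_prod_scale[OF that(2)]) (use that is_submoduleD(3)[OF sL] in blast)
    show "\<exists>d\<in>supp_in T. d \<noteq> 0 \<and> (\<forall>x\<in>?X. d * x \<in> supp_in T)"
    proof -
      obtain e where "e \<in> supp_in T" "e \<noteq> 0" "\<And>x. x \<in> K \<Longrightarrow> e * x \<in> supp_in T"
        using frac_ideal_denom[OF canonical_fracD(1)[OF K]] by metis
      then show ?thesis using XK by (intro bexI[of _ e]) auto
    qed
    show "\<exists>x\<in>?X. x \<noteq> 0" by (rule bexI[OF _ mod_prodI[OF dk l(1)]]) (use d k l in simp)
  qed (rule mod_prod_add)
  have PL: "colon K ?P = L" by (rule canonical_fracD(3)[OF K canonical_fracD(1)[OF L]])
  \<comment> \<open>Adjunction: \<open>K : (P L) = (K : P) : L\<close>, and \<open>K : P = L\<close>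
    by duality.\<close>
  have "colon K ?X = colon L L"
  proof (intro equalityI subsetI)
    fix z assume z: "z \<in> colon K ?X"
    show "z \<in> colon L L"
    proof (rule colonI)
      fix b assume b: "b \<in> L"
      have "z * b \<in> colon K ?P"
      proof (rule colonI)
        fix p assume "p \<in> ?P"
        then have "z * (p * b) \<in> K" using z b mod_prodI colonD by blast
        then show "z * b * p \<in> K" by (simp add: mult_ac)
      qed
      then show "z * b \<in> L" using PL by simp
    qed
  next
    fix z assume z: "z \<in> colon L L"
    have "?X \<subseteq> {x. z * x \<in> K}"
    proof (rule mod_prod_subset)
      fix p b assume "p \<in> ?P" "b \<in> L"
      then have "p * (z * b) \<in> K" using z colonD by blast
      then show "p * b \<in> {x. z * x \<in> K}" by (simp add: mult_ac)
    qed (auto simp: distrib_left is_submoduleD(1,2)[OF sK])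
    then show "z \<in> colon K ?X" by (intro colonI) blast
  qed
  then have "colon K ?X = colon K K" by (simp add: canonical_colon_self K L)
  then have "colon K (colon K ?X) = colon K (colon K K)" by simp
  then show ?thesis by (simp add: canonical_fracD(3)[OF K frX] canonical_fracD(3)[OF K canonical_fracD(1)[OF K]])
qed

text \<open>With \<open>P = K : L\<close> and \<open>P' = L : K\<close>, all products
  \<open>p * p'\<close> lie in \<open>K : K = R\<close>. If none were a unit,
  \<open>K = P L = P P' K\<close> would consist of series of order above the least order in
  \<open>K\<close>. A unit product gives \<open>K = p L\<close>.\<close>

theorem canonical_unique:
  fixes K L :: "'k::field fls set"
  assumes K: "canonical_frac (supp_in T) K" and L: "canonical_frac (supp_in T) L"
  obtains u where "u \<noteq> 0" "K = (\<lambda>y. u * y) ` L"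
proof -
  let ?P = "colon K L" and ?P' = "colon L K"
  note sK = canonical_fracD(2)[OF K]
  have PPR: "p * p' \<in> supp_in T" if "p \<in> ?P" "p' \<in> ?P'" for p p'
  proof -
    have "p * p' \<in> colon K K" using that by (intro colonI) (metis colonD mult.assoc)
    then show ?thesis by (simp add: canonical_colon_self K)
  qed
  have "\<exists>p\<in>?P. \<exists>p'\<in>?P'. (p * p') $$ 0 \<noteq> 0"
  proof (rule ccontr)
    assume contra: "\<not> ?thesis"
    obtain x where x: "x \<in> K" "x \<noteq> 0" "K \<subseteq> supp_in {fls_subdegree x..}"
      using frac_ideal_min_order[OF canonical_fracD(1)[OF K]] by metis
    define v where "v = fls_subdegree x"
    have ppk: "p * p' * k \<in> supp_in {v + 1..}" if "p \<in> ?P" "p' \<in> ?P'" "k \<in> K" for p p' k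
    proof (rule supp_in_mult[of _ "{1..}" _ "{v..}"])
      show "p * p' \<in> supp_in {1..}"
      proof (rule supp_inI)
        fix n assume n: "(p * p') $$ n \<noteq> 0"
        then have "0 \<le> n" using PPR that ring_nth_neg by (metis not_le)
        moreover have "n \<noteq> 0" using n contra that by auto
        ultimately show "n \<in> {1..}" by simp
      qed
    qed (use that x v_def in auto)
    have "p * l \<in> supp_in {v + 1..}" if p: "p \<in> ?P" and l: "l \<in> L" for p l
    proof -
      have "mod_prod ?P' K \<subseteq> {l. p * l \<in> supp_in {v + 1..}}"
        by (rule mod_prod_subset) (use p ppk in \<open>auto simp: distrib_left supp_in_add mult.assoc\<close>)
      then show ?thesis using l canonical_colon_prod[OF L K] by blast
    qed
    then have "mod_prod ?P L \<subseteq> supp_in {v + 1..}"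
      by (intro mod_prod_subset) (auto intro: supp_in_add)
    then have "x \<in> supp_in {v + 1..}" using x canonical_colon_prod[OF K L] by blast
    then show False using in_supp_in_subdegree[OF x(2)] v_def by fastforce
  qed
  then obtain p p' where p: "p \<in> ?P" "p' \<in> ?P'" "(p * p') $$ 0 \<noteq> 0" by blast
  have inv: "inverse (p * p') \<in> supp_in T" using ring_inverse PPR p by blast
  have nz: "p \<noteq> 0" "p' \<noteq> 0" using p by auto
  have "k \<in> (\<lambda>y. p * y) ` L" if k: "k \<in> K" for k
  proof -
    have "p' * (inverse (p * p') * k) \<in> L" using p k is_submoduleD(3)[OF sK inv] colonD by blast
    moreover have "k = p * (p' * (inverse (p * p') * k))" using nz by (simp add: field_simps)
    ultimately show ?thesis by blast
  qed
  moreover have "(\<lambda>y. p * y) ` L \<subseteq> K" using p colonD by blast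
  ultimately show thesis using that[OF nz(1)] by blast
qed

end

section \<open>Colengths and value sets\<close>

context num_semigroup
begin

text \<open>Gaussian elimination by order. The lowest term of \<open>f\<close> is removed by an
  element of \<open>I\<close> if its exponent is an order in \<open>I\<close>, and otherwise by a
  gap monomial; after finitely many steps the rest is in the tail.\<close>

lemma spanned_by_gap_monomials:
  fixes I :: "'k::field fls set"
  assumes I: "fls_subspace I" and tail: "supp_in {N..} \<subseteq> I" and sub: "I \<subseteq> supp_in T"
    and D: "D = T - fls_subdegree ` (I - {0})" and fin: "finite D" and f: "f \<in> supp_in T"
  shows "\<exists>c. f - (\<Sum>i\<in>D. fls_const (c i) * tpow i) \<in> I"
proof -
  have "\<exists>c. f - (\<Sum>i\<in>D. fls_const (c i) * tpow i) \<in> I"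
    if "f \<in> supp_in T" "f \<in> supp_in {N - int k..}" for f k
    using that
  proof (induction k arbitrary: f)
    case 0
    then have "f \<in> I" using tail by auto
    then show ?case by (intro exI[of _ "\<lambda>_. 0"]) simp
  next
    case (Suc k)
    let ?M = "N - int (Suc k)"
    have step: "f' \<in> supp_in {N - int k..}" if "f' \<in> supp_in {?M..}" "f' $$ ?M = 0" for f' :: "'k fls"
    proof (rule supp_inI)
      fix n assume "f' $$ n \<noteq> 0"
      then have "n \<noteq> ?M" "n \<ge> ?M" using that supp_inD by auto
      then show "n \<in> {N - int k..}" by simp
    qed
    consider "f $$ ?M = 0" | "f $$ ?M \<noteq> 0" "?M \<in> fls_subdegree ` (I - {0})"
      | "f $$ ?M \<noteq> 0" "?M \<notin> fls_subdegree ` (I - {0})" by blast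
    then show ?case
    proof cases
      case 1
      then show ?thesis using Suc step by blast
    next
      case 2
      from this(2) obtain g where g': "?M = fls_subdegree g" "g \<in> I - {0}" by (rule imageE)
      then have g: "g \<in> I" "g \<noteq> 0" "fls_subdegree g = ?M" by simp_all
      define q where "q = fls_const (f $$ ?M / g $$ ?M) * g"
      have qI: "q \<in> I" unfolding q_def by (rule fls_subspaceD(3)[OF I g(1)])
      have gM: "g $$ ?M \<noteq> 0" using g nth_fls_subdegree_nonzero by metis
      have "g \<in> supp_in {?M..}" by (rule in_supp_in_atLeastI) (use g in auto)
      then have "f - q \<in> supp_in {?M..}"
        unfolding q_def using Suc.prems(2) by (intro supp_in_diff const_times_in_supp_in)
      moreover have "(f - q) $$ ?M = 0" using gM by (simp add: q_def)
      ultimately have "f - q \<in> supp_in {N - int k..}" by (rule step)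
      moreover have "f - q \<in> supp_in T" using Suc.prems(1) qI sub by (intro supp_in_diff) auto
      ultimately obtain c where c: "f - q - (\<Sum>i\<in>D. fls_const (c i) * tpow i) \<in> I"
        using Suc.IH by blast
      have "f - (\<Sum>i\<in>D. fls_const (c i) * tpow i) = (f - q - (\<Sum>i\<in>D. fls_const (c i) * tpow i)) + q"
        by simp
      then show ?thesis using fls_subspaceD(2)[OF I c qI] by metis
    next
      case 3
      have MD: "?M \<in> D" using 3 D supp_inD[OF Suc.prems(1)] by blast
      define q where "q = fls_const (f $$ ?M) * tpow ?M"
      have "f - q \<in> supp_in {?M..}"
        unfolding q_def using Suc.prems(2) by (intro supp_in_diff const_times_in_supp_in) auto
      moreover have "(f - q) $$ ?M = 0" by (simp add: q_def)
      ultimately have "f - q \<in> supp_in {N - int k..}" by (rule step)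
      moreover have "f - q \<in> supp_in T" unfolding q_def
        using Suc.prems(1) MD D by (intro supp_in_diff const_times_in_supp_in) auto
      ultimately obtain c where c: "f - q - (\<Sum>i\<in>D. fls_const (c i) * tpow i) \<in> I"
        using Suc.IH by blast
      define M where "M = ?M"
      define c' where "c' i = c i + (if i = M then f $$ M else 0)" for i
      have qM: "q = fls_const (f $$ M) * tpow M" and MD': "M \<in> D" using MD by (simp_all add: q_def M_def)
      have "(\<Sum>i\<in>D. fls_const (c' i) * tpow i)
          = (\<Sum>i\<in>D. fls_const (c i) * tpow i + (if i = M then q else 0))"
        by (rule sum.cong) (simp_all add: c'_def qM distrib_right flip: fls_plus_const)
      also have "\<dots> = (\<Sum>i\<in>D. fls_const (c i) * tpow i) + q"
        unfolding sum.distrib using MD' fin by (subst sum.delta) auto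
      finally have "f - (\<Sum>i\<in>D. fls_const (c' i) * tpow i) = f - q - (\<Sum>i\<in>D. fls_const (c i) * tpow i)"
        by simp
      then show ?thesis using c by metis
    qed
  qed
  \<comment> \<open>For \<open>k = nat N\<close> the bound \<open>N - int k\<close> is at most 0, so
    every element of the ring is covered.\<close>
  from this[OF f, of "nat N"] show ?thesis using f nonneg supp_in_mono[of T "{N - int (nat N)..}"] by force
qed

text \<open>Gap monomials are independent modulo \<open>I\<close>: a nonzero combination has a gap
  as its order, while orders in \<open>I\<close> are never gaps. A spanning list of the quotient
  therefore has at least \<open>card D\<close> entries.\<close>

lemma card_gaps_le_spanning:
  fixes I :: "'k::field fls set"
  assumes I: "fls_subspace I" and D: "D = T - fls_subdegree ` (I - {0})" and fin: "finite D"
    and xs: "\<And>f. f \<in> supp_in T \<Longrightarrow> \<exists>c. f - (\<Sum>i<length xs. fls_const (c i) * xs ! i) \<in> I"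
  shows "card D \<le> length xs"
proof -
  interpret V: vector_space_pair "\<lambda>c (f::'k fls). fls_const c * f" "\<lambda>c (f::'k fls). fls_const c * f"
    by (intro vector_space_pair.intro vector_space_fls)
  obtain B where B: "B \<subseteq> I" "V.vs1.independent B" "I \<subseteq> V.vs1.span B"
    using V.vs1.maximal_independent_subset by blast
  have sI: "V.vs1.subspace I" using I unfolding fls_subspace_def V.vs1.subspace_def by blast
  have spB: "V.vs1.span B = I" using V.vs1.span_minimal[OF B(1) sI] B(3) by blast
  let ?B' = "tpow ` D :: 'k fls set"
  have ind: "V.vs1.independent (B \<union> tpow ` C)" if "finite C" "C \<subseteq> D" for C
    using that
  proof (induction C rule: finite_induct)
    case empty then show ?case using B(2) by simp
  next
    case (insert i C)
    have "tpow i \<notin> V.vs1.span (B \<union> tpow ` C)"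
    proof
      assume "tpow i \<in> V.vs1.span (B \<union> tpow ` C)"
      then obtain y z where yz: "tpow i = y + z" "y \<in> I" "z \<in> V.vs1.span (tpow ` C)"
        unfolding V.vs1.span_Un spB by blast
      have "V.vs1.subspace (supp_in C :: 'k fls set)"
        unfolding V.vs1.subspace_def by (auto intro: supp_in_add const_times_in_supp_in)
      then have "V.vs1.span (tpow ` C) \<subseteq> (supp_in C :: 'k fls set)"
        by (intro V.vs1.span_minimal) auto
      then have z: "z \<in> supp_in C" using yz(3) by blast
      have y: "y = tpow i - z" using yz(1) by (simp add: algebra_simps)
      have "y $$ i = 1" using z insert.hyps by (simp add: y supp_in_nth_eq_0)
      then have y0: "y \<noteq> 0" by auto
      have "y \<in> supp_in (insert i C)"
        unfolding y using supp_in_mono[of C "insert i C"] z by (intro supp_in_diff) auto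
      then have "fls_subdegree y \<in> D" using in_supp_in_subdegree[OF y0] insert.prems by blast
      then show False using D yz(2) y0 by blast
    qed
    moreover have "V.vs1.independent (B \<union> tpow ` C)" using insert by blast
    ultimately have "V.vs1.independent (insert (tpow i) (B \<union> tpow ` C))" by (rule V.vs1.independent_insertI)
    then show ?case by simp
  qed
  \<comment> \<open>\<open>g\<close> plays the part of the quotient map: it kills \<open>I\<close>
    and fixes the gap monomials.\<close>
  from V.linear_independent_extend[OF ind[OF fin order.refl], of "\<lambda>y. if y \<in> ?B' then y else 0"]
  obtain g where g: "Vector_Spaces.linear (\<lambda>c (f::'k fls). fls_const c * f) (\<lambda>c (f::'k fls). fls_const c * f) g"
    "\<forall>y\<in>B \<union> ?B'. g y = (if y \<in> ?B' then y else 0)" by blast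
  have gB': "g y = y" if "y \<in> ?B'" for y
  proof -
    have "y \<in> B \<union> ?B'" using that by blast
    from bspec[OF g(2) this] show ?thesis unfolding if_P[OF that] .
  qed
  have gB: "g y = 0" if "y \<in> B" "y \<notin> ?B'" for y
  proof -
    have "y \<in> B \<union> ?B'" using that by blast
    from bspec[OF g(2) this] show ?thesis unfolding if_not_P[OF that(2)] .
  qed
  interpret g: Vector_Spaces.linear "\<lambda>c (f::'k fls). fls_const c * f" "\<lambda>c (f::'k fls). fls_const c * f" g
    by (rule g(1))
  have disj: "tpow i \<notin> I" if "i \<in> D" for i
  proof
    assume "tpow i \<in> I"
    then have "fls_subdegree (tpow i :: 'k fls) \<in> fls_subdegree ` (I - {0})" by (intro imageI) simp
    then show False using that D by simp
  qed
  have gI: "g m = 0" if "m \<in> I" for m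
  proof (rule V.linear_eq_0_on_span[OF g(1)])
    show "m \<in> V.vs1.span B" using that B(3) by blast
    show "g b = 0" if "b \<in> B" for b
      by (rule gB[OF that]) (use that B(1) disj in blast)
  qed
  have "b \<in> V.vs1.span (g ` set xs)" if b: "b \<in> ?B'" for b
  proof -
    have "b \<in> supp_in T" using b D by auto
    then obtain c where c: "b - (\<Sum>i<length xs. fls_const (c i) * xs ! i) \<in> I" using xs by blast
    have "b = g b" by (rule gB'[OF b, symmetric])
    also have "\<dots> = g (\<Sum>i<length xs. fls_const (c i) * xs ! i)"
      using gI[OF c] unfolding g.diff by simp
    also have "\<dots> = (\<Sum>i<length xs. fls_const (c i) * g (xs ! i))" unfolding g.sum g.scale ..
    also have "\<dots> \<in> V.vs1.span (g ` set xs)"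
      by (intro V.vs1.span_sum V.vs1.span_scale V.vs1.span_base) auto
    finally show ?thesis .
  qed
  moreover have "V.vs1.independent ?B'"
    by (rule V.vs1.independent_mono[OF ind[OF fin order.refl]]) blast
  ultimately have "card ?B' \<le> card (g ` set xs)"
    using V.vs1.independent_span_bound[of "g ` set xs" ?B'] by blast
  also have "\<dots> \<le> length xs" using card_image_le[of "set xs" g] card_length[of xs] by simp
  also have "card ?B' = card D"
    by (rule card_image[OF inj_on_inverseI[of _ fls_subdegree]]) simp
  finally show ?thesis .
qed

lemma len_eq_card:
  fixes I :: "'k::field fls set"
  assumes I: "fls_subspace I" and tail: "supp_in {N..} \<subseteq> I" and sub: "I \<subseteq> supp_in T"
  shows "len (supp_in T) I = card (T - fls_subdegree ` (I - {0}))"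
proof -
  define D where "D = T - fls_subdegree ` (I - {0})"
  have "D \<subseteq> {0..N}"
  proof
    fix n assume n: "n \<in> D"
    have "n < N"
    proof (rule ccontr)
      assume "\<not> n < N"
      then have "tpow n \<in> I" using tail by auto
      then have "fls_subdegree (tpow n :: 'k fls) \<in> fls_subdegree ` (I - {0})" by (intro imageI) simp
      then show False using n D_def by simp
    qed
    then show "n \<in> {0..N}" using n D_def nonneg by simp
  qed
  then have fin: "finite D" using finite_subset by blast
  define ys where "ys = sorted_list_of_set D"
  have ys: "set ys = D" "distinct ys" "length ys = card D" using fin by (auto simp: ys_def)
  have "len (supp_in T) I = card D"
    unfolding len_def
  proof (rule Least_equality)
    have "\<exists>c. f - (\<Sum>i<card D. fls_const (c i) * map tpow ys ! i) \<in> I" if f: "f \<in> supp_in T" for f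
    proof -
      obtain c where c: "f - (\<Sum>i\<in>D. fls_const (c i) * tpow i) \<in> I"
        using spanned_by_gap_monomials[OF I tail sub D_def fin f] by blast
      have "(\<Sum>i\<in>D. fls_const (c i) * tpow i) = (\<Sum>j<card D. fls_const (c (ys ! j)) * tpow (ys ! j))"
        by (rule sum.reindex_bij_betw[symmetric, OF bij_betw_nth]) (use ys in auto)
      also have "\<dots> = (\<Sum>j<card D. fls_const (c (ys ! j)) * map tpow ys ! j)"
        by (rule sum.cong) (use ys in auto)
      finally show ?thesis using c by (intro exI[of _ "\<lambda>j. c (ys ! j)"]) simp
    qed
    then show "\<exists>xs. length xs = card D \<and> set xs \<subseteq> supp_in T \<and>
        (\<forall>f\<in>supp_in T. \<exists>c. f - (\<Sum>i<card D. fls_const (c i) * xs ! i) \<in> I)"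
      using ys by (intro exI[of _ "map tpow ys"]) (auto simp: D_def)
  next
    fix n assume "\<exists>xs. length xs = n \<and> set xs \<subseteq> supp_in T \<and>
        (\<forall>f\<in>supp_in T. \<exists>c. f - (\<Sum>i<n. fls_const (c i) * xs ! i) \<in> I)"
    then show "card D \<le> n" using card_gaps_le_spanning[OF I D_def fin] by blast
  qed
  then show ?thesis by (simp add: D_def)
qed

end

section \<open>Almost Gorenstein semigroup rings\<close>

text \<open>Exponents of the powers of a monomial module; stage 0 is \<open>T\<close> because
  \<open>ideal_pow\<close> starts with the ring.\<close>

fun sumset_pow :: "int set \<Rightarrow> int set \<Rightarrow> nat \<Rightarrow> int set" where
  "sumset_pow T A 0 = T"
| "sumset_pow T A (Suc n) = {a + b | a b. a \<in> A \<and> b \<in> sumset_pow T A n}"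

text \<open>Only finite sums of products are allowed, so the infinite part of a series must come
  from a single product: \<open>tpow a0\<close> times a series with exponents in the tail of
  \<open>B\<close>.\<close>

lemma mod_prod_supp_in:
  assumes a0: "a0 \<in> A" and N: "{N..} \<subseteq> B"
  shows "mod_prod (supp_in A) (supp_in B) = supp_in {a + b | a b. a \<in> A \<and> b \<in> B}"
proof
  show "mod_prod (supp_in A) (supp_in B) \<subseteq> supp_in {a + b | a b. a \<in> A \<and> b \<in> B}"
    by (rule mod_prod_subset) (auto intro: supp_in_add supp_in_mult)
  show "supp_in {a + b | a b. a \<in> A \<and> b \<in> B} \<subseteq> (mod_prod (supp_in A) (supp_in B) :: 'a fls set)"
  proof (rule supp_in_subset_of_tpows)
    show "supp_in {a0 + N..} \<subseteq> (mod_prod (supp_in A) (supp_in B) :: 'a fls set)"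
    proof
      fix f :: "'a fls" assume f: "f \<in> supp_in {a0 + N..}"
      have "tpow (- a0) * f \<in> supp_in B"
        by (rule supp_in_mult[of _ "{- a0}", OF _ f]) (use N in auto)
      then have "tpow a0 * (tpow (- a0) * f) \<in> mod_prod (supp_in A) (supp_in B)"
        using a0 by (intro mod_prodI) auto
      then show "f \<in> mod_prod (supp_in A) (supp_in B)"
        by (simp add: mult.assoc[symmetric] tpow_mult tpow_0)
    qed
    fix i and c :: 'a assume "i \<in> {a + b | a b. a \<in> A \<and> b \<in> B}"
    then obtain a b where ab: "i = a + b" "a \<in> A" "b \<in> B" by blast
    then have "(fls_const c * tpow a) * tpow b \<in> mod_prod (supp_in A) (supp_in B)"
      by (intro mod_prodI const_times_in_supp_in) auto
    then show "fls_const c * tpow i \<in> mod_prod (supp_in A) (supp_in B)"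
      by (simp add: ab mult.assoc tpow_mult)
  qed (simp_all add: mod_prod_add zero_in_mod_prod)
qed

lemma mod_prod_scaled:
  "mod_prod ((\<lambda>y. u * y) ` A) ((\<lambda>y. v * y) ` B) = (\<lambda>y. (u * v) * y) ` mod_prod A B"
proof
  show "mod_prod ((\<lambda>y. u * y) ` A) ((\<lambda>y. v * y) ` B) \<subseteq> (\<lambda>y. (u * v) * y) ` mod_prod A B"
  proof (rule mod_prod_subset)
    show "0 \<in> (\<lambda>y. (u * v) * y) ` mod_prod A B" by (rule image_eqI[OF _ zero_in_mod_prod]) simp
    fix x y assume "x \<in> (\<lambda>y. (u * v) * y) ` mod_prod A B" "y \<in> (\<lambda>y. (u * v) * y) ` mod_prod A B"
    then obtain x' y' where "x' \<in> mod_prod A B" "y' \<in> mod_prod A B" "x = u * v * x'" "y = u * v * y'" by blast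
    then show "x + y \<in> (\<lambda>y. (u * v) * y) ` mod_prod A B"
      by (intro image_eqI[of _ _ "x' + y'"] mod_prod_add) (simp_all add: distrib_left)
  next
    fix a b assume "a \<in> (\<lambda>y. u * y) ` A" "b \<in> (\<lambda>y. v * y) ` B"
    then obtain a' b' where "a' \<in> A" "b' \<in> B" "a = u * a'" "b = v * b'" by blast
    then show "a * b \<in> (\<lambda>y. (u * v) * y) ` mod_prod A B"
      by (intro image_eqI[OF _ mod_prodI]) (simp_all add: mult_ac)
  qed
  have "mod_prod A B \<subseteq> {x. (u * v) * x \<in> mod_prod ((\<lambda>y. u * y) ` A) ((\<lambda>y. v * y) ` B)}"
  proof (rule mod_prod_subset)
    fix a b assume "a \<in> A" "b \<in> B"
    then have "(u * a) * (v * b) \<in> mod_prod ((\<lambda>y. u * y) ` A) ((\<lambda>y. v * y) ` B)"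
      by (intro mod_prodI imageI)
    then show "a * b \<in> {x. (u * v) * x \<in> mod_prod ((\<lambda>y. u * y) ` A) ((\<lambda>y. v * y) ` B)}"
      by (simp add: mult_ac)
  qed (simp_all add: distrib_left mod_prod_add zero_in_mod_prod)
  then show "(\<lambda>y. (u * v) * y) ` mod_prod A B \<subseteq> mod_prod ((\<lambda>y. u * y) ` A) ((\<lambda>y. v * y) ` B)"
    by blast
qed

lemma sumset_pow_tail:
  assumes "0 \<in> A" "{N..} \<subseteq> T"
  shows "{N..} \<subseteq> sumset_pow T A n"
proof (induction n)
  case (Suc n)
  have "sumset_pow T A n \<subseteq> sumset_pow T A (Suc n)" using assms(1) by force
  then show ?case using Suc by blast
qed (use assms in simp)

lemma ideal_pow_scaled:
  assumes "0 \<in> A" "{N..} \<subseteq> T"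
  shows "ideal_pow (supp_in T) ((\<lambda>y. w * y) ` supp_in A) n = (\<lambda>y. w ^ n * y) ` supp_in (sumset_pow T A n)"
proof (induction n)
  case (Suc n)
  then show ?case
    by (simp only: ideal_pow.simps mod_prod_scaled mod_prod_supp_in[OF assms(1) sumset_pow_tail[OF assms]]
        sumset_pow.simps power_Suc)
qed simp

lemma subdegree_image_scaled:
  fixes u :: "'k::field fls"
  assumes "u \<noteq> 0"
  shows "fls_subdegree ` ((\<lambda>y. u * y) ` supp_in X - {0}) = (\<lambda>x. fls_subdegree u + x) ` X"
proof (intro equalityI subsetI)
  fix n assume "n \<in> fls_subdegree ` ((\<lambda>y. u * y) ` supp_in X - {0})"
  then obtain y where y: "n = fls_subdegree (u * y)" "y \<in> supp_in X" "u * y \<noteq> 0" by blast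
  then have "y \<noteq> 0" by auto
  then show "n \<in> (\<lambda>x. fls_subdegree u + x) ` X"
    using y assms in_supp_in_subdegree[of y X] by simp
next
  fix n assume "n \<in> (\<lambda>x. fls_subdegree u + x) ` X"
  then obtain x where x: "n = fls_subdegree u + x" "x \<in> X" by blast
  show "n \<in> fls_subdegree ` ((\<lambda>y. u * y) ` supp_in X - {0})"
  proof (rule image_eqI)
    show "n = fls_subdegree (u * tpow x)" using x assms by simp
    show "u * tpow x \<in> (\<lambda>y. u * y) ` supp_in X - {0}" using x assms by auto
  qed
qed

lemma finite_nonneg_diff:
  fixes X :: "int set"
  assumes "{N..} \<subseteq> X"
  shows "finite ({0..} - X)"
proof (rule finite_subset)
  show "{0..} - X \<subseteq> {0..N}"
  proof
    fix x assume x: "x \<in> {0..} - X"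
    then have "\<not> N \<le> x" using assms by auto
    then show "x \<in> {0..N}" using x by simp
  qed
qed simp

text \<open>Both sets are compared through their complements in the nonnegative integers: a shift by
  \<open>m\<close> adds the \<open>m\<close> gaps below \<open>m\<close> and preserves the number of
  others.\<close>

lemma card_diff_shift:
  fixes T X :: "int set" and m :: int
  assumes m: "0 \<le> m" and X: "X \<subseteq> {0..}" "{N..} \<subseteq> X" and T: "T \<subseteq> {0..}" "(\<lambda>x. m + x) ` X \<subseteq> T"
  shows "int (card (T - (\<lambda>x. m + x) ` X)) = m + int (card ({0..} - X)) - int (card ({0..} - T))"
proof -
  let ?Y = "(\<lambda>x. m + x) ` X"
  have finX: "finite ({0..} - X)" by (rule finite_nonneg_diff[OF X(2)])
  have eq1: "{0..} - ?Y = {0..<m} \<union> (\<lambda>x. m + x) ` ({0..} - X)"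
  proof (intro equalityI subsetI)
    fix n assume n: "n \<in> {0..} - ?Y"
    then have "n - m \<notin> X" by force
    then show "n \<in> {0..<m} \<union> (\<lambda>x. m + x) ` ({0..} - X)" using n by (cases "n < m") (auto intro!: image_eqI[of _ _ "n - m"])
  next
    fix n assume "n \<in> {0..<m} \<union> (\<lambda>x. m + x) ` ({0..} - X)"
    then show "n \<in> {0..} - ?Y" using X(1) m by force
  qed
  have "card ({0..} - ?Y) = card {0..<m} + card ((\<lambda>x. m + x) ` ({0..} - X))"
    unfolding eq1 by (rule card_Un_disjoint) (use finX in auto)
  then have c1: "int (card ({0..} - ?Y)) = m + int (card ({0..} - X))"
    using m by (simp add: card_image)
  have finY: "finite ({0..} - ?Y)" unfolding eq1 using finX by simp
  have eq2: "{0..} - ?Y = (T - ?Y) \<union> ({0..} - T)" using T by blast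
  have "finite (T - ?Y)" "finite ({0..} - T)" using finY eq2 by (metis finite_Un)+
  then have "card ({0..} - ?Y) = card (T - ?Y) + card ({0..} - T)"
    unfolding eq2 by (intro card_Un_disjoint) auto
  then show ?thesis using c1 by simp
qed

context num_semigroup
begin

lemma ideal_pow_subset:
  assumes "is_ideal (supp_in T) J"
  shows "ideal_pow (supp_in T) J n \<subseteq> supp_in T"
proof (induction n)
  case (Suc n)
  have "mod_prod J (ideal_pow (supp_in T) J n) \<subseteq> supp_in T"
    by (rule mod_prod_subset) (use Suc assms ring_mult in \<open>auto simp: is_ideal_def intro: supp_in_add\<close>)
  then show ?case by simp
qed simp

text \<open>The length depends on \<open>w\<close> only through its order, and linearly; for
  \<open>w ^ n\<close> this exhibits the Hilbert function of a scaled monomial ideal.\<close>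

lemma len_scaled:
  fixes w :: "'k::field fls"
  assumes w: "w \<noteq> 0" and X: "X \<subseteq> {0..}" "{N..} \<subseteq> X" and d: "0 \<le> fls_subdegree w"
    and sub: "(\<lambda>y. w * y) ` supp_in X \<subseteq> supp_in T"
  shows "int (len (supp_in T) ((\<lambda>y. w * y) ` supp_in X))
    = fls_subdegree w + int (card ({0..} - X)) - int (card ({0..} - T))"
proof -
  let ?I = "(\<lambda>y. w * y) ` supp_in X"
  have "fls_subspace ?I"
    unfolding fls_subspace_def
  proof (intro conjI ballI allI)
    show "0 \<in> ?I" by (rule image_eqI[of _ _ 0]) auto
    show "x + y \<in> ?I" if "x \<in> ?I" "y \<in> ?I" for x y
      using that by (auto simp: distrib_left[symmetric] intro!: imageI supp_in_add)
    show "fls_const c * x \<in> ?I" if x: "x \<in> ?I" for c x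
    proof -
      obtain y where y: "x = w * y" "y \<in> supp_in X" using x by blast
      then show ?thesis by (intro image_eqI[of _ _ "fls_const c * y"] const_times_in_supp_in) (simp_all add: mult_ac)
    qed
  qed
  moreover have "supp_in {N + fls_subdegree w..} \<subseteq> ?I"
  proof
    fix f :: "'k fls" assume f: "f \<in> supp_in {N + fls_subdegree w..}"
    show "f \<in> ?I"
    proof (cases "f = 0")
      case True then show ?thesis by (intro image_eqI[of _ _ 0]) auto
    next
      case False
      then have "N + fls_subdegree w \<le> fls_subdegree f" using in_supp_in_subdegree[OF False f] by simp
      then have "inverse w * f \<in> supp_in {N..}" using False w by (intro in_supp_in_atLeastI) auto
      then have "inverse w * f \<in> supp_in X" using supp_in_mono[OF X(2)] by blast
      then show ?thesis using w by (intro image_eqI[of _ _ "inverse w * f"]) (auto simp: mult.assoc[symmetric])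
    qed
  qed
  ultimately have "len (supp_in T) ?I = card (T - fls_subdegree ` (?I - {0}))"
    using sub by (rule len_eq_card)
  also have "\<dots> = card (T - (\<lambda>x. fls_subdegree w + x) ` X)" by (simp only: subdegree_image_scaled[OF w])
  finally have "len (supp_in T) ?I = card (T - (\<lambda>x. fls_subdegree w + x) ` X)" .
  moreover have "(\<lambda>x. fls_subdegree w + x) ` X \<subseteq> T"
  proof
    fix n assume "n \<in> (\<lambda>x. fls_subdegree w + x) ` X"
    then obtain x where x: "n = fls_subdegree w + x" "x \<in> X" by blast
    then have "w * tpow x \<in> (\<lambda>y. w * y) ` supp_in X" by (intro imageI) simp
    then have "w * tpow x \<in> supp_in T" using sub by blast
    then show "n \<in> T" using in_supp_in_subdegree[of "w * tpow x" T] w x by simp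
  qed
  moreover have "T \<subseteq> {0..}" using nonneg by auto
  ultimately show ?thesis using card_diff_shift[OF d X] by simp
qed

text \<open>The Hilbert coefficients of a canonical ideal are read off from the value sets of its powers:
  with \<open>A\<close> the exponents of the canonical module and \<open>S\<close> the semigroup that \<open>A\<close> generates,
  the almost Gorenstein equation says \<open>|S - A| = 1\<close>.\<close>
theorem almost_gor_not_gor_semigroup:
  assumes ag: "almost_gor_not_gor (supp_in T :: 'k::field fls set)"
    and F: "F \<notin> T" "\<And>n. F < n \<Longrightarrow> n \<in> T"
  shows "\<And>h k. h \<in> T \<Longrightarrow> h \<noteq> 0 \<Longrightarrow> F - k \<notin> T \<Longrightarrow> h + k \<in> T"
    and "\<exists>f. f \<notin> T \<and> F - f \<notin> T"
proof -
  define A where "A = {n. F - n \<notin> T}"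
  have A0: "0 \<in> A" using F by (simp add: A_def)
  have An: "A \<subseteq> {0..}" using F(2) by (force simp: A_def not_less)
  have At: "{F + 1..} \<subseteq> A" using nonneg by (force simp: A_def)
  have TA: "T \<subseteq> A"
  proof
    fix t assume "t \<in> T"
    then show "t \<in> A" using add_mem[of t "F - t"] F(1) by (auto simp: A_def)
  qed
  have AT: "a + t \<in> A" if "a \<in> A" "t \<in> T" for a t
    using add_mem[of t "F - (a + t)"] that by (auto simp: A_def)
  obtain N0 where N0: "{N0..} \<subseteq> T" using cofinite by blast
  define X where "X = sumset_pow T A"
  have X1: "X 1 = A"
  proof (intro equalityI subsetI)
    fix n assume "n \<in> A"
    then show "n \<in> X 1" using zero_mem unfolding X_def One_nat_def sumset_pow.simps
      by (intro CollectI exI[of _ n] exI[of _ 0]) simp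
  qed (use AT X_def in auto)
  have XS: "X n \<subseteq> X (Suc n)" for n using A0 by (force simp: X_def)
  have Xmono: "X i \<subseteq> X j" if "i \<le> j" for i j using lift_Suc_mono_le[of X, OF XS that] .
  have Xn: "X n \<subseteq> {0..}" for n
  proof (induction n)
    case 0 then show ?case using nonneg by (auto simp: X_def)
  next
    case (Suc n)
    then show ?case using An by (force simp: X_def)
  qed
  have Xt: "{N0..} \<subseteq> X n" for n unfolding X_def by (rule sumset_pow_tail[OF A0 N0])
  have Xfin: "finite ({0..} - X n)" for n by (rule finite_nonneg_diff[OF Xt])
  \<comment> \<open>The increasing sets \<open>X n\<close> become constant once the number of gaps
    is least. Minimising over \<open>1 \<le> n\<close> ensures that \<open>A = X 1\<close> lies in
    the limit.\<close>
  obtain n0 where n0: "1 \<le> n0" "\<And>n. 1 \<le> n \<Longrightarrow> card ({0..} - X n0) \<le> card ({0..} - X n)"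
    using ex_has_least_nat[of "\<lambda>n::nat. 1 \<le> n" 1 "\<lambda>n. card ({0..} - X n)"] by auto
  define S where "S = X n0"
  have stab: "X n = S" if "n0 \<le> n" for n
  proof -
    have "{0..} - X n \<subseteq> {0..} - X n0" using Xmono[OF that] by blast
    moreover have "card ({0..} - X n0) \<le> card ({0..} - X n)" using n0 that by simp
    ultimately have "{0..} - X n = {0..} - X n0" using Xfin[of n0] by (meson card_seteq)
    then show ?thesis using Xn[of n] Xn[of n0] unfolding S_def by blast
  qed
  obtain J Q e0 e1 where J: "canonical_ideal (supp_in T :: 'k fls set) J"
    and hc: "hilb_coeffs (supp_in T :: 'k fls set) J e0 e1" and e1: "e1 = e0 - int (len (supp_in T) J) + 1"
    using ag unfolding almost_gor_not_gor_def by blast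
  have idJ: "is_ideal (supp_in T) J" using J unfolding canonical_ideal_def by simp
  obtain K' x where K': "canonical_frac (supp_in T) K'" "x \<noteq> 0" "J = (\<lambda>y. x * y) ` K'"
    using J unfolding canonical_ideal_def by blast
  obtain u where u: "u \<noteq> 0" "K' = (\<lambda>y. u * y) ` kan F"
    using canonical_unique[OF K'(1) kan_canonical[of F]] by blast
  define w where "w = x * u"
  have w: "w \<noteq> 0" using K' u by (simp add: w_def)
  have Jw: "J = (\<lambda>y. w * y) ` supp_in A"
    unfolding K'(3) u(2) w_def kan_def A_def by (simp add: image_image mult.assoc)
  define d where "d = fls_subdegree w"
  have pow: "ideal_pow (supp_in T) J n = (\<lambda>y. w ^ n * y) ` supp_in (X n)" for n
    unfolding Jw X_def by (rule ideal_pow_scaled[OF A0 N0])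
  have "w * tpow 0 \<in> J" unfolding Jw by (intro imageI) (simp add: A0)
  then have "w * tpow 0 \<in> supp_in T" using idJ unfolding is_ideal_def by blast
  then have d0: "0 \<le> d" using in_supp_in_subdegree[of w T] w nonneg d_def by (simp add: tpow_0)
  have lenp: "int (len (supp_in T) (ideal_pow (supp_in T) J n))
      = int n * d + int (card ({0..} - X n)) - int (card ({0..} - T))" for n
  proof -
    have sd: "fls_subdegree (w ^ n) = int n * d" by (simp add: d_def fls_subdegree_pow)
    have "(\<lambda>y. w ^ n * y) ` supp_in (X n) \<subseteq> supp_in T"
      using ideal_pow_subset[OF idJ, of n] pow by simp
    from len_scaled[OF _ Xn Xt _ this] show ?thesis unfolding pow using w d0 by (simp add: sd)
  qed
  have lenJ: "int (len (supp_in T) J) = d + int (card ({0..} - A)) - int (card ({0..} - T))"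
  proof -
    have "(\<lambda>y. w * y) ` supp_in A \<subseteq> supp_in T" using idJ Jw by (simp add: is_ideal_def)
    from len_scaled[OF w An At _ this] show ?thesis using d0 Jw by (simp add: d_def)
  qed
  obtain N where N: "\<And>n. N \<le> n \<Longrightarrow> int (len (supp_in T) (ideal_pow (supp_in T) J (Suc n))) = e0 * int (Suc n) - e1"
    using hc unfolding hilb_coeffs_def by blast
  define n where "n = max N n0"
  \<comment> \<open>Two consecutive values of an eventually linear function determine it: the slope
    is \<open>d = e0\<close>, and the constant term expresses \<open>e1\<close> as a difference of
    gap counts.\<close>
  have h1: "int (Suc n) * d + int (card ({0..} - S)) - int (card ({0..} - T)) = e0 * int (Suc n) - e1"
    using N[of n] lenp[of "Suc n"] stab[of "Suc n"] unfolding n_def by simp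
  have h2: "int (Suc (Suc n)) * d + int (card ({0..} - S)) - int (card ({0..} - T)) = e0 * int (Suc (Suc n)) - e1"
    using N[of "Suc n"] lenp[of "Suc (Suc n)"] stab[of "Suc (Suc n)"] unfolding n_def by simp
  have de: "d = e0" using h1 h2 by (simp add: algebra_simps)
  then have "int (card ({0..} - S)) - int (card ({0..} - T)) = - e1" using h1 by (simp add: algebra_simps)
  \<comment> \<open>Writing g for gap counts, \<open>e1 = g(T) - g(S)\<close> and the length of
    \<open>R/J\<close> is \<open>d + g(A) - g(T)\<close>. The almost Gorenstein equation becomes
    \<open>g(A) = g(S) + 1\<close>.\<close>
  then have gS: "card ({0..} - A) = card ({0..} - S) + 1" using e1 lenJ de by simp
  have AS: "A \<subseteq> S" using Xmono[OF n0(1)] X1 by (simp add: S_def)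
  have Sn: "S \<subseteq> {0..}" using Xn S_def by simp
  have "{0..} - A = ({0..} - S) \<union> (S - A)" using AS Sn by blast
  moreover have finSA: "finite (S - A)" by (rule finite_subset[OF _ Xfin[of 1]]) (use Sn X1 in auto)
  ultimately have "card ({0..} - A) = card ({0..} - S) + card (S - A)"
    using Xfin[of n0] by (metis Diff_disjoint Diff_Int_distrib2 Int_Diff S_def card_Un_disjoint inf_commute)
  then have card1: "card (S - A) = 1" using gS by simp
  have SA: "s + a \<in> S" if "s \<in> S" "a \<in> A" for s a
  proof -
    have "a + s \<in> X (Suc n0)" using that unfolding S_def X_def by auto
    then show ?thesis using stab[of "Suc n0"] by (simp add: add.commute)
  qed
  \<comment> \<open>For such \<open>s\<close>, \<open>F - s\<close> lies in \<open>T\<close>, so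
    \<open>F = s + (F - s)\<close> lies in \<open>S\<close>; it is not in \<open>A\<close> because 0
    is in \<open>T\<close>. As \<open>S - A\<close> has one element, \<open>s\<close> is
    \<open>F\<close>.\<close>
  have FS: "s = F" if s: "s \<in> S - A" for s
  proof -
    obtain z where z: "S - A = {z}" using card1 card_1_singletonE by blast
    have "F - s \<in> T" using s by (simp add: A_def)
    then have "s + (F - s) \<in> S" using SA[of s "F - s"] TA s by blast
    then have "F \<in> S - A" using zero_mem by (simp add: A_def)
    then show ?thesis using s unfolding z by simp
  qed
  \<comment> \<open>If \<open>h + k\<close> were a gap, adding \<open>k\<close> to
    \<open>F - (h + k)\<close> inside \<open>S\<close> would put \<open>F - h\<close> into
    \<open>S - A\<close>, which forces \<open>h = 0\<close>.\<close>
  show "h + k \<in> T" if h: "h \<in> T" "h \<noteq> 0" and k: "F - k \<notin> T" for h k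
  proof (rule ccontr)
    assume "h + k \<notin> T"
    then have "F - (h + k) \<in> A" by (simp add: A_def)
    then have "F - (h + k) \<in> S" using AS by blast
    moreover have "k \<in> A" using k by (simp add: A_def)
    ultimately have "F - (h + k) + k \<in> S" by (rule SA)
    moreover have "F - h \<notin> A" using h by (simp add: A_def)
    ultimately have "F - h = F" using FS[of "F - h"] by simp
    then show False using h by simp
  qed
  show "\<exists>f. f \<notin> T \<and> F - f \<notin> T"
  proof (rule ccontr)
    assume "\<not> ?thesis"
    then have AeqT: "A = T" using TA by (auto simp: A_def)
    have "X n = T" for n
    proof (induction n)
      case (Suc n)
      have "X (Suc n) \<subseteq> T" using Suc AeqT add_mem by (auto simp: X_def)
      then show ?case using XS[of n] Suc by blast
    qed (simp add: X_def)
    then show False using card1 AeqT by (simp add: S_def)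
  qed
qed

end

section \<open>Ulrich ideals\<close>

lemma gen_single: "gen R [a] = (\<lambda>y. a * y) ` R"
proof (intro equalityI subsetI)
  fix x assume "x \<in> gen R [a]"
  then obtain r :: "nat \<Rightarrow> 'a fls" where "x = r 0 * a" "r 0 \<in> R" unfolding gen_def by auto
  then show "x \<in> (\<lambda>y. a * y) ` R" by (intro image_eqI[of _ _ "r 0"]) (simp_all add: mult.commute)
next
  fix x assume "x \<in> (\<lambda>y. a * y) ` R"
  then obtain y where "x = a * y" "y \<in> R" by blast
  then show "x \<in> gen R [a]" unfolding gen_def by (intro CollectI exI[of _ "\<lambda>_. y"]) (simp add: mult.commute)
qed

lemma gen_pair: "gen R [a, b] = {r * a + s * b | r s. r \<in> R \<and> s \<in> R}"
proof (intro equalityI subsetI)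
  fix x assume "x \<in> gen R [a, b]"
  then obtain r :: "nat \<Rightarrow> 'a fls" where "x = r 0 * a + r 1 * b" "r 0 \<in> R" "r 1 \<in> R"
    unfolding gen_def by (auto simp: numeral_2_eq_2 less_Suc_eq)
  then show "x \<in> {r * a + s * b | r s. r \<in> R \<and> s \<in> R}" by blast
next
  fix x assume "x \<in> {r * a + s * b | r s. r \<in> R \<and> s \<in> R}"
  then obtain r s where "x = r * a + s * b" "r \<in> R" "s \<in> R" by blast
  then show "x \<in> gen R [a, b]" unfolding gen_def
    by (intro CollectI exI[of _ "\<lambda>i. if i = 0 then r else s"]) (auto simp: numeral_2_eq_2 less_Suc_eq)
qed

context num_semigroup
begin

lemma ideal_submodule: "is_ideal (supp_in T) I \<Longrightarrow> is_submodule (supp_in T) I"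
  by (simp add: is_ideal_def is_submodule_def)

lemma submodule_sum:
  assumes "is_submodule (supp_in T) M" "\<And>i. i \<in> A \<Longrightarrow> f i \<in> M"
  shows "sum f A \<in> M"
  using assms(2)
  by (induction A rule: infinite_finite_induct) (simp_all add: is_submoduleD(1,2)[OF assms(1)])

lemma gen_submodule:
  fixes xs :: "'k::field fls list"
  shows "is_submodule (supp_in T) (gen (supp_in T) xs)"
  unfolding is_submodule_def
proof (intro conjI ballI)
  show "0 \<in> gen (supp_in T) xs" unfolding gen_def by (intro CollectI exI[of _ "\<lambda>_. 0"]) simp
next
  fix x y assume "x \<in> gen (supp_in T) xs" "y \<in> gen (supp_in T) xs"
  then obtain r s where "x = (\<Sum>i<length xs. r i * xs ! i)" "y = (\<Sum>i<length xs. s i * xs ! i)"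
    and "\<forall>i<length xs. r i \<in> supp_in T" "\<forall>i<length xs. s i \<in> supp_in T" unfolding gen_def by blast
  then show "x + y \<in> gen (supp_in T) xs" unfolding gen_def
    by (intro CollectI exI[of _ "\<lambda>i. r i + s i"]) (simp add: distrib_right sum.distrib supp_in_add)
next
  fix c x :: "'k fls" assume c: "c \<in> supp_in T" and "x \<in> gen (supp_in T) xs"
  then obtain r where "x = (\<Sum>i<length xs. r i * xs ! i)" "\<forall>i<length xs. r i \<in> supp_in T"
    unfolding gen_def by blast
  then show "c * x \<in> gen (supp_in T) xs" unfolding gen_def
    by (intro CollectI exI[of _ "\<lambda>i. c * r i"]) (simp add: sum_distrib_left mult.assoc ring_mult[OF c])
qed

lemma gen_subset:
  assumes "is_submodule (supp_in T) M" "set xs \<subseteq> M"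
  shows "gen (supp_in T) xs \<subseteq> M"
proof
  fix x assume "x \<in> gen (supp_in T) xs"
  then obtain r where "x = (\<Sum>i<length xs. r i * xs ! i)" "\<forall>i<length xs. r i \<in> supp_in T"
    unfolding gen_def by blast
  then show "x \<in> M" using assms(2) nth_mem
    by (auto intro!: submodule_sum[OF assms(1)] is_submoduleD(3)[OF assms(1)])
qed

lemma gen_superset: "set xs \<subseteq> gen (supp_in T) xs"
proof
  fix x assume "x \<in> set xs"
  then obtain j where j: "j < length xs" "x = xs ! j" by (metis in_set_conv_nth)
  have "(\<Sum>i<length xs. (if i = j then 1 else 0) * xs ! i) = (\<Sum>i<length xs. if i = j then xs ! j else 0)"
    by (rule sum.cong) auto
  also have "\<dots> = x" using j by (simp add: sum.delta)
  finally show "x \<in> gen (supp_in T) xs" unfolding gen_def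
    by (intro CollectI exI[of _ "\<lambda>i. if i = j then 1 else 0"]) (simp add: ring_one)
qed

lemma mod_prod_ring: "is_submodule (supp_in T) I \<Longrightarrow> mod_prod I (supp_in T) = I"
proof (intro equalityI subsetI)
  assume I: "is_submodule (supp_in T) I"
  have "mod_prod I (supp_in T) \<subseteq> I"
  proof (rule mod_prod_subset[OF is_submoduleD(1,2)[OF I]])
    show "a * b \<in> I" if "a \<in> I" "b \<in> supp_in T" for a b
      using is_submoduleD(3)[OF I that(2,1)] by (simp add: mult.commute)
  qed
  then show "x \<in> I" if "x \<in> mod_prod I (supp_in T)" for x using that by blast
  show "x \<in> mod_prod I (supp_in T)" if "x \<in> I" for x using mod_prodI[OF that ring_one] by simp
qed

lemma ideal_pow_1: "is_submodule (supp_in T) I \<Longrightarrow> ideal_pow (supp_in T) I (Suc 0) = I"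
  by (simp add: mod_prod_ring)

lemma ideal_pow_2: "is_submodule (supp_in T) I \<Longrightarrow> ideal_pow (supp_in T) I 2 = mod_prod I I"
  by (simp add: numeral_2_eq_2 mod_prod_ring)

lemma mod_prod_principal:
  assumes I: "is_submodule (supp_in T) I"
  shows "mod_prod (gen (supp_in T) [a]) I = (\<lambda>y. a * y) ` I"
proof (intro equalityI subsetI)
  have "mod_prod (gen (supp_in T) [a]) I \<subseteq> (\<lambda>y. a * y) ` I"
  proof (rule mod_prod_subset)
    show "0 \<in> (\<lambda>y. a * y) ` I" using is_submoduleD(1)[OF I] by (intro image_eqI[of _ _ 0]) auto
    fix x y assume "x \<in> (\<lambda>y. a * y) ` I" "y \<in> (\<lambda>y. a * y) ` I"
    then show "x + y \<in> (\<lambda>y. a * y) ` I" 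
      by (auto simp: distrib_left[symmetric] intro!: imageI is_submoduleD(2)[OF I])
  next
    fix b c assume "b \<in> gen (supp_in T) [a]" "c \<in> I"
    then obtain r where "b = a * r" "r \<in> supp_in T" by (auto simp: gen_single)
    then show "b * c \<in> (\<lambda>y. a * y) ` I" using is_submoduleD(3)[OF I _ \<open>c \<in> I\<close>]
      by (intro image_eqI[of _ _ "r * c"]) (simp_all add: mult.assoc)
  qed
  then show "x \<in> (\<lambda>y. a * y) ` I" if "x \<in> mod_prod (gen (supp_in T) [a]) I" for x using that by blast
  fix x assume "x \<in> (\<lambda>y. a * y) ` I"
  then show "x \<in> mod_prod (gen (supp_in T) [a]) I"
    using gen_superset[of "[a]"] by (auto intro: mod_prodI)
qed

end

text \<open>The Ulrich conditions with \<open>Q = (a)\<close> and \<open>I^2 = a I\<close>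
  substituted. The list \<open>xs\<close> lifts a basis of \<open>I / I^2\<close> and need not
  contain \<open>a\<close>.\<close>

locale ulrich_ideal = num_semigroup T for T :: "int set" +
  fixes I :: "'k::field fls set" and a :: "'k fls" and xs :: "'k fls list"
  assumes ideal: "is_ideal (supp_in T) I"
    and proper: "I \<noteq> supp_in T"
    and a: "a \<in> I" "a \<noteq> 0"
    and not_principal: "I \<noteq> (\<lambda>y. a * y) ` supp_in T"
    and square: "x \<in> I \<Longrightarrow> y \<in> I \<Longrightarrow> x * y \<in> (\<lambda>y. a * y) ` I"
    and xs: "set xs \<subseteq> I"
    and span: "x \<in> I \<Longrightarrow> \<exists>r. (\<forall>i<length xs. r i \<in> supp_in T)
      \<and> x - (\<Sum>i<length xs. r i * xs ! i) \<in> (\<lambda>y. a * y) ` I"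
    and indep: "(\<And>i. i < length xs \<Longrightarrow> r i \<in> supp_in T)
      \<Longrightarrow> (\<Sum>i<length xs. r i * xs ! i) \<in> (\<lambda>y. a * y) ` I \<Longrightarrow> i < length xs \<Longrightarrow> r i \<in> I"

lemma (in num_semigroup) ulrich_imp_ulrich_ideal:
  fixes I :: "'k::field fls set"
  assumes "ulrich (supp_in T) I"
  obtains a xs where "ulrich_ideal T I a xs"
proof -
  obtain Q where mI: "m_primary (supp_in T) I" and qf: "quot_free (supp_in T) I"
    and pr: "param_reduction (supp_in T) Q I" and IQ: "I \<noteq> Q"
    and sq: "ideal_pow (supp_in T) I 2 = mod_prod Q I"
    using assms unfolding ulrich_def by blast
  have ideal: "is_ideal (supp_in T) I" and proper: "I \<noteq> supp_in T" using mI unfolding m_primary_def by auto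
  note sm = ideal_submodule[OF ideal]
  obtain a where Q: "Q = gen (supp_in T) [a]" and mQ: "m_primary (supp_in T) Q" and QI: "Q \<subseteq> I"
    using pr unfolding param_reduction_def by blast
  have aI: "a \<in> I" using QI gen_superset[of "[a]"] Q by auto
  have a0: "a \<noteq> 0"
  proof
    assume "a = 0"
    then have Q0: "Q \<subseteq> {0}" unfolding Q gen_single by auto
    obtain n where n: "ideal_pow (supp_in T) (max_ideal (supp_in T)) n \<subseteq> Q"
      using mQ unfolding m_primary_def by blast
    obtain N where N: "{N..} \<subseteq> T" using cofinite by blast
    \<comment> \<open>\<open>N\<close> puts the exponent into \<open>T\<close>, and 1 keeps the
      monomial in the maximal ideal. Its powers are nonzero, so an m-primary \<open>Q\<close> cannot
      be 0.\<close>
    define h where "h = max N 1"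
    have hm: "(tpow h :: 'k fls) \<in> max_ideal (supp_in T)" using N by (auto simp: max_ideal_def h_def)
    have "(tpow (h * int k) :: 'k fls) \<in> ideal_pow (supp_in T) (max_ideal (supp_in T)) k" for k
    proof (induction k)
      case 0 then show ?case by (simp add: tpow_0 ring_one)
    next
      case (Suc k)
      have "(tpow h * tpow (h * int k) :: 'k fls) \<in> ideal_pow (supp_in T) (max_ideal (supp_in T)) (Suc k)"
        using mod_prodI[OF hm Suc] by simp
      then show ?case by (simp add: tpow_mult algebra_simps)
    qed
    then have "tpow (h * int n) \<in> Q" using n by blast
    then have "(tpow (h * int n) :: 'k fls) = 0" using Q0 by blast
    then show False by simp
  qed
  have II: "ideal_pow (supp_in T) I 2 = (\<lambda>y. a * y) ` I"
    unfolding sq Q by (rule mod_prod_principal[OF sm])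
  obtain xs where xs: "set xs \<subseteq> I"
    "\<forall>x\<in>I. \<exists>r. (\<forall>i<length xs. r i \<in> supp_in T) \<and> x - (\<Sum>i<length xs. r i * xs ! i) \<in> (\<lambda>y. a * y) ` I"
    "\<forall>r. (\<forall>i<length xs. r i \<in> supp_in T) \<longrightarrow> (\<Sum>i<length xs. r i * xs ! i) \<in> (\<lambda>y. a * y) ` I
            \<longrightarrow> (\<forall>i<length xs. r i \<in> I)"
    using qf unfolding quot_free_def II by (elim exE conjE) (rule that)
  have "ulrich_ideal T I a xs"
  proof (intro ulrich_ideal.intro num_semigroup_axioms ulrich_ideal_axioms.intro)
    show "I \<noteq> (\<lambda>y. a * y) ` supp_in T" using IQ unfolding Q gen_single .
    show "x * y \<in> (\<lambda>y. a * y) ` I" if "x \<in> I" "y \<in> I" for x y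
      using mod_prodI[OF that] II ideal_pow_2[OF sm] by simp
    fix r i
    show "(\<And>i. i < length xs \<Longrightarrow> r i \<in> supp_in T) \<Longrightarrow>
      (\<Sum>i<length xs. r i * xs ! i) \<in> (\<lambda>y. a * y) ` I \<Longrightarrow> i < length xs \<Longrightarrow> r i \<in> I"
      using xs(3)[rule_format, of r] by simp
    show "\<exists>r. (\<forall>i<length xs. r i \<in> supp_in T) \<and> x - (\<Sum>i<length xs. r i * xs ! i) \<in> (\<lambda>y. a * y) ` I"
      if "x \<in> I" for x using bspec[OF xs(2) that] .
  qed (rule ideal proper aI a0 xs(1))+
  then show thesis by (rule that)
qed

context ulrich_ideal
begin

lemma submodule: "is_submodule (supp_in T) I"
  by (rule ideal_submodule[OF ideal])

lemmas I_zero = is_submoduleD(1)[OF submodule]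
  and I_add = is_submoduleD(2)[OF submodule]
  and I_scale = is_submoduleD(3)[OF submodule]
  and I_diff = submodule_diff[OF submodule]

lemma I_ring: "x \<in> I \<Longrightarrow> x \<in> supp_in T"
  using ideal by (auto simp: is_ideal_def)

lemma nth_0: "x \<in> I \<Longrightarrow> x $$ 0 = 0"
proof (rule ccontr)
  assume x: "x \<in> I" and "x $$ 0 \<noteq> 0"
  then have "inverse x \<in> supp_in T" "x \<noteq> 0" using ring_inverse I_ring by auto
  then have "1 \<in> I" using I_scale[of "inverse x" x] x by simp
  then have "supp_in T \<subseteq> I" using I_scale[of _ 1] by auto
  then show False using proper I_ring by blast
qed

lemma aI_zero: "0 \<in> (\<lambda>y. a * y) ` I"
  using I_zero by (intro image_eqI[of _ _ 0]) auto

lemma aI_diff: "x \<in> (\<lambda>y. a * y) ` I \<Longrightarrow> y \<in> (\<lambda>y. a * y) ` I \<Longrightarrow> x - y \<in> (\<lambda>y. a * y) ` I"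
  by (auto simp: right_diff_distrib[symmetric] intro!: imageI I_diff)

lemma aI_scale: "r \<in> supp_in T \<Longrightarrow> x \<in> (\<lambda>y. a * y) ` I \<Longrightarrow> r * x \<in> (\<lambda>y. a * y) ` I"
  by (auto simp: mult.left_commute intro!: imageI I_scale)

lemma frac_ideal: "frac_ideal (supp_in T) I"
  unfolding frac_ideal_def
proof (intro conjI submodule)
  show "\<exists>d\<in>supp_in T. d \<noteq> 0 \<and> (\<forall>x\<in>I. d * x \<in> supp_in T)"
    using ring_one I_ring by (intro bexI[of _ 1]) auto
qed (use a in blast)

text \<open>For \<open>x\<close> of least order, \<open>x * x = a * y\<close> with \<open>y\<close>
  in \<open>I\<close>. Since the order of \<open>y\<close> is at least that of \<open>x\<close>, the
  order of \<open>a\<close> is at most that of \<open>x\<close>.\<close>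

lemma order_min: "I \<subseteq> supp_in {fls_subdegree a..}"
proof -
  obtain x where x: "x \<in> I" "x \<noteq> 0" "I \<subseteq> supp_in {fls_subdegree x..}"
    using frac_ideal_min_order[OF frac_ideal] by metis
  obtain y where y: "x * x = a * y" "y \<in> I" using square[OF x(1,1)] by blast
  then have y0: "y \<noteq> 0" using x by auto
  have "fls_subdegree x + fls_subdegree x = fls_subdegree (x * x)" using x by simp
  also have "\<dots> = fls_subdegree a + fls_subdegree y" using y y0 a by simp
  finally have "fls_subdegree a \<le> fls_subdegree x"
    using in_supp_in_subdegree[OF y0, of "{fls_subdegree x..}"] x y by auto
  then show ?thesis using x(3) supp_in_mono[of "{fls_subdegree x..}" "{fls_subdegree a..}"] by auto
qed

lemma subdegree_min: "x \<in> I \<Longrightarrow> x \<noteq> 0 \<Longrightarrow> fls_subdegree a \<le> fls_subdegree x"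
  using order_min in_supp_in_subdegree by fastforce

text \<open>Expand \<open>a\<close> in the basis modulo \<open>a I\<close>. If all coefficients were
  nonunits, every term on the right would have order above that of \<open>a\<close>, since
  \<open>a\<close> has least order in \<open>I\<close>.\<close>

lemma unit_coefficient:
  obtains j s y where "j < length xs" "\<And>i. i < length xs \<Longrightarrow> s i \<in> supp_in T" "s j $$ 0 \<noteq> 0"
    "y \<in> I" "a = (\<Sum>i<length xs. s i * xs ! i) + a * y"
proof -
  obtain s y where s: "\<forall>i<length xs. s i \<in> supp_in T" "y \<in> I" "a - (\<Sum>i<length xs. s i * xs ! i) = a * y"
    using span[OF a(1)] by blast
  let ?v = "fls_subdegree a"
  have "\<exists>j<length xs. s j $$ 0 \<noteq> 0"
  proof (rule ccontr)
    assume contra: "\<not> ?thesis"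
    have pos: "r * x \<in> supp_in {?v + 1..}" if r: "r \<in> supp_in T" "r $$ 0 = 0" and x: "x \<in> I" for r x
    proof (rule supp_in_mult[of _ "{1..}" _ "{?v..}"])
      show "r \<in> supp_in {1..}"
      proof (rule supp_inI)
        fix n assume n: "r $$ n \<noteq> 0"
        then have "0 \<le> n" "n \<noteq> 0" using r ring_nth_neg[of r n] by (auto simp: not_le[symmetric])
        then show "n \<in> {1..}" by simp
      qed
    qed (use x order_min in auto)
    have "(\<Sum>i<length xs. s i * xs ! i) + y * a \<in> supp_in {?v + 1..}"
    proof (intro supp_in_add supp_in_sum pos)
      fix i assume "i \<in> {..<length xs}"
      then show "s i \<in> supp_in T" "s i $$ 0 = 0" "xs ! i \<in> I" using s contra xs by auto
    qed (use s a I_ring nth_0 in auto)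
    moreover have "a = (\<Sum>i<length xs. s i * xs ! i) + y * a" using s(3) by (simp add: algebra_simps)
    ultimately have "a \<in> supp_in {?v + 1..}" by simp
    then show False using in_supp_in_subdegree[OF a(2)] by fastforce
  qed
  moreover have "a = (\<Sum>i<length xs. s i * xs ! i) + a * y" using s(3) by (simp add: algebra_simps)
  ultimately show thesis using that s by metis
qed

text \<open>Since one coefficient of \<open>a\<close> is a unit, \<open>a\<close> can replace a basis element of \<open>I / I\<^sup>2\<close>.\<close>
lemma exchange:
  obtains j where "j < length xs"
    "\<And>r0 r i. r0 \<in> supp_in T \<Longrightarrow> (\<And>i. i < length xs \<Longrightarrow> r i \<in> supp_in T) \<Longrightarrow> r j = 0
      \<Longrightarrow> r0 * a + (\<Sum>i<length xs. r i * xs ! i) \<in> (\<lambda>y. a * y) ` I \<Longrightarrow> i < length xs \<Longrightarrow> r i \<in> I"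
proof -
  obtain j s y where j: "j < length xs" and s: "\<And>i. i < length xs \<Longrightarrow> s i \<in> supp_in T" "s j $$ 0 \<noteq> 0"
    "y \<in> I" "a = (\<Sum>i<length xs. s i * xs ! i) + a * y" using unit_coefficient by metis
  have "r i \<in> I" if r0: "r0 \<in> supp_in T" and r: "\<And>i. i < length xs \<Longrightarrow> r i \<in> supp_in T" "r j = 0"
    and sm: "r0 * a + (\<Sum>i<length xs. r i * xs ! i) \<in> (\<lambda>y. a * y) ` I" and i: "i < length xs" for r0 r i
  proof -
    define q where "q i = r0 * s i + r i" for i
    have q: "q i \<in> supp_in T" if "i < length xs" for i
      unfolding q_def using that r0 r s by (intro supp_in_add ring_mult) auto
    have "(\<Sum>i<length xs. q i * xs ! i) = r0 * (\<Sum>i<length xs. s i * xs ! i) + (\<Sum>i<length xs. r i * xs ! i)"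
      by (simp add: q_def distrib_right sum.distrib sum_distrib_left mult.assoc)
    also have "(\<Sum>i<length xs. s i * xs ! i) = a - a * y" using s(4) by (metis add_diff_cancel_right')
    also have "r0 * (a - a * y) + (\<Sum>i<length xs. r i * xs ! i)
        = (r0 * a + (\<Sum>i<length xs. r i * xs ! i)) - r0 * (a * y)" by (simp add: right_diff_distrib)
    also have "\<dots> \<in> (\<lambda>y. a * y) ` I" by (rule aI_diff[OF sm aI_scale[OF r0 imageI[OF s(3)]]])
    finally have qI: "q i \<in> I" if "i < length xs" for i using indep[of q] q that by blast
    have "s j \<noteq> 0" using s(2) by auto
    moreover have "r0 * s j \<in> I" using qI[OF j] r(2) by (simp add: q_def)
    then have "inverse (s j) * (r0 * s j) \<in> I" by (rule I_scale[OF ring_inverse[OF s(1)[OF j] s(2)]])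
    ultimately have "r0 \<in> I" by (simp add: field_simps)
    then have "q i - s i * r0 \<in> I" using qI[OF i] s(1)[OF i] I_diff I_scale by blast
    then show "r i \<in> I" by (simp add: q_def mult.commute)
  qed
  then show thesis using that[OF j] by blast
qed

text \<open>A direct form of Nakayama: \<open>(1 - y) * a\<close> is in the span and
  \<open>1 - y\<close> is a unit, so \<open>a\<close> is in the span, and with it the error terms
  from \<open>a I\<close>.\<close>

lemma gen_xs: "gen (supp_in T) xs = I"
proof
  let ?G = "gen (supp_in T) xs"
  show "?G \<subseteq> I" by (rule gen_subset[OF submodule xs])
  have inG: "(\<Sum>i<length xs. r i * xs ! i) \<in> ?G" if "\<And>i. i < length xs \<Longrightarrow> r i \<in> supp_in T" for r
    using that unfolding gen_def by blast
  obtain j s y where s: "\<And>i. i < length xs \<Longrightarrow> s i \<in> supp_in T"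
    "y \<in> I" "a = (\<Sum>i<length xs. s i * xs ! i) + a * y" using unit_coefficient by metis
  have "(1 - y) * a = (\<Sum>i<length xs. s i * xs ! i)" using s(3) by (simp add: algebra_simps)
  then have "(1 - y) * a \<in> ?G" using inG[of s] s(1) by simp
  moreover have y1: "(1 - y) $$ 0 \<noteq> 0" using nth_0[OF s(2)] by simp
  moreover have "inverse (1 - y) \<in> supp_in T"
    using y1 s(2) I_ring ring_one by (intro ring_inverse supp_in_diff) auto
  ultimately have "inverse (1 - y) * ((1 - y) * a) \<in> ?G"
    using is_submoduleD(3)[OF gen_submodule] by blast
  moreover have "1 - y \<noteq> 0" using y1 by auto
  ultimately have aG: "a \<in> ?G" by (simp add: mult.assoc[symmetric])
  show "I \<subseteq> ?G"
  proof
    fix x assume "x \<in> I"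
    then obtain r z where r: "\<forall>i<length xs. r i \<in> supp_in T" "z \<in> I" "x - (\<Sum>i<length xs. r i * xs ! i) = a * z"
      using span by blast
    have "z * a \<in> ?G" using aG I_ring[OF r(2)] is_submoduleD(3)[OF gen_submodule] by blast
    then have "(\<Sum>i<length xs. r i * xs ! i) + z * a \<in> ?G"
      using inG[of r] r(1) is_submoduleD(2)[OF gen_submodule] by blast
    then show "x \<in> ?G" using r(3) by (simp add: algebra_simps)
  qed
qed

text \<open>If \<open>z\<close> generated \<open>I\<close>, then \<open>a = z * r\<close>, and
  minimality of the order of \<open>a\<close> makes \<open>r\<close> a unit; so
  \<open>I = (a)\<close>, which is excluded.\<close>

lemma length_generators:
  assumes "gen (supp_in T) zs = I"
  shows "2 \<le> length zs"
proof (rule ccontr)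
  assume "\<not> 2 \<le> length zs"
  then consider "zs = []" | z where "zs = [z]" by (cases zs; cases "tl zs") auto
  then show False
  proof cases
    case 1
    then have "I = {0}" using assms by (auto simp: gen_def)
    then show False using a by blast
  next
    case 2
    then have I: "I = (\<lambda>y. z * y) ` supp_in T" using assms gen_single by metis
    then obtain r where r: "a = z * r" "r \<in> supp_in T" using a by blast
    have z: "z \<in> I" unfolding I by (rule image_eqI[OF _ ring_one]) simp
    have nz: "z \<noteq> 0" "r \<noteq> 0" using r a by auto
    have "fls_subdegree r \<le> 0" using subdegree_min[OF z nz(1)] r nz by simp
    moreover have "0 \<le> fls_subdegree r" using in_supp_in_subdegree[OF nz(2) r(2)] nonneg by blast
    ultimately have "r $$ 0 \<noteq> 0" using nth_fls_subdegree_nonzero[OF nz(2)] by simp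
    then have inv: "inverse r \<in> supp_in T" using ring_inverse r by blast
    have "I = (\<lambda>y. a * y) ` supp_in T"
    proof (intro equalityI subsetI)
      fix x assume "x \<in> I"
      then obtain y where y: "x = z * y" "y \<in> supp_in T" using I by blast
      then have "x = a * (inverse r * y)" using r nz by (simp add: field_simps)
      then show "x \<in> (\<lambda>y. a * y) ` supp_in T" using ring_mult[OF inv y(2)] by blast
    next
      fix x assume "x \<in> (\<lambda>y. a * y) ` supp_in T"
      then show "x \<in> I" using I_scale a by (auto simp: mult.commute)
    qed
    then show False using not_principal by simp
  qed
qed

lemma length_xs: "2 \<le> length xs"
  by (rule length_generators[OF gen_xs])

lemma mu_attained: "\<exists>zs. length zs = mu (supp_in T) I \<and> set zs \<subseteq> I \<and> gen (supp_in T) zs = I"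
  unfolding mu_def by (rule LeastI[of _ "length xs"]) (use gen_xs xs in blast)

lemma mu_eq_2: "length xs = 2 \<Longrightarrow> mu (supp_in T) I = 2"
  unfolding mu_def
  by (rule Least_equality) (use gen_xs xs length_generators in blast)+

text \<open>Gives \<open>(a) : I \<subseteq> I\<close>. For a basis element \<open>x\<close>
  independent of \<open>a\<close>, the equation \<open>r * x = a * y\<close> is a relation between
  \<open>a\<close> and \<open>x\<close>, so its coefficient \<open>r\<close> lies in
  \<open>I\<close>.\<close>

lemma annihilator:
  assumes r: "r \<in> supp_in T" "\<And>x. x \<in> I \<Longrightarrow> r * x \<in> (\<lambda>y. a * y) ` supp_in T"
  shows "r \<in> I"
proof -
  obtain j where j: "j < length xs" and ex: "\<And>r0 r i. r0 \<in> supp_in T \<Longrightarrow> (\<And>i. i < length xs \<Longrightarrow> r i \<in> supp_in T) \<Longrightarrow> r j = 0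
      \<Longrightarrow> r0 * a + (\<Sum>i<length xs. r i * xs ! i) \<in> (\<lambda>y. a * y) ` I \<Longrightarrow> i < length xs \<Longrightarrow> r i \<in> I"
    using exchange by blast
  define p where "p = (if j = 0 then 1 else 0 :: nat)"
  have p: "p < length xs" "p \<noteq> j" using length_xs by (auto simp: p_def)
  obtain y where y: "r * xs ! p = a * y" "y \<in> supp_in T" using r(2) xs p by force
  have "(\<Sum>i<length xs. (if i = p then r else 0) * xs ! i) = (\<Sum>i<length xs. if i = p then r * xs ! p else 0)"
    by (rule sum.cong) auto
  also have "\<dots> = a * y" using p y by (simp add: sum.delta)
  finally have "- y * a + (\<Sum>i<length xs. (if i = p then r else 0) * xs ! i) \<in> (\<lambda>y. a * y) ` I"
    using aI_zero by (simp add: mult.commute)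
  from ex[of "- y" "\<lambda>i. if i = p then r else 0", OF _ _ _ this p(1)]
  show ?thesis using y r p by (simp add: supp_in_uminus)
qed

lemma trace_subset:
  assumes len: "3 \<le> length xs" and K: "canonical_frac (supp_in T) K" and RK: "supp_in T \<subseteq> K"
  shows "colon (supp_in T) K \<subseteq> I"
proof
  fix c assume c: "c \<in> colon (supp_in T) K"
  have cR: "c \<in> supp_in T" using colonD[OF c, of 1] ring_one RK by auto
  note sK = canonical_fracD(2)[OF K]
  obtain j where j: "j < length xs" and ex: "\<And>r0 r i. r0 \<in> supp_in T \<Longrightarrow> (\<And>i. i < length xs \<Longrightarrow> r i \<in> supp_in T) \<Longrightarrow> r j = 0
      \<Longrightarrow> r0 * a + (\<Sum>i<length xs. r i * xs ! i) \<in> (\<lambda>y. a * y) ` I \<Longrightarrow> i < length xs \<Longrightarrow> r i \<in> I"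
    using exchange by blast
  \<comment> \<open>\<open>j\<close> is the basis position that \<open>a\<close> takes over;
    \<open>p\<close> and \<open>q\<close> are two distinct positions among the first three that
    avoid it.\<close>
  define p where "p = (if j = 0 then 1 else 0 :: nat)"
  define q where "q = (if j = 2 then 1 else 2 :: nat)"
  have pq: "p < length xs" "q < length xs" "p \<noteq> j" "q \<noteq> j" "p \<noteq> q" 
    using len by (auto simp: p_def q_def)
  define x y where "x = xs ! p" and "y = xs ! q"
  have xy: "x \<in> I" "y \<in> I" using xs pq by (auto simp: x_def y_def)
  have ind: "r1 \<in> I \<and> r2 \<in> I" if r: "r0 \<in> supp_in T" "r1 \<in> supp_in T" "r2 \<in> supp_in T"
    and eq: "r0 * a + (r1 * x + r2 * y) = 0" for r0 r1 r2
  proof -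
    define r where "r i = (if i = p then r1 else if i = q then r2 else 0)" for i
    have "(\<Sum>i<length xs. r i * xs ! i)
        = (\<Sum>i<length xs. (if i = p then r1 * x else 0) + (if i = q then r2 * y else 0))"
      by (rule sum.cong) (use pq in \<open>auto simp: r_def x_def y_def\<close>)
    also have "\<dots> = r1 * x + r2 * y" using pq by (simp add: sum.distrib sum.delta)
    finally have "r0 * a + (\<Sum>i<length xs. r i * xs ! i) \<in> (\<lambda>y. a * y) ` I" using eq aI_zero by simp
    moreover have "r i \<in> supp_in T" for i using r by (simp add: r_def)
    moreover have "r j = 0" using pq by (simp add: r_def)
    ultimately have "r i \<in> I" if "i < length xs" for i using ex[of r0 r i] r(1) that by blast
    from this[of p] this[of q] show ?thesis using pq by (simp add: r_def)
  qed
  define f g where "f = x * inverse a" and "g = y * inverse a"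
  have fg: "f * a = x" "g * a = y" using a by (simp_all add: f_def g_def mult.assoc)
  \<comment> \<open>\<open>X = K B\<close> for \<open>B = R + R f\<close>. Only
    \<open>K : X \<subseteq> I\<close> is proved: with \<open>g\<close> in \<open>K : I\<close> and
    \<open>K : (K : X) = X\<close> this suffices for \<open>g\<close> to lie in
    \<open>X\<close>.\<close>
  define X where "X = {k + l * f | k l. k \<in> K \<and> l \<in> K}"
  have XI: "k + l * f \<in> X" if "k \<in> K" "l \<in> K" for k l using that unfolding X_def by blast
  have frX: "frac_ideal (supp_in T) X"
    unfolding frac_ideal_def is_submodule_def
  proof (intro conjI ballI)
    show "0 \<in> X" using XI[of 0 0] is_submoduleD(1)[OF sK] by simp
    show "u + v \<in> X" if uv: "u \<in> X" "v \<in> X" for u v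
    proof -
      obtain k l k' l' where "u = k + l * f" "v = k' + l' * f" "k \<in> K" "l \<in> K" "k' \<in> K" "l' \<in> K"
        using uv unfolding X_def by blast
      then show ?thesis using XI[of "k + k'" "l + l'"] is_submoduleD(2)[OF sK] by (simp add: algebra_simps)
    qed
    show "r * u \<in> X" if ru: "r \<in> supp_in T" "u \<in> X" for r u
    proof -
      obtain k l where "u = k + l * f" "k \<in> K" "l \<in> K" using ru unfolding X_def by blast
      then show ?thesis using XI[of "r * k" "r * l"] is_submoduleD(3)[OF sK ru(1)] by (simp add: distrib_left mult.assoc)
    qed
    show "\<exists>d\<in>supp_in T. d \<noteq> 0 \<and> (\<forall>x\<in>X. d * x \<in> supp_in T)"
    proof -
      obtain d where d: "d \<in> supp_in T" "d \<noteq> 0" "\<And>x. x \<in> K \<Longrightarrow> d * x \<in> supp_in T"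
        using frac_ideal_denom[OF canonical_fracD(1)[OF K]] by metis
      have "d * a * u \<in> supp_in T" if u: "u \<in> X" for u
      proof -
        obtain k l where kl: "u = k + l * f" "k \<in> K" "l \<in> K" using u unfolding X_def by blast
        have "d * a * u = a * (d * k) + (d * l) * (f * a)" by (simp add: kl algebra_simps)
        then show ?thesis unfolding fg using kl d(3) a xy I_ring
          by (simp add: supp_in_add ring_mult)
      qed
      moreover have "d * a \<in> supp_in T" using ring_mult[OF d(1) I_ring[OF a(1)]] .
      ultimately show ?thesis using d a by (intro bexI[of _ "d * a"]) auto
    qed
    have "1 + 0 * f \<in> X" using XI[of 1 0] RK ring_one is_submoduleD(1)[OF sK] by blast
    then show "\<exists>x\<in>X. x \<noteq> 0" by (intro bexI[of _ 1]) auto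
  qed
  \<comment> \<open>Here both \<open>z\<close> and \<open>z * f\<close> lie in
    \<open>K : K = R\<close>, and \<open>z * x = (z * f) * a\<close> is a relation between
    \<open>a\<close> and \<open>x\<close>.\<close>
  have "colon K X \<subseteq> I"
  proof
    fix z assume z: "z \<in> colon K X"
    have "z * k \<in> K" "(z * f) * k \<in> K" if "k \<in> K" for k
      using colonD[OF z XI[OF that is_submoduleD(1)[OF sK]]] colonD[OF z XI[OF is_submoduleD(1)[OF sK] that]]
      by (simp_all add: mult_ac)
    then have "z \<in> colon K K" "z * f \<in> colon K K" by (auto intro: colonI)
    then have zR: "z \<in> supp_in T" "z * f \<in> supp_in T" by (simp_all add: canonical_colon_self[OF K])
    have "- (z * f) * a + (z * x + 0 * y) = 0" by (simp flip: fg(1))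
    from ind[OF supp_in_uminus[OF zR(2)] zR(1) supp_in_zero this] show "z \<in> I" by simp
  qed
  moreover have "g * z \<in> K" if z: "z \<in> I" for z
  proof -
    obtain v where v: "y * z = a * v" "v \<in> I" using square[OF xy(2) z] by blast
    have "g * z = (y * z) * inverse a" by (simp add: g_def mult_ac)
    also have "\<dots> = v" using v a by simp
    finally show ?thesis using v I_ring RK by blast
  qed
  ultimately have "g \<in> colon K (colon K X)" by (intro colonI) blast
  then have "g \<in> X" by (simp add: canonical_fracD(3)[OF K frX])
  then obtain k l where kl: "g = k + l * f" "k \<in> K" "l \<in> K" unfolding X_def by blast
  \<comment> \<open>Multiplying \<open>g = k + l * f\<close> by \<open>c * a\<close> clears the
    denominators: \<open>c\<close> carries \<open>K\<close> into the ring, and the coefficient of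
    \<open>y\<close> is \<open>c\<close> itself.\<close>
  have "- (c * k) * a + (- (c * l) * x + c * y) = 0"
    unfolding fg[symmetric] kl(1) by (simp add: algebra_simps)
  from ind[OF supp_in_uminus[OF colonD[OF c kl(2)]] supp_in_uminus[OF colonD[OF c kl(3)]] cR this]
  show "c \<in> I" by simp
qed

end

section \<open>Two-generated monomial Ulrich ideals\<close>

text \<open>The identity of size 3 does not factor through dimension 2. The leading minor
  \<open>D\<close> is nonzero, so by Cramer's rule the third row of coefficients vanishes.\<close>

lemma rank_two_no_three_units:
  fixes p q :: "nat \<Rightarrow> 'k::field"
  assumes "\<And>i j. i < 3 \<Longrightarrow> j < 3 \<Longrightarrow> p i * y j + q i * z j = (if i = j then 1 else 0)"
  shows False
proof -
  define D where "D = y 0 * z 1 - y 1 * z 0"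
  have e: "p 0 * y 0 + q 0 * z 0 = 1" "p 0 * y 1 + q 0 * z 1 = 0" "p 1 * y 0 + q 1 * z 0 = 0"
    "p 1 * y 1 + q 1 * z 1 = 1" "p 2 * y 0 + q 2 * z 0 = 0" "p 2 * y 1 + q 2 * z 1 = 0"
    "p 2 * y 2 + q 2 * z 2 = 1"
    using assms[of 0 0] assms[of 0 1] assms[of 1 0] assms[of 1 1] assms[of 2 0] assms[of 2 1] assms[of 2 2]
    by simp_all
  have "(p 0 * q 1 - p 1 * q 0) * D
      = (p 0 * y 0 + q 0 * z 0) * (p 1 * y 1 + q 1 * z 1) - (p 0 * y 1 + q 0 * z 1) * (p 1 * y 0 + q 1 * z 0)"
    unfolding D_def by algebra
  then have "D \<noteq> 0" using e by auto
  moreover have "p 2 * D = (p 2 * y 0 + q 2 * z 0) * z 1 - (p 2 * y 1 + q 2 * z 1) * z 0"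
    "q 2 * D = (p 2 * y 1 + q 2 * z 1) * y 0 - (p 2 * y 0 + q 2 * z 0) * y 1"
    unfolding D_def by algebra+
  then have "p 2 * D = 0" "q 2 * D = 0" unfolding e(5,6) by simp_all
  ultimately have "p 2 = 0" "q 2 = 0" by simp_all
  then show False using e by simp
qed

lemma int_least:
  fixes S :: "int set"
  assumes "S \<noteq> {}" "\<And>n. n \<in> S \<Longrightarrow> 0 \<le> n"
  obtains m where "m \<in> S" "\<And>n. n \<in> S \<Longrightarrow> m \<le> n"
proof -
  obtain s where "s \<in> S" using assms(1) by blast
  then obtain m where m: "m \<in> S" "\<And>n. n \<in> S \<Longrightarrow> nat m \<le> nat n"
    using ex_has_least_nat[of "\<lambda>n. n \<in> S" s nat] by blast
  then have "m \<le> n" if "n \<in> S" for n using m(2)[OF that] assms(2)[OF that] assms(2)[OF m(1)] by simp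
  then show thesis using that m(1) by blast
qed

context num_semigroup
begin

lemma supp_in_submodule:
  assumes "\<And>e t. e \<in> E \<Longrightarrow> t \<in> T \<Longrightarrow> e + t \<in> E"
  shows "is_submodule (supp_in T) (supp_in E)"
  unfolding is_submodule_def
proof (intro conjI ballI)
  fix r x :: "'a fls" assume "r \<in> supp_in T" "x \<in> supp_in E"
  then show "r * x \<in> supp_in E" by (rule supp_in_mult) (metis assms add.commute)
qed (simp_all add: supp_in_add)

lemma gen_tpow_pair:
  "gen (supp_in T) [tpow p, tpow q] = (supp_in {n. n - p \<in> T \<or> n - q \<in> T} :: 'k::field fls set)"
proof
  let ?E = "{n. n - p \<in> T \<or> n - q \<in> T}"
  have sub: "is_submodule (supp_in T) (supp_in ?E :: 'k fls set)"
  proof (rule supp_in_submodule)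
    fix e t assume "e \<in> ?E" "t \<in> T"
    moreover have "e + t - p = (e - p) + t" "e + t - q = (e - q) + t" by auto
    ultimately show "e + t \<in> ?E" using add_mem by (metis (no_types, lifting) mem_Collect_eq)
  qed
  show "gen (supp_in T) [tpow p, tpow q] \<subseteq> (supp_in ?E :: 'k fls set)"
    by (rule gen_subset[OF sub]) (simp add: zero_mem)
  let ?G = "gen (supp_in T) [tpow p, tpow q] :: 'k fls set"
  have G: "tpow p \<in> ?G" "tpow q \<in> ?G" using gen_superset[of "[tpow p, tpow q]"] by auto
  note sG = is_submoduleD[OF gen_submodule[of "[tpow p, tpow q :: 'k fls]"]]
  obtain N where N: "supp_in {N..} \<subseteq> ?G" using submodule_tail[OF gen_submodule G(1)] by auto
  show "supp_in ?E \<subseteq> ?G"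
  proof (rule supp_in_subset_of_tpows[OF N _ sG(2,1)])
    fix i and c :: 'k assume "i \<in> ?E"
    then consider "i - p \<in> T" | "i - q \<in> T" by blast
    then show "fls_const c * tpow i \<in> ?G"
    proof cases
      case 1
      then have "(fls_const c * tpow (i - p)) * tpow p \<in> ?G"
        by (intro sG(3) G const_times_in_supp_in) simp
      then show ?thesis by (simp add: mult.assoc tpow_mult)
    next
      case 2
      then have "(fls_const c * tpow (i - q)) * tpow q \<in> ?G"
        by (intro sG(3) G const_times_in_supp_in) simp
      then show ?thesis by (simp add: mult.assoc tpow_mult)
    qed
  qed
qed

end

context ulrich_ideal
begin

lemma tail: obtains N where "supp_in {N..} \<subseteq> I"
  using submodule_tail[OF submodule a] by blast

lemma const_in: "x \<in> I \<Longrightarrow> fls_const c * x \<in> I"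
  by (rule I_scale[OF ring_const])

lemma monomial_ideal:
  assumes S: "S \<subseteq> range (\<lambda>n. fls_X ^ n)" "I = gen_set (supp_in T) S"
  shows "I = supp_in {n. tpow n \<in> I}"
proof
  show "supp_in {n. tpow n \<in> I} \<subseteq> I"
  proof -
    obtain N where "supp_in {N..} \<subseteq> I" using tail by blast
    then show ?thesis by (rule supp_in_subset_of_tpows) (auto intro: const_in I_add I_zero)
  qed
  have SI: "s \<in> I" if "s \<in> S" for s
  proof -
    have "1 * s \<in> gen_set (supp_in T) S" unfolding gen_set_def
      by (intro CollectI exI[of _ "1::nat"] exI[of _ "\<lambda>_. 1"] exI[of _ "\<lambda>_. s"]) (simp add: that ring_one)
    then show ?thesis using S(2) by simp
  qed
  show "I \<subseteq> supp_in {n. tpow n \<in> I}"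
  proof
    fix x assume "x \<in> I"
    then obtain n r s where x: "x = (\<Sum>i<(n::nat). r i * s i)" "\<forall>i<n. r i \<in> supp_in T \<and> s i \<in> S"
      using S(2) unfolding gen_set_def by blast
    show "x \<in> supp_in {n. tpow n \<in> I}" unfolding x(1)
    proof (rule supp_in_sum)
      fix i assume "i \<in> {..<n}"
      then have ri: "r i \<in> supp_in T" and si: "s i \<in> S" using x by auto
      obtain m where "s i = fls_X ^ m" using S(1) si by blast
      then have m: "s i = tpow (int m)" by (simp add: fls_X_power_eq_tpow)
      show "r i * s i \<in> supp_in {n. tpow n \<in> I}"
      proof (rule supp_in_mult[OF ri, of _ "{int m}"])
        show "s i \<in> supp_in {int m}" by (simp add: m)
        fix t b assume "t \<in> T" "b \<in> {int m}"
        then show "t + b \<in> {n. tpow n \<in> I}"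
          using I_scale[of "tpow t" "s i"] SI[OF si] by (simp add: m tpow_mult)
      qed
    qed
  qed
qed

text \<open>A monomial ideal generated by two elements is generated by two monomials, since the coefficients
  at three minimal generators would give three independent vectors in a space of dimension two.\<close>
lemma monomial_two_generated:
  assumes E: "I = supp_in E" and mu: "mu (supp_in T) I = 2"
  obtains e0 e1 where "e0 \<in> T" "e0 \<noteq> 0" "e1 \<in> T" "e0 < e1" "e1 - e0 \<notin> T" "2 * (e1 - e0) \<in> T"
    "E = {n. n - e0 \<in> T \<or> n - e1 \<in> T}" "\<And>h. h \<in> T \<Longrightarrow> h + (e1 - e0) \<in> T \<Longrightarrow> h \<in> E"
proof -
  have tE: "tpow n \<in> I \<longleftrightarrow> n \<in> E" for n by (simp add: E)
  have ET: "n \<in> T" if "n \<in> E" for n using that tE[of n] I_ring[of "tpow n"] by simp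
  have EpT: "e + t \<in> E" if "e \<in> E" "t \<in> T" for e t
    using I_scale[of "tpow t" "tpow e"] tE that by (simp add: tpow_mult add.commute)
  define e0 where "e0 = fls_subdegree a"
  have e0: "e0 \<in> E" using in_supp_in_subdegree[OF a(2), of E] a(1) E by (simp add: e0_def)
  have e0min: "e0 \<le> n" if "n \<in> E" for n
    using subdegree_min[of "tpow n"] tE that by (simp add: e0_def)
  have en0: "e0 \<noteq> 0" using nth_0[of "tpow e0"] e0 tE[of e0] by auto
  have genE: "E \<noteq> {n. n - e0 \<in> T}"
  proof
    assume EE: "E = {n. n - e0 \<in> T}"
    have "gen (supp_in T) [tpow e0, tpow e0] = I" unfolding gen_tpow_pair E EE by simp
    moreover have "gen (supp_in T) [tpow e0, tpow e0] \<subseteq> gen (supp_in T) [tpow e0 :: 'k fls]"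
      by (rule gen_subset[OF gen_submodule]) (use gen_superset[of "[tpow e0]"] in auto)
    moreover have "gen (supp_in T) [tpow e0] \<subseteq> I"
      by (rule gen_subset[OF submodule]) (simp add: tE e0)
    ultimately have "gen (supp_in T) [tpow e0] = I" by blast
    then show False using length_generators by fastforce
  qed
  have sub0: "n \<in> E" if "n - e0 \<in> T" for n using EpT[OF e0 that] by simp
  \<comment> \<open>\<open>e0\<close> and \<open>e1\<close> are the first two minimal generators of
    \<open>E\<close> over \<open>T\<close>; the second exists because \<open>I\<close> is not
    principal.\<close>
  define E1 where "E1 = {n \<in> E. n - e0 \<notin> T}"
  have "E1 \<noteq> {}" using genE sub0 unfolding E1_def by blast
  then obtain e1 where e1: "e1 \<in> E1" "\<And>n. n \<in> E1 \<Longrightarrow> e1 \<le> n"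
    using int_least[of E1] ET nonneg unfolding E1_def by blast
  have e1E: "e1 \<in> E" "e1 - e0 \<notin> T" using e1 by (auto simp: E1_def)
  have lt: "e0 < e1" using e0min[OF e1E(1)] e1E(2) zero_mem by (cases "e0 = e1") auto
  have sub1: "n \<in> E" if "n - e1 \<in> T" for n using EpT[OF e1E(1) that] by simp
  have Eeq: "E = {n. n - e0 \<in> T \<or> n - e1 \<in> T}"
  proof (rule ccontr)
    assume ne: "E \<noteq> {n. n - e0 \<in> T \<or> n - e1 \<in> T}"
    define E2 where "E2 = {n \<in> E. n - e0 \<notin> T \<and> n - e1 \<notin> T}"
    have "E2 \<noteq> {}" using ne sub0 sub1 unfolding E2_def by blast
    then obtain e2 where e2: "e2 \<in> E2" "\<And>n. n \<in> E2 \<Longrightarrow> e2 \<le> n"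
      using int_least[of E2] ET nonneg unfolding E2_def by blast
    have e2E: "e2 \<in> E" "e2 - e0 \<notin> T" "e2 - e1 \<notin> T" using e2 by (auto simp: E2_def)
    have min: "n = e" if e: "e \<in> {e0, e1, e2}" and n: "n \<in> E" "e - n \<in> T" for e n
    proof (rule ccontr)
      assume "n \<noteq> e"
      then have l: "n < e" using nonneg[OF n(2)] by simp
      have tr: "e - m \<in> T" if "n - m \<in> T" for m using add_mem[OF that n(2)] by simp
      consider "e = e0" | "e = e1" | "e = e2" using e by blast
      then show False
      proof cases
        case 1 then show ?thesis using e0min[OF n(1)] l by simp
      next
        case 2
        then have "n \<notin> E1" using e1(2)[of n] l by auto
        then have "n - e0 \<in> T" using n by (simp add: E1_def)
        then show ?thesis using tr 2 e1E by blast
      next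
        case 3
        then have "n \<notin> E2" using e2(2)[of n] l by auto
        then have "n - e0 \<in> T \<or> n - e1 \<in> T" using n by (simp add: E2_def)
        then show ?thesis using tr 3 e2E by blast
      qed
    qed
    \<comment> \<open>A minimal generator is no sum of an element of \<open>E\<close> and a nonzero
      element of \<open>T\<close>. So its coefficient is a coordinate on \<open>I\<close> modulo the
      maximal ideal times \<open>I\<close>, on which \<open>r\<close> acts by its constant
      term.\<close>
    have coeff: "(r * w) $$ e = r $$ 0 * w $$ e" if e: "e \<in> {e0, e1, e2}" and r: "r \<in> supp_in T" and w: "w \<in> I" for e r w
    proof -
      have "(r * w) $$ e = r $$ 0 * w $$ (e - 0)"
      proof (rule fls_times_nth_single)
        fix i assume i: "i \<noteq> 0" "r $$ i \<noteq> 0"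
        show "w $$ (e - i) = 0"
        proof (rule ccontr)
          assume "w $$ (e - i) \<noteq> 0"
          then have "e - i \<in> E" using w E supp_inD by blast
          moreover have "i \<in> T" using i r supp_inD by blast
          ultimately show False using min[OF e, of "e - i"] i by simp
        qed
      qed
      then show ?thesis by simp
    qed
    obtain zs where zs: "length zs = 2" "set zs \<subseteq> I" "gen (supp_in T) zs = I"
      using mu_attained mu by metis
    then obtain y z where yz: "zs = [y, z]" by (auto simp: numeral_2_eq_2 length_Suc_conv)
    define ee where "ee i = (if i = 0 then e0 else if i = 1 then e1 else e2)" for i :: nat
    have eeE: "ee i \<in> {e0, e1, e2}" "ee i \<in> E" for i using e0 e1E e2E by (auto simp: ee_def)
    have "\<exists>p q. tpow (ee i) = p * y + q * z \<and> p \<in> supp_in T \<and> q \<in> supp_in T" for i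
      using eeE(2)[of i] tE[of "ee i"] zs(3) unfolding yz gen_pair by blast
    then obtain p q where pq: "\<And>i. tpow (ee i) = p i * y + q i * z" "\<And>i. p i \<in> supp_in T" "\<And>i. q i \<in> supp_in T"
      by metis
    have "p i $$ 0 * y $$ ee j + q i $$ 0 * z $$ ee j = (if i = j then 1 else 0)" if "i < 3" "j < 3" for i j
    proof -
      have "p i $$ 0 * y $$ ee j + q i $$ 0 * z $$ ee j = (p i * y + q i * z) $$ ee j"
        using coeff[OF eeE(1)] pq(2,3) zs(2) yz by simp
      also have "\<dots> = (if ee j = ee i then 1 else 0)" unfolding pq(1)[symmetric] by simp
      also have "\<dots> = (if i = j then 1 else 0)"
        using that lt e1E e2E zero_mem by (auto simp: ee_def less_Suc_eq numeral_3_eq_3 split: if_splits)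
      finally show ?thesis .
    qed
    then show False by (rule rank_two_no_three_units)
  qed
  define d where "d = e1 - e0"
  have dT: "d \<notin> T" using e1E by (simp add: d_def)
  \<comment> \<open>The square of \<open>tpow e1\<close> lies in \<open>a I\<close>, and
    \<open>a\<close> has order \<open>e0\<close>, so \<open>2 * e1 - e0\<close> is in
    \<open>E\<close>. This means \<open>2 * d\<close> or \<open>d\<close> is in \<open>T\<close>,
    and the latter is excluded.\<close>
  have d2: "2 * d \<in> T"
  proof -
    obtain y where y: "tpow e1 * tpow e1 = a * y" "y \<in> I" using square[of "tpow e1" "tpow e1"] tE e1E by blast
    have y0: "y \<noteq> 0" using y(1) by (metis mult_zero_right no_zero_divisors tpow_nonzero)
    have "e1 + e1 = fls_subdegree (tpow e1 * tpow e1 :: 'k fls)" by simp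
    also have "\<dots> = e0 + fls_subdegree y" unfolding y(1) using y0 a by (simp add: e0_def)
    finally have "fls_subdegree y = e1 + e1 - e0" by simp
    then have "e1 + e1 - e0 \<in> E" using in_supp_in_subdegree[OF y0, of E] y(2) E by simp
    then show ?thesis unfolding Eeq using dT by (auto simp: d_def algebra_simps)
  qed
  have hE: "h \<in> E" if h: "h \<in> T" "h + d \<in> T" for h
  proof -
    \<comment> \<open>Since \<open>2 * d\<close> is in \<open>T\<close>, \<open>D\<close> is a
      semigroup, and \<open>I\<close> divided by \<open>tpow e0\<close> has exponents in
      \<open>D\<close>. There \<open>a\<close> becomes a unit, so quotients \<open>x / a\<close>
      stay in \<open>supp_in D\<close> although \<open>a\<close> need not be a monomial;
      \<open>tpow h\<close> carries this ring into \<open>supp_in T\<close>.\<close>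
    define D where "D = {n. n \<in> T \<or> n - d \<in> T}"
    have D: "m + n \<in> D" if "m \<in> D" "n \<in> D" for m n
    proof -
      have "(m - d) + n = m + n - d" "m + (n - d) = m + n - d" "(m - d) + (n - d) + 2 * d = m + n" by auto
      then show ?thesis using that d2 add_mem unfolding D_def by (metis (no_types, lifting) mem_Collect_eq)
    qed
    have Dn: "0 \<le> n" if "n \<in> D" for n using that nonneg[of n] nonneg[of "n - d"] lt by (auto simp: D_def d_def)
    have D0: "0 \<in> D" using zero_mem by (simp add: D_def)
    have shift: "tpow (- e0) * x \<in> supp_in D" if "x \<in> I" for x
      by (rule supp_in_mult[of _ "{- e0}" _ E]) (use that E in \<open>auto simp: Eeq D_def d_def algebra_simps\<close>)
    define u where "u = tpow (- e0) * a"
    have "u $$ 0 \<noteq> 0" using a by (simp add: u_def e0_def)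
    then have invu: "inverse u \<in> supp_in D" using shift[OF a(1)] Dn D0 D unfolding u_def
      by (intro inverse_in_supp_in) auto
    have "tpow h * x \<in> (\<lambda>y. a * y) ` supp_in T" if x: "x \<in> I" for x
    proof (rule image_eqI)
      have "tpow (- e0) * x * inverse u \<in> supp_in D" by (rule supp_in_mult[OF shift[OF x] invu D])
      then show "tpow h * (tpow (- e0) * x * inverse u) \<in> supp_in T"
      proof (rule supp_in_mult[of _ "{h}", rotated])
        fix i n assume "i \<in> {h}" "n \<in> D"
        then have "n \<in> T \<or> n - d \<in> T" "i = h" by (auto simp: D_def)
        moreover have "h + d + (n - d) = h + n" by simp
        ultimately show "i + n \<in> T" using h add_mem by metis
      qed simp
      have "inverse u * u = 1" using \<open>u $$ 0 \<noteq> 0\<close> by (metis left_inverse fls_zero_nth)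
      then have "inverse u * (tpow (- e0) * a) = 1" by (simp add: u_def)
      then show "tpow h * x = a * (tpow h * (tpow (- e0) * x * inverse u))"
        by (metis (no_types, lifting) mult.assoc mult.commute mult_1)
    qed
    then have "tpow h \<in> I" using h by (intro annihilator) auto
    then show ?thesis using tE by simp
  qed
  show thesis
    using that[OF ET[OF e0] en0 ET[OF e1E(1)] lt e1E(2) d2[unfolded d_def] Eeq hE[unfolded d_def]] .
qed

end

section \<open>Numerical semigroups from generators\<close>

lemma sg_gen_Nil: "sg_gen [] = {0}"
  by (auto simp: sg_gen_def)

lemma sg_gen_snoc: "sg_gen (xs @ [a]) = {s + c * a | s c. s \<in> sg_gen xs}"
proof (intro equalityI subsetI)
  fix x assume "x \<in> sg_gen (xs @ [a])"
  then obtain c where "x = (\<Sum>i<Suc (length xs). c i * (xs @ [a]) ! i)" unfolding sg_gen_def by auto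
  then have "x = (\<Sum>i<length xs. c i * xs ! i) + c (length xs) * a" by (simp add: nth_append)
  then show "x \<in> {s + c * a | s c. s \<in> sg_gen xs}" unfolding sg_gen_def by blast
next
  fix x assume "x \<in> {s + c * a | s c. s \<in> sg_gen xs}"
  then obtain d c where x: "x = (\<Sum>i<length xs. d i * xs ! i) + c * a" unfolding sg_gen_def by blast
  define c' where "c' i = (if i < length xs then d i else c)" for i
  have "x = (\<Sum>i<length (xs @ [a]). c' i * (xs @ [a]) ! i)" by (simp add: x c'_def nth_append)
  then show "x \<in> sg_gen (xs @ [a])" unfolding sg_gen_def by blast
qed

lemma sg_gen_zero: "0 \<in> sg_gen xs"
  unfolding sg_gen_def by (intro CollectI exI[of _ "\<lambda>_. 0"]) simp

lemma sg_gen_add: "s \<in> sg_gen xs \<Longrightarrow> t \<in> sg_gen xs \<Longrightarrow> s + t \<in> sg_gen xs"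
proof -
  assume "s \<in> sg_gen xs" "t \<in> sg_gen xs"
  then obtain c d where "s = (\<Sum>i<length xs. c i * xs ! i)" "t = (\<Sum>i<length xs. d i * xs ! i)"
    unfolding sg_gen_def by blast
  then show ?thesis unfolding sg_gen_def
    by (intro CollectI exI[of _ "\<lambda>i. c i + d i"]) (simp add: distrib_right sum.distrib)
qed

lemma sg_gen_scale: "s \<in> sg_gen xs \<Longrightarrow> n * s \<in> sg_gen xs"
  by (induction n) (auto simp: sg_gen_zero sg_gen_add)

lemma sg_gen_superset: "set xs \<subseteq> sg_gen xs"
proof (induction xs rule: rev_induct)
  case (snoc a xs)
  have "0 + 1 * a \<in> sg_gen (xs @ [a])" unfolding sg_gen_snoc using sg_gen_zero by blast
  moreover have "s + 0 * a \<in> sg_gen (xs @ [a])" if "s \<in> set xs" for s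
    unfolding sg_gen_snoc using that snoc by blast
  ultimately show ?case by auto
qed simp

lemma sg_gen_double: "sg_gen (map (\<lambda>a. 2 * a) xs) = (\<lambda>s. 2 * s) ` sg_gen xs"
proof -
  have "(\<Sum>i<length xs. c i * map (\<lambda>a. 2 * a) xs ! i) = 2 * (\<Sum>i<length xs. c i * xs ! i)" for c
    unfolding sum_distrib_left by (rule sum.cong) auto
  then show ?thesis unfolding sg_gen_def by auto
qed

text \<open>A nonzero element that is no generator is a sum of at least two generators. Applied to
  \<alpha>, this bounds twice the least generator.\<close>

lemma sg_gen_not_generator:
  assumes "\<And>a. a \<in> set xs \<Longrightarrow> b \<le> a" "s \<in> sg_gen xs"
  shows "s = 0 \<or> s \<in> set xs \<or> 2 * b \<le> s"
  using assms
proof (induction xs arbitrary: s rule: rev_induct)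
  case Nil
  then show ?case by (simp add: sg_gen_Nil)
next
  case (snoc a xs)
  then obtain t c where s: "s = t + c * a" "t \<in> sg_gen xs" unfolding sg_gen_snoc by blast
  have t: "t = 0 \<or> t \<in> set xs \<or> 2 * b \<le> t" using snoc.IH[of t] snoc.prems(1) s(2) by auto
  have ba: "b \<le> a" using snoc.prems(1) by simp
  consider "c = 0" | "c = 1" | "2 \<le> c" by linarith
  then show ?case
  proof cases
    case 3
    then have "2 * b \<le> c * a" using ba by (intro mult_le_mono)
    then show ?thesis using s by simp
  next
    case 2
    then show ?thesis using s t ba snoc.prems(1)[of t] by auto
  qed (use s t in auto)
qed

text \<open>If \<open>u\<close> and \<open>v\<close> differ by the old gcd \<open>g\<close>, Bezout
  \<open>a * x = g * y + gcd a g\<close> shows that \<open>y * v + x * a\<close> and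
  \<open>y * u\<close> differ by the new one.\<close>

lemma sg_gen_Gcd:
  assumes "\<And>a. a \<in> set xs \<Longrightarrow> 0 < a"
  shows "\<exists>u v. u \<in> sg_gen xs \<and> v \<in> sg_gen xs \<and> u = v + Gcd (set xs)"
  using assms
proof (induction xs rule: rev_induct)
  case Nil
  then show ?case by (simp add: sg_gen_Nil)
next
  case (snoc a xs)
  then obtain u v where uv: "u \<in> sg_gen xs" "v \<in> sg_gen xs" "u = v + Gcd (set xs)" by auto
  let ?g = "Gcd (set xs)"
  have "a \<noteq> 0" using snoc.prems[of a] by simp
  then obtain x y where xy: "a * x = ?g * y + gcd a ?g" using bezout_nat by blast
  have "y * v + x * a \<in> sg_gen (xs @ [a])" "y * u + 0 * a \<in> sg_gen (xs @ [a])"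
    unfolding sg_gen_snoc using uv sg_gen_scale by blast+
  moreover have "y * v + x * a = (y * u + 0 * a) + Gcd (set (xs @ [a]))"
    using xy uv(3) by (simp add: algebra_simps)
  ultimately show ?case by blast
qed

text \<open>From consecutive elements \<open>v\<close> and \<open>v + 1\<close>: write
  \<open>n = q * v + r\<close>, where \<open>n \<ge> v * v\<close> ensures \<open>r \<le> q\<close>,
  and replace \<open>r\<close> copies of \<open>v\<close> by \<open>v + 1\<close>.\<close>

lemma sg_gen_cofinite:
  assumes "\<And>a. a \<in> set xs \<Longrightarrow> 0 < a" "Gcd (set xs) = 1"
  obtains N where "\<And>n. N \<le> n \<Longrightarrow> n \<in> sg_gen xs"
proof -
  obtain v where v: "v + 1 \<in> sg_gen xs" "v \<in> sg_gen xs" using sg_gen_Gcd[of xs] assms by auto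
  have "n \<in> sg_gen xs" if "v * v \<le> n" for n
  proof (cases "v = 0")
    case True
    then show ?thesis using sg_gen_scale[OF v(1), of n] by simp
  next
    case False
    define q r where "q = n div v" and "r = n mod v"
    have "r < v" using False by (simp add: r_def)
    moreover have "v \<le> q" unfolding q_def using that False by (simp add: less_eq_div_iff_mult_less_eq)
    ultimately have "r \<le> q" by simp
    have n: "n = q * v + r" by (simp add: q_def r_def)
    have "(q - r) * v + r * (v + 1) = (q - r) * v + r * v + r" by (simp add: algebra_simps)
    also have "\<dots> = q * v + r" using \<open>r \<le> q\<close> by (metis add_mult_distrib le_add_diff_inverse2)
    finally have "n = (q - r) * v + r * (v + 1)" using n by simp
    then show ?thesis using sg_gen_add[OF sg_gen_scale[OF v(2)] sg_gen_scale[OF v(1)]] by simp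
  qed
  then show thesis by (rule that)
qed

lemma num_semigroup_sg_gen:
  assumes "\<And>a. a \<in> set xs \<Longrightarrow> 0 < a" "Gcd (set xs) = 1"
  shows "num_semigroup (int ` sg_gen xs)"
proof
  obtain N where N: "\<And>n. N \<le> n \<Longrightarrow> n \<in> sg_gen xs" using sg_gen_cofinite[OF assms] by blast
  have "{int N..} \<subseteq> int ` sg_gen xs"
  proof
    fix n assume "n \<in> {int N..}"
    then have "n = int (nat n)" "nat n \<in> sg_gen xs" using N[of "nat n"] by auto
    then show "n \<in> int ` sg_gen xs" by blast
  qed
  then show "\<exists>N. {N..} \<subseteq> int ` sg_gen xs" by blast
  show "0 \<in> int ` sg_gen xs" using sg_gen_zero[of xs] by force
  show "a + b \<in> int ` sg_gen xs" if "a \<in> int ` sg_gen xs" "b \<in> int ` sg_gen xs" for a b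
    using that sg_gen_add by (force simp flip: of_nat_add)
qed auto

section \<open>Frobenius number, primary ideals and a criterion for monomial pairs\<close>

context num_semigroup
begin

text \<open>\<open>F = c - 1\<close> for the least natural \<open>c\<close> with
  \<open>{c..}\<close> inside \<open>T\<close>; it is -1 when there are no gaps.\<close>

lemma frobenius_number:
  obtains F where "F \<notin> T" "\<And>n. F < n \<Longrightarrow> n \<in> T"
proof -
  obtain N where N: "{N..} \<subseteq> T" using cofinite by blast
  let ?P = "\<lambda>c. {int c..} \<subseteq> T"
  have "?P (nat N)" using N by auto
  define c where "c = (LEAST c. ?P c)"
  have c: "?P c" unfolding c_def by (rule LeastI[of ?P, OF \<open>?P (nat N)\<close>])
  have "int c - 1 \<notin> T"
  proof
    assume m: "int c - 1 \<in> T"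
    then have c1: "1 \<le> c" using nonneg[OF m] by linarith
    have "?P (c - 1)"
    proof
      fix n assume "n \<in> {int (c - 1)..}"
      then have "n = int c - 1 \<or> n \<in> {int c..}" using c1 by auto
      then show "n \<in> T" using m c by auto
    qed
    then show False using not_less_Least[of "c - 1" ?P] c1 unfolding c_def[symmetric] by simp
  qed
  moreover have "n \<in> T" if "int c - 1 < n" for n using c that by auto
  ultimately show thesis using that by blast
qed

lemma max_ideal_pow: "ideal_pow (supp_in T) (max_ideal (supp_in T)) n \<subseteq> supp_in {int n..}"
proof (induction n)
  case 0
  have "T \<subseteq> {0..}" using nonneg by auto
  then show ?case using supp_in_mono[of T "{0..}"] by simp
next
  case (Suc n)
  have "max_ideal (supp_in T) \<subseteq> (supp_in {1..} :: 'a fls set)"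
  proof
    fix f :: "'a fls" assume f: "f \<in> max_ideal (supp_in T)"
    show "f \<in> supp_in {1..}"
    proof (rule supp_inI)
      fix i assume i: "f $$ i \<noteq> 0"
      then have "i \<in> T" "i \<noteq> 0" using f supp_inD[of f T i] by (auto simp: max_ideal_def)
      then show "i \<in> {1..}" using nonneg[of i] by simp
    qed
  qed
  then have "mod_prod (max_ideal (supp_in T)) (ideal_pow (supp_in T) (max_ideal (supp_in T)) n)
      \<subseteq> (supp_in {int (Suc n)..} :: 'a fls set)"
    by (intro mod_prod_subset) (use Suc in \<open>auto intro!: supp_in_add supp_in_mult[of _ "{1..}" _ "{int n..}"]\<close>)
  then show ?case by simp
qed

lemma m_primaryI:
  assumes "is_ideal (supp_in T) I" "I \<noteq> supp_in T" "x \<in> I" "x \<noteq> 0"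
  shows "m_primary (supp_in T) I"
proof -
  obtain N where N: "supp_in {N..} \<subseteq> I" using submodule_tail[OF ideal_submodule[OF assms(1)] assms(3,4)] by blast
  have "ideal_pow (supp_in T) (max_ideal (supp_in T)) (nat N) \<subseteq> supp_in {int (nat N)..}" by (rule max_ideal_pow)
  also have "\<dots> \<subseteq> supp_in {N..}" by (rule supp_in_mono) auto
  finally show ?thesis using N assms(1,2) unfolding m_primary_def by blast
qed

lemma gen_set_eq_gen: "gen_set (supp_in T) (set xs) = gen (supp_in T) xs"
proof (intro equalityI subsetI)
  fix x assume "x \<in> gen_set (supp_in T) (set xs)"
  then obtain n r s where x: "x = (\<Sum>i<(n::nat). r i * s i)" "\<forall>i<n. r i \<in> supp_in T \<and> s i \<in> set xs"
    unfolding gen_set_def by blast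
  show "x \<in> gen (supp_in T) xs" unfolding x(1)
    by (rule submodule_sum[OF gen_submodule]) (use x(2) gen_superset is_submoduleD(3)[OF gen_submodule] in blast)
next
  fix x assume "x \<in> gen (supp_in T) xs"
  then obtain r where r: "x = (\<Sum>i<length xs. r i * xs ! i)" "\<forall>i<length xs. r i \<in> supp_in T"
    unfolding gen_def by blast
  then show "x \<in> gen_set (supp_in T) (set xs)" unfolding gen_set_def
    by (intro CollectI exI[of _ "length xs"] exI[of _ r] exI[of _ "\<lambda>i. xs ! i"]) simp
qed

text \<open>Let \<open>d = e1 - e0\<close>. From \<open>2 * d\<close> in \<open>T\<close> the
  exponent set is stable under adding \<open>d\<close>, whence \<open>I^2 = t^e0 I\<close>. In a
  relation modulo \<open>I^2\<close> the coefficient of \<open>tpow e1\<close> has exponents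
  \<open>n\<close> with \<open>n\<close> and \<open>n + d\<close> in \<open>T\<close>, and
  \<open>ann\<close> places them in \<open>I\<close>; the other coefficient follows.\<close>

lemma ulrich_monomial_pair:
  assumes e: "e0 \<in> T" "0 < e0" "e1 \<in> T" and d: "e1 - e0 \<notin> T" "2 * (e1 - e0) \<in> T"
    and ann: "\<And>h. h \<in> T \<Longrightarrow> h + (e1 - e0) \<in> T \<Longrightarrow> h - e0 \<in> T \<or> h - e1 \<in> T"
    and pos: "0 < e1"
  defines "I \<equiv> gen (supp_in T) [tpow e0, tpow e1 :: 'k::field fls]"
  shows "ulrich (supp_in T) I" "mu (supp_in T) I = 2"
proof -
  define E where "E = {n. n - e0 \<in> T \<or> n - e1 \<in> T}"
  have I: "I = supp_in E" unfolding I_def E_def by (rule gen_tpow_pair)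
  have EpT: "n + t \<in> E" if "n \<in> E" "t \<in> T" for n t
    using that add_mem[of "n - e0" t] add_mem[of "n - e1" t] by (auto simp: E_def algebra_simps)
  have Epd: "n + (e1 - e0) \<in> E" if "n \<in> E" for n
    using that add_mem[OF _ d(2), of "n - e1"] by (auto simp: E_def algebra_simps)
  have ET: "n \<in> T \<and> 0 < n" if "n \<in> E" for n
    using that add_mem[OF _ e(1), of "n - e0"] add_mem[OF _ e(3), of "n - e1"] nonneg[of "n - e0"] nonneg[of "n - e1"] e(2) pos
    by (auto simp: E_def)
  have eE: "e0 \<in> E" "e1 \<in> E" using zero_mem by (auto simp: E_def)
  have sm: "is_submodule (supp_in T) I" unfolding I_def by (rule gen_submodule)
  have IR: "I \<subseteq> supp_in T" unfolding I by (rule supp_in_mono) (use ET in blast)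
  have idI: "is_ideal (supp_in T) I" using sm IR unfolding is_ideal_def is_submodule_def by blast
  have oneI: "1 \<notin> I" using ET[of 0] by (auto simp: I tpow_0[symmetric] simp del: tpow_0)
  have prI: "I \<noteq> supp_in T" using oneI ring_one by blast
  have mI: "m_primary (supp_in T) I"
    by (rule m_primaryI[OF idI prI, of "tpow e0"]) (simp_all add: I eE)
  define zs where "zs = [tpow e0, tpow e1 :: 'k fls]"
  have I_zs: "I = gen (supp_in T) zs" by (simp add: I_def zs_def)
  have zsI: "set zs \<subseteq> I" unfolding zs_def I using eE by simp
  define Q where "Q = gen (supp_in T) [tpow e0 :: 'k fls]"
  have QI: "Q \<subseteq> I" unfolding Q_def by (rule gen_subset[OF sm]) (simp add: I eE)
  have idQ: "is_ideal (supp_in T) Q"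
    using gen_submodule[of "[tpow e0 :: 'k fls]"] QI IR unfolding Q_def[symmetric] is_ideal_def is_submodule_def by blast
  have mQ: "m_primary (supp_in T) Q"
  proof (rule m_primaryI[OF idQ])
    show "Q \<noteq> supp_in T" using QI oneI ring_one by blast
    show "tpow e0 \<in> Q" using gen_superset[of "[tpow e0]"] by (simp add: Q_def)
  qed simp
  have aI: "mod_prod Q I = (\<lambda>y. tpow e0 * y) ` I" unfolding Q_def by (rule mod_prod_principal[OF sm])
  have sq: "mod_prod I I = (\<lambda>y. tpow e0 * y) ` I"
  proof
    have "mod_prod I I \<subseteq> {x. tpow (- e0) * x \<in> I}"
    proof (rule mod_prod_subset)
      fix x y assume xy: "x \<in> I" "y \<in> I"
      have "x * y \<in> supp_in ((\<lambda>n. e0 + n) ` E)"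
      proof (rule supp_in_mult[OF xy[unfolded I]])
        fix m n assume mn: "m \<in> E" "n \<in> E"
        have "m + n - e0 \<in> E"
        proof (cases "m - e0 \<in> T")
          case True
          then show ?thesis using EpT[OF mn(2) True] by (simp add: algebra_simps)
        next
          case False
          then have "m - e1 \<in> T" using mn by (simp add: E_def)
          then show ?thesis using EpT[OF Epd[OF mn(2)], of "m - e1"] by (simp add: algebra_simps)
        qed
        then show "m + n \<in> (\<lambda>n. e0 + n) ` E" by (intro image_eqI[of _ _ "m + n - e0"]) auto
      qed
      then have "tpow (- e0) * (x * y) \<in> supp_in E"
        by (rule supp_in_mult[of _ "{- e0}", rotated]) auto
      then show "x * y \<in> {x. tpow (- e0) * x \<in> I}" by (simp add: I)
    qed (auto simp: distrib_left is_submoduleD(1,2)[OF sm])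
    then show "mod_prod I I \<subseteq> (\<lambda>y. tpow e0 * y) ` I"
    proof (intro subsetI)
      fix x assume "x \<in> mod_prod I I" and "mod_prod I I \<subseteq> {x. tpow (- e0) * x \<in> I}"
      then have "tpow (- e0) * x \<in> I" by blast
      then show "x \<in> (\<lambda>y. tpow e0 * y) ` I"
        by (rule image_eqI[rotated]) (simp add: mult.assoc[symmetric] tpow_mult tpow_0)
    qed
    have "tpow e0 \<in> I" by (simp add: I eE)
    then show "(\<lambda>y. tpow e0 * y) ` I \<subseteq> mod_prod I I" using mod_prodI by blast
  qed
  have II: "ideal_pow (supp_in T) I 2 = mod_prod Q I" using ideal_pow_2[OF sm] sq aI by simp
  have "param_reduction (supp_in T) Q I"
    unfolding param_reduction_def
  proof (intro conjI mQ QI)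
    show "\<exists>a\<in>supp_in T. Q = gen (supp_in T) [a]" unfolding Q_def using e by (intro bexI[of _ "tpow e0"]) auto
    show "\<exists>r. ideal_pow (supp_in T) I (Suc r) = mod_prod Q (ideal_pow (supp_in T) I r)"
      using II ideal_pow_1[OF sm] by (intro exI[of _ "Suc 0"]) (simp add: numeral_2_eq_2)
  qed
  moreover have "I \<noteq> Q"
  proof
    assume "I = Q"
    moreover have "tpow e1 \<in> I" using eE by (simp add: I)
    ultimately have "tpow e1 \<in> (\<lambda>y. tpow e0 * y) ` (supp_in T :: 'k fls set)"
      unfolding Q_def gen_single by blast
    then obtain y where y: "tpow e1 = tpow e0 * y" "y \<in> (supp_in T :: 'k fls set)" by blast
    have "(tpow e0 * y) $$ e1 \<noteq> 0" unfolding y(1)[symmetric] by simp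
    then have "y $$ (e1 - e0) \<noteq> 0" by simp
    then show False using supp_inD[OF y(2)] d by blast
  qed
  moreover have "quot_free (supp_in T) I"
    unfolding quot_free_def II aI
  proof (intro exI[of _ zs] conjI ballI allI impI)
    show "set zs \<subseteq> I" by (rule zsI)
    fix x assume "x \<in> I"
    then obtain r where r: "x = (\<Sum>i<length zs. r i * zs ! i)" "\<forall>i<length zs. r i \<in> supp_in T"
      unfolding I_zs gen_def by blast
    have "0 \<in> (\<lambda>y. tpow e0 * y) ` I" by (rule image_eqI[OF _ is_submoduleD(1)[OF sm]]) simp
    then show "\<exists>r. (\<forall>i<length zs. r i \<in> supp_in T) \<and>
      x - (\<Sum>i<length zs. r i * zs ! i) \<in> (\<lambda>y. tpow e0 * y) ` I"
      using r by (intro exI[of _ r]) simp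
  next
    fix r :: "nat \<Rightarrow> 'k fls" and i
    assume "\<forall>i<length zs. r i \<in> supp_in T"
      and "(\<Sum>i<length zs. r i * zs ! i) \<in> (\<lambda>y. tpow e0 * y) ` I" and "i < length zs"
    then have r: "\<forall>i<2. r i \<in> supp_in T" and sm0: "r 0 * tpow e0 + r 1 * tpow e1 \<in> (\<lambda>y. tpow e0 * y) ` I"
      and i: "i < 2" by (simp_all add: zs_def numeral_2_eq_2)
    have r01: "r 0 \<in> supp_in T" "r 1 \<in> supp_in T" using r by auto
    obtain y where y: "r 0 * tpow e0 + r 1 * tpow e1 = tpow e0 * y" "y \<in> I"
      using sm0 by blast
    have "tpow (- e0) * (r 0 * tpow e0 + r 1 * tpow e1) = (tpow (- e0) * tpow e0) * r 0 + (tpow (- e0) * tpow e1) * r 1"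
      by (simp add: algebra_simps)
    also have "\<dots> = r 0 + tpow (e1 - e0) * r 1" by (simp add: tpow_mult tpow_0)
    also have "tpow (- e0) * (r 0 * tpow e0 + r 1 * tpow e1) = y"
      unfolding y(1) by (simp add: mult.assoc[symmetric] tpow_mult tpow_0)
    finally have eq: "tpow (e1 - e0) * r 1 = y - r 0" by simp
    have "y - r 0 \<in> supp_in T" using y(2) IR r01 by (intro supp_in_diff) auto
    have r1: "r 1 \<in> I" unfolding I
    proof (rule supp_inI)
      fix n assume n: "r 1 $$ n \<noteq> 0"
      then have "(tpow (e1 - e0) * r 1) $$ (n + (e1 - e0)) \<noteq> 0" by simp
      then have "n + (e1 - e0) \<in> T" unfolding eq using supp_inD[OF \<open>y - r 0 \<in> supp_in T\<close>] by blast
      moreover have "n \<in> T" using supp_inD[OF r01(2) n] .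
      ultimately show "n \<in> E" using ann by (simp add: E_def)
    qed
    have "tpow (e1 - e0) * r 1 \<in> I" unfolding I
      by (rule supp_in_mult[of _ "{e1 - e0}", OF _ r1[unfolded I]]) (use Epd in \<open>auto simp: add.commute\<close>)
    then have "y - (y - r 0) \<in> I" unfolding eq by (rule submodule_diff[OF sm y(2)])
    then show "r i \<in> I" using r1 i by (auto simp: less_Suc_eq numeral_2_eq_2)
  qed
  ultimately show ul: "ulrich (supp_in T) I" unfolding ulrich_def using mI II by blast
  obtain a xs where "ulrich_ideal T I a xs" using ulrich_imp_ulrich_ideal[OF ul] by blast
  then interpret U: ulrich_ideal T I a xs .
  have "2 \<le> mu (supp_in T) I" using U.mu_attained U.length_generators by metis
  moreover have "mu (supp_in T) I \<le> 2"
    unfolding mu_def by (rule Least_le, rule exI[of _ zs]) (use zsI I_zs in \<open>simp add: zs_def\<close>)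
  ultimately show "mu (supp_in T) I = 2" by simp
qed

end

section \<open>The semigroup generated by 2 H1 and an odd element\<close>

text \<open>The two parts of \<open>T\<close> are separated by parity, as \<alpha> is odd. Each
  membership in \<open>T\<close> becomes one in \<open>T1\<close>, through \<open>even_mem\<close>
  or \<open>odd_mem\<close>.\<close>

locale double_semigroup = base: num_semigroup T1 for T1 :: "int set" +
  fixes \<alpha> :: int and T :: "int set"
  assumes alpha_mem: "\<alpha> \<in> T1" and alpha_odd: "odd \<alpha>"
    and T_eq: "T = (\<lambda>j. 2 * j) ` T1 \<union> (\<lambda>j. \<alpha> + 2 * j) ` T1"
begin

lemma even_mem: "2 * j \<in> T \<longleftrightarrow> j \<in> T1"
  unfolding T_eq using alpha_odd by (auto, presburger)

lemma odd_mem: "\<alpha> + 2 * j \<in> T \<longleftrightarrow> j \<in> T1"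
  unfolding T_eq using alpha_odd by (auto, presburger)

lemma T_cases:
  assumes "n \<in> T"
  obtains j where "j \<in> T1" "n = 2 * j" | j where "j \<in> T1" "n = \<alpha> + 2 * j"
  using assms unfolding T_eq by blast

lemma int_cases_parity: obtains j where "n = 2 * j" | j where "n = \<alpha> + 2 * j"
proof (cases "even n")
  case True then show thesis using that(1) by (elim evenE)
next
  case False
  then have "even (n - \<alpha>)" using alpha_odd by simp
  then obtain j where "n - \<alpha> = 2 * j" by (elim evenE)
  then show thesis using that(2)[of j] by simp
qed

end

sublocale double_semigroup \<subseteq> num_semigroup T
proof
  show "0 \<in> T" using even_mem[of 0] base.zero_mem by simp
  show "0 \<le> n" if "n \<in> T" for n
    using that by (rule T_cases) (use base.nonneg alpha_mem in force)+
  show "m + n \<in> T" if "m \<in> T" "n \<in> T" for m n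
    using that(1)
  proof (rule T_cases)
    fix i assume i: "i \<in> T1" "m = 2 * i"
    show ?thesis using that(2)
    proof (rule T_cases)
      fix j assume "j \<in> T1" "n = 2 * j"
      then show ?thesis using even_mem[of "i + j"] base.add_mem i by simp
    next
      fix j assume "j \<in> T1" "n = \<alpha> + 2 * j"
      then show ?thesis using odd_mem[of "i + j"] base.add_mem i by (simp add: algebra_simps)
    qed
  next
    fix i assume i: "i \<in> T1" "m = \<alpha> + 2 * i"
    show ?thesis using that(2)
    proof (rule T_cases)
      fix j assume "j \<in> T1" "n = 2 * j"
      then show ?thesis using odd_mem[of "i + j"] base.add_mem i by (simp add: algebra_simps)
    next
      fix j assume "j \<in> T1" "n = \<alpha> + 2 * j"
      then show ?thesis using even_mem[of "\<alpha> + (i + j)"] base.add_mem alpha_mem i by (simp add: algebra_simps)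
    qed
  qed
  obtain N where N: "{N..} \<subseteq> T1" using base.cofinite by blast
  have "{max (2 * N) (\<alpha> + 2 * N)..} \<subseteq> T"
  proof
    fix n assume n: "n \<in> {max (2 * N) (\<alpha> + 2 * N)..}"
    show "n \<in> T"
    proof (rule int_cases_parity[of n])
      fix j assume "n = 2 * j"
      then show ?thesis using n N even_mem[of j] by auto
    next
      fix j assume "n = \<alpha> + 2 * j"
      then show ?thesis using n N odd_mem[of j] by auto
    qed
  qed
  then show "\<exists>N. {N..} \<subseteq> T" by blast
qed

text \<open>\<open>f\<close> and \<open>F - f\<close> are exponents of the canonical module of \<open>k[[T1]]\<close> outside \<open>T1\<close>: they exist
  because the ring is not Gorenstein, and multiply the maximal ideal into itself because it is
  almost Gorenstein.\<close>
locale almost_symmetric_double = double_semigroup +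
  fixes F f b :: int
  assumes F: "F \<notin> T1" "F < n \<Longrightarrow> n \<in> T1"
    and almost: "h \<in> T1 \<Longrightarrow> h \<noteq> 0 \<Longrightarrow> F - k \<notin> T1 \<Longrightarrow> h + k \<in> T1"
    and f: "f \<notin> T1" "F - f \<notin> T1"
    and b: "b \<in> T1" "b \<noteq> 0" "2 * b < \<alpha>"
begin

lemma alpha_pos: "0 < \<alpha>"
  using b base.nonneg[OF b(1)] by simp

lemma odd_ge: "\<alpha> + 2 * j \<in> T \<Longrightarrow> 0 \<le> j"
  using odd_mem base.nonneg by blast

text \<open>With \<open>M = T1 - {0}\<close>, this is the union of \<open>2 M\<close> and
  \<open>\<alpha> + 2 M\<close>: the exponents of the extension to \<open>R\<close> of the maximal
  ideal of \<open>R1\<close>.\<close>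

definition Tc :: "int set" where
  "Tc = T - {0, \<alpha>}"

lemma Tc_even: "2 * j \<in> Tc \<longleftrightarrow> j \<in> T1 \<and> j \<noteq> 0"
  unfolding Tc_def using even_mem alpha_odd by auto

lemma Tc_odd: "\<alpha> + 2 * j \<in> Tc \<longleftrightarrow> j \<in> T1 \<and> j \<noteq> 0"
  unfolding Tc_def using odd_mem alpha_odd by (auto, presburger)

text \<open>The canonical exponents at \<open>\<alpha> + 2 * F\<close> are \<open>2 * k\<close> and
  \<open>\<alpha> + 2 * k\<close> with \<open>F - k \<notin> T1\<close>, so \<open>almost\<close>
  applies in each parity. In the odd-odd case the sum of two \<alpha> is absorbed because \<alpha>
  is in \<open>T1\<close>.\<close>

lemma Tc_add_canonical:
  assumes n: "\<alpha> + 2 * F - n \<notin> T" and h: "h \<in> Tc"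
  shows "n + h \<in> Tc" and "0 \<le> n"
proof -
  have ge: "0 \<le> k" if "F - k \<notin> T1" for k using F(2)[of "F - k"] that by force
  have mul: "i + k \<in> T1 \<and> i + k \<noteq> 0" if "i \<in> T1" "i \<noteq> 0" "F - k \<notin> T1" for i k
    using almost[OF that] ge[OF that(3)] base.nonneg[OF that(1)] that(2) by auto
  consider k where "n = 2 * k" "F - k \<notin> T1" | k where "n = \<alpha> + 2 * k" "F - k \<notin> T1"
  proof (rule int_cases_parity[of n])
    fix k assume k: "n = 2 * k"
    have "\<alpha> + 2 * F - n = \<alpha> + 2 * (F - k)" using k by simp
    then show thesis using that(1)[OF k] n odd_mem by metis
  next
    fix k assume k: "n = \<alpha> + 2 * k"
    have "\<alpha> + 2 * F - n = 2 * (F - k)" using k by simp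
    then show thesis using that(2)[OF k] n even_mem by metis
  qed
  note ncases = this
  show "0 \<le> n" by (rule ncases) (use ge alpha_pos in force)+
  show "n + h \<in> Tc"
  proof (rule ncases)
    fix k assume k: "n = 2 * k" "F - k \<notin> T1"
    show ?thesis
    proof (rule int_cases_parity[of h])
      fix i assume i: "h = 2 * i"
      then show ?thesis using mul[of i k] h Tc_even[of i] Tc_even[of "i + k"] k by (simp add: algebra_simps)
    next
      fix i assume i: "h = \<alpha> + 2 * i"
      then show ?thesis using mul[of i k] h Tc_odd[of i] Tc_odd[of "i + k"] k by (simp add: algebra_simps)
    qed
  next
    fix k assume k: "n = \<alpha> + 2 * k" "F - k \<notin> T1"
    show ?thesis
    proof (rule int_cases_parity[of h])
      fix i assume i: "h = 2 * i"
      then show ?thesis using mul[of i k] h Tc_even[of i] Tc_odd[of "i + k"] k by (simp add: algebra_simps)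
    next
      fix i assume i: "h = \<alpha> + 2 * i"
      then have ik: "i + k \<in> T1" "i + k \<noteq> 0" using mul[of i k] h Tc_odd[of i] k by auto
      then have "\<alpha> + (i + k) \<in> T1" "\<alpha> + (i + k) \<noteq> 0"
        using base.add_mem[OF alpha_mem ik(1)] base.nonneg[OF ik(1)] alpha_pos by auto
      then show ?thesis using Tc_even[of "\<alpha> + (i + k)"] i k by (simp add: algebra_simps)
    qed
  qed
qed

text \<open>All exponents of the canonical model carry \<open>Tc\<close> into itself, so they lie in
  the semigroup \<open>D\<close> of nonnegative integers doing so. Once \<open>K\<close> is inside
  the ring \<open>supp_in D\<close>, so is \<open>R[K]\<close>, and it multiplies
  \<open>supp_in Tc\<close> into itself.\<close>

lemma supp_in_Tc_subset_conductor:
  fixes K :: "'k::field fls set"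
  assumes K: "canonical_fractional_ideal (supp_in T) K"
  shows "supp_in Tc \<subseteq> colon (supp_in T) (ring_adj (supp_in T) K)"
proof -
  have Kc: "canonical_frac (supp_in T) K" and RK: "supp_in T \<subseteq> K" and KV: "K \<subseteq> pow_series"
    using K unfolding canonical_fractional_ideal_def by auto
  define G where "G = \<alpha> + 2 * F"
  have GT: "G \<notin> T" unfolding G_def odd_mem by (rule F(1))
  define D where "D = {n. 0 \<le> n \<and> (\<forall>h\<in>Tc. n + h \<in> Tc)}"
  have b2: "2 * b \<in> Tc" using b Tc_even by simp
  have AD: "n \<in> D" if "G - n \<notin> T" for n
    using that Tc_add_canonical(1)[of n] Tc_add_canonical(2)[of n, OF _ b2] unfolding D_def G_def by blast
  have D0: "0 \<in> D" by (simp add: D_def)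
  have Dadd: "m + n \<in> D" if "m \<in> D" "n \<in> D" for m n using that by (simp add: D_def add.assoc)
  have Dn: "0 \<le> n" if "n \<in> D" for n using that by (simp add: D_def)
  obtain u where u: "u \<noteq> 0" "K = (\<lambda>y. u * y) ` kan G"
    using canonical_unique[OF Kc kan_canonical[of G]] by blast
  have kanD: "kan G \<subseteq> (supp_in D :: 'k fls set)" unfolding kan_def by (rule supp_in_mono) (use AD in blast)
  \<comment> \<open>\<open>K\<close> is \<open>u * kan G\<close> with unknown \<open>u\<close>. From
    1 in \<open>K\<close>, \<open>u\<close> is the inverse of an element of \<open>kan G\<close>;
    \<open>K \<subseteq> pow_series\<close> makes that element of order 0, so its inverse keeps its
    exponents in \<open>D\<close>.\<close>
  obtain y where y: "1 = u * y" "y \<in> kan G" using RK ring_one u(2) by blast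
  have y0: "y \<noteq> 0" using y(1) by auto
  have "(1 :: 'k fls) \<in> kan G" using GT unfolding kan_def tpow_0[symmetric] by simp
  then have "u * 1 \<in> K" using u(2) by blast
  then have "u \<in> supp_in {0..}" using KV unfolding pow_series_def supp_in_def by force
  then have "0 \<le> fls_subdegree u" using in_supp_in_subdegree[OF u(1)] by fastforce
  moreover have "0 \<le> fls_subdegree y" using in_supp_in_subdegree[OF y0, of D] y(2) kanD Dn by blast
  moreover have "fls_subdegree u + fls_subdegree y = 0" using fls_subdegree_mult[OF u(1) y0] by (simp flip: y(1))
  ultimately have "fls_subdegree y = 0" by simp
  then have "y $$ 0 \<noteq> 0" using nth_fls_subdegree_nonzero[OF y0] by simp
  then have "inverse y \<in> supp_in D" using y(2) kanD Dn D0 Dadd by (intro inverse_in_supp_in) auto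
  moreover have "u = inverse y" using y(1) y0 by (metis inverse_unique mult.commute)
  ultimately have uD: "u \<in> supp_in D" by simp
  have KD: "K \<subseteq> supp_in D"
  proof
    fix k assume "k \<in> K"
    then obtain z where "k = u * z" "z \<in> kan G" using u(2) by blast
    then show "k \<in> supp_in D" using supp_in_mult[OF uD, of z D D] kanD Dadd by blast
  qed
  have "is_subring (supp_in D :: 'k fls set)"
    unfolding is_subring_def
  proof (intro conjI ballI)
    show "1 \<in> supp_in D" using D0 by (simp add: tpow_0[symmetric] del: tpow_0)
    show "x * z \<in> supp_in D" if "x \<in> supp_in D" "z \<in> supp_in D" for x z :: "'k fls"
      using supp_in_mult[OF that, of D] Dadd by blast
  qed (simp_all add: supp_in_add supp_in_uminus)
  then have adj: "ring_adj (supp_in T) K \<subseteq> supp_in D" unfolding ring_adj_def using RK KD by blast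
  show ?thesis
  proof
    fix x :: "'k fls" assume x: "x \<in> supp_in Tc"
    show "x \<in> colon (supp_in T) (ring_adj (supp_in T) K)"
    proof (rule colonI)
      fix s assume "s \<in> ring_adj (supp_in T) K"
      then have "s \<in> supp_in D" using adj by blast
      then have "x * s \<in> supp_in Tc"
        by (rule supp_in_mult[OF x]) (auto simp: D_def add.commute)
      moreover have "supp_in Tc \<subseteq> (supp_in T :: 'k fls set)" by (rule supp_in_mono) (auto simp: Tc_def)
      ultimately show "x * s \<in> supp_in T" by blast
    qed
  qed
qed

lemma add_f:
  assumes "h \<in> T1" "h \<noteq> 0" "g \<in> {f, F - f}"
  shows "h + g \<in> T1"
  using almost[OF assms(1,2), of g] assms(3) f by auto

lemma g_notin: "g \<in> {f, F - f} \<Longrightarrow> g \<notin> T1"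
  using f by auto

text \<open>The order \<open>e\<close> of \<open>a\<close> is at most
  \<open>2 * b < \<alpha>\<close>, hence even, say \<open>2 * c\<close>. Both
  \<open>tpow \<alpha>\<close> and \<open>tpow (2 * (c + f))\<close> lie in the ideal, and dividing
  their product by \<open>a\<close> would give the order \<open>\<alpha> + 2 * f\<close>, a gap of
  \<open>T\<close>.\<close>

lemma max_ideal_not_ulrich:
  assumes "ulrich_ideal T (supp_in (T - {0}) :: 'k::field fls set) a xs"
  shows False
proof -
  interpret U: ulrich_ideal T "supp_in (T - {0}) :: 'k fls set" a xs by (rule assms)
  define e where "e = fls_subdegree a"
  have eT: "e \<in> T" "e \<noteq> 0" using in_supp_in_subdegree[OF U.a(2) U.a(1)] by (auto simp: e_def)
  have "(tpow (2 * b) :: 'k fls) \<in> supp_in (T - {0})" using b even_mem by simp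
  from U.subdegree_min[OF this] have "e \<le> 2 * b" by (simp add: e_def)
  then have lt: "e < \<alpha>" using b by simp
  obtain c where c: "e = 2 * c"
  proof (rule int_cases_parity[of e])
    fix j assume "e = \<alpha> + 2 * j"
    then show thesis using odd_ge[of j] eT lt by simp
  qed (use that in blast)
  have cT: "c \<in> T1" "c \<noteq> 0" using c eT even_mem by auto
  have f0: "0 \<le> f" using F(2)[of "F - f"] f by force
  have h: "c + f \<in> T1" "c + f \<noteq> 0" using add_f[OF cT, of f] f0 cT base.nonneg[OF cT(1)] by auto
  have "(tpow \<alpha> :: 'k fls) \<in> supp_in (T - {0})" "(tpow (2 * (c + f)) :: 'k fls) \<in> supp_in (T - {0})"
    using odd_mem[of 0] base.zero_mem alpha_pos even_mem[of "c + f"] h by auto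
  from U.square[OF this] obtain y :: "'k fls" where y: "tpow \<alpha> * tpow (2 * (c + f)) = a * y" "y \<in> supp_in (T - {0})"
    by blast
  have y0: "y \<noteq> 0" using y(1) by (metis mult_zero_right no_zero_divisors tpow_nonzero)
  have "\<alpha> + 2 * (c + f) = fls_subdegree (tpow \<alpha> * tpow (2 * (c + f)) :: 'k fls)" by simp
  also have "\<dots> = e + fls_subdegree y" unfolding y(1) using y0 U.a by (simp add: e_def)
  finally have "fls_subdegree y = \<alpha> + 2 * f" using c by simp
  then have "\<alpha> + 2 * f \<in> T" using in_supp_in_subdegree[OF y0 y(2)] by simp
  then show False using odd_mem f by simp
qed

theorem ulrich_ideals:
  fixes K I :: "'k::field fls set"
  assumes K: "canonical_fractional_ideal (supp_in T) K" and I: "ulrich (supp_in T) I"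
  shows "mu (supp_in T) I = 2 \<or> I = colon (supp_in T) (ring_adj (supp_in T) K)"
proof -
  let ?c = "colon (supp_in T) (ring_adj (supp_in T) K)"
  obtain a xs where U': "ulrich_ideal T I a xs" using ulrich_imp_ulrich_ideal[OF I] by blast
  interpret U: ulrich_ideal T I a xs by (rule U')
  show ?thesis
  proof (cases "length xs = 2")
    case True
    then show ?thesis using U.mu_eq_2 by simp
  next
    case False
    then have len: "3 \<le> length xs" using U.length_xs by simp
    have "K \<subseteq> ring_adj (supp_in T) K" unfolding ring_adj_def by blast
    then have "?c \<subseteq> colon (supp_in T) K" unfolding colon_def by blast
    also have "\<dots> \<subseteq> I" using K unfolding canonical_fractional_ideal_def by (intro U.trace_subset len) auto
    finally have cI: "?c \<subseteq> I" .
    have TcI: "supp_in Tc \<subseteq> ?c" by (rule supp_in_Tc_subset_conductor[OF K])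
    \<comment> \<open>A further element of \<open>I\<close> has a nonzero coefficient at \<alpha>,
      and all its other terms are in \<open>supp_in Tc\<close>. Then \<open>I\<close> contains
      \<open>tpow \<alpha>\<close> and is the maximal ideal.\<close>
    have "I \<subseteq> supp_in Tc"
    proof (rule ccontr)
      assume "\<not> I \<subseteq> supp_in Tc"
      then obtain g n where g: "g \<in> I" "g $$ n \<noteq> 0" "n \<notin> Tc" unfolding supp_in_def by blast
      have "n \<in> T" using supp_inD[OF U.I_ring[OF g(1)] g(2)] .
      moreover have "n \<noteq> 0" using U.nth_0[OF g(1)] g(2) by auto
      ultimately have ga: "g $$ \<alpha> \<noteq> 0" using g unfolding Tc_def by blast
      define s where "s = fls_const (g $$ \<alpha>) * tpow \<alpha>"
      have "g - s \<in> supp_in Tc"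
      proof (rule supp_inI)
        fix m assume m: "(g - s) $$ m \<noteq> 0"
        then have "m \<noteq> \<alpha>" by (auto simp: s_def)
        then have "g $$ m \<noteq> 0" using m by (simp add: s_def)
        moreover then have "m \<noteq> 0" using U.nth_0[OF g(1)] by auto
        ultimately show "m \<in> Tc" using \<open>m \<noteq> \<alpha>\<close> supp_inD[OF U.I_ring[OF g(1)]] unfolding Tc_def by blast
      qed
      then have "g - s \<in> I" using TcI cI by blast
      then have "g - (g - s) \<in> I" by (rule U.I_diff[OF g(1)])
      then have "fls_const (inverse (g $$ \<alpha>)) * s \<in> I" by (intro U.const_in) simp
      then have ta: "tpow \<alpha> \<in> I" using ga by (simp add: s_def mult.assoc[symmetric])
      obtain N where N: "supp_in {N..} \<subseteq> I" using U.tail by blast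
      have "supp_in (T - {0}) \<subseteq> I"
      proof (rule supp_in_subset_of_tpows[OF N _ U.I_add U.I_zero])
        fix i and c :: 'k assume "i \<in> T - {0}"
        then have "i = \<alpha> \<or> i \<in> Tc" by (auto simp: Tc_def)
        then have "tpow i \<in> I" using ta TcI cI tpow_in_supp_in[of i Tc] by blast
        then show "fls_const c * tpow i \<in> I" by (rule U.const_in)
      qed
      moreover have "I \<subseteq> supp_in (T - {0})"
        using U.I_ring U.nth_0 unfolding supp_in_def by blast
      ultimately have "I = supp_in (T - {0})" by blast
      then show False using max_ideal_not_ulrich U' by blast
    qed
    then show ?thesis using TcI cI by blast
  qed
qed

lemma monomial_pair_classification:
  assumes e: "e0 \<in> T" "e0 \<noteq> 0" "e1 \<in> T" "e0 < e1" and d: "e1 - e0 \<notin> T" "2 * (e1 - e0) \<in> T"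
    and E: "\<And>h. h \<in> T \<Longrightarrow> h + (e1 - e0) \<in> T \<Longrightarrow> h - e0 \<in> T \<or> h - e1 \<in> T"
  obtains m where "m \<in> T1" "0 < m" "\<alpha> - 2 * m \<in> T1" "e0 = 2 * m" "e1 = \<alpha>"
proof -
  let ?d = "e1 - e0"
  have dT1: "?d \<in> T1" using d even_mem by blast
  have e0p: "0 < e0" using nonneg[OF e(1)] e(2) by simp
  consider (gen) "e0 \<noteq> \<alpha>" "e1 \<noteq> \<alpha>" | (e1) "e1 = \<alpha>" | (e0) "e0 = \<alpha>" by blast
  then show thesis
  proof cases
    case gen
    have add: "x + 2 * g \<in> T" if "x \<in> T" "x \<noteq> 0" "x \<noteq> \<alpha>" and g: "g \<in> {f, F - f}" for x g
      using that(1)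
    proof (rule T_cases)
      fix j assume j: "j \<in> T1" "x = 2 * j"
      then show ?thesis using add_f[OF j(1) _ g] even_mem[of "j + g"] that by auto
    next
      fix j assume j: "j \<in> T1" "x = \<alpha> + 2 * j"
      then show ?thesis using add_f[OF j(1) _ g] odd_mem[of "j + g"] that by (auto simp: algebra_simps)
    qed
    \<comment> \<open>Apply \<open>E\<close> to \<open>e0 + 2 * g\<close> and to
      \<open>e1 + 2 * g\<close>. Each time one alternative is \<open>2 * g\<close>, which is not in
      \<open>T\<close>, so the other one holds.\<close>
    have key: "2 * g - ?d \<in> T \<and> 2 * g + ?d \<in> T" if g: "g \<in> {f, F - f}" for g
    proof -
      have gT: "2 * g \<notin> T" using even_mem g_notin[OF g] by simp
      have a0: "e0 + 2 * g \<in> T" and a1: "e1 + 2 * g \<in> T" using add e gen g e0p by auto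
      have "(e0 + 2 * g) - e0 \<in> T \<or> (e0 + 2 * g) - e1 \<in> T" using E[OF a0] a1 by (simp add: algebra_simps)
      moreover have "(e1 + 2 * g) + ?d \<in> T" using add_mem[OF a0 d(2)] by (simp add: algebra_simps)
      then have "(e1 + 2 * g) - e0 \<in> T \<or> (e1 + 2 * g) - e1 \<in> T" using E[OF a1] by blast
      ultimately show ?thesis using gT by (simp add: algebra_simps)
    qed
    have "(2 * f - ?d) + (2 * (F - f) + ?d) \<in> T" using key[of f] key[of "F - f"] add_mem by blast
    then have "2 * F \<in> T" by (simp add: algebra_simps)
    then show ?thesis using even_mem F by simp
  next
    case e1
    obtain m where m: "e0 = 2 * m"
    proof (rule int_cases_parity[of e0])
      fix j assume "e0 = \<alpha> + 2 * j"
      then show thesis using odd_ge[of j] e e1 by simp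
    qed (use that in blast)
    then show ?thesis using that[of m] e e0p even_mem[of m] dT1 e1 by simp
  next
    case e0
    obtain m where m: "e1 = 2 * m"
    proof (rule int_cases_parity[of e1])
      fix j assume j: "e1 = \<alpha> + 2 * j"
      then have "2 * j \<in> T" using e odd_mem even_mem by simp
      then show thesis using d j e0 by simp
    qed (use that in blast)
    have mT: "m \<in> T1" "m \<noteq> 0" using m e even_mem alpha_pos e0 by auto
    have dd: "?d = 2 * m - \<alpha>" "?d \<noteq> 0" using m e0 e by auto
    \<comment> \<open>Here \<open>e0 = \<alpha>\<close> and \<open>e1 = 2 * m\<close>;
      \<open>E\<close> is applied to \<open>2 * (\<alpha> + g)\<close> and
      \<open>2 * (m + g)\<close>. The rejected alternatives are \<open>\<alpha> + 2 * g\<close> and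
      \<open>2 * g\<close>; adding the results for \<open>f\<close> and \<open>F - f\<close> puts
      \<open>F\<close> into \<open>T1\<close>.\<close>
    have key: "g + \<alpha> - m \<in> T1 \<and> g + m - \<alpha> \<in> T1" if g: "g \<in> {f, F - f}" for g
    proof
      have g1: "\<alpha> + g \<in> T1" "m + g \<in> T1" "?d + g \<in> T1"
        using add_f[OF alpha_mem _ g] add_f[OF mT g] add_f[OF dT1 dd(2) g] alpha_pos by auto
      have h1: "2 * (\<alpha> + g) \<in> T" "2 * (\<alpha> + g) + ?d \<in> T"
        using g1 even_mem[of "\<alpha> + g"] odd_mem[of "m + g"] by (auto simp: dd algebra_simps)
      have "2 * (\<alpha> + g) - e0 = \<alpha> + 2 * g" "2 * (\<alpha> + g) - e1 = 2 * (g + \<alpha> - m)" using e0 m by auto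
      then show "g + \<alpha> - m \<in> T1" using E[OF h1] odd_mem even_mem g_notin[OF g] by metis
      have h2: "2 * (m + g) \<in> T" "2 * (m + g) + ?d \<in> T"
        using g1 even_mem[of "m + g"] odd_mem[of "?d + g"] by (auto simp: dd algebra_simps)
      have "2 * (m + g) - e0 = \<alpha> + 2 * (g + m - \<alpha>)" "2 * (m + g) - e1 = 2 * g" using e0 m by auto
      then show "g + m - \<alpha> \<in> T1" using E[OF h2] odd_mem even_mem g_notin[OF g] by metis
    qed
    have "(f + \<alpha> - m) + (F - f + m - \<alpha>) \<in> T1" using key[of f] key[of "F - f"] base.add_mem by blast
    then show ?thesis using F by simp
  qed
qed

text \<open>Parity settles the annihilator condition: for \<open>h = 2 * j\<close>, both
  \<open>h + (\<alpha> - 2 * m)\<close> and \<open>h - 2 * m\<close> are in \<open>T\<close> exactly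
  when \<open>j - m\<close> is in \<open>T1\<close>; an odd \<open>h\<close> is already a multiple
  of \<alpha> in exponents, \<open>h - \<alpha>\<close> being in \<open>T\<close>.\<close>

lemma ulrich_pair:
  assumes m: "m \<in> T1" "0 < m" "\<alpha> - 2 * m \<in> T1"
  shows "ulrich (supp_in T) (gen (supp_in T) [tpow (2 * m), tpow \<alpha> :: 'k::field fls])"
    "mu (supp_in T) (gen (supp_in T) [tpow (2 * m), tpow \<alpha> :: 'k fls]) = 2"
proof -
  have 1: "2 * m \<in> T" "0 < 2 * m" "\<alpha> \<in> T" using m even_mem odd_mem[of 0] base.zero_mem by auto
  have 2: "\<alpha> - 2 * m \<notin> T"
    using odd_ge[of "- m"] m by auto
  have 3: "2 * (\<alpha> - 2 * m) \<in> T" using m even_mem by blast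
  have 4: "h - 2 * m \<in> T \<or> h - \<alpha> \<in> T" if h: "h \<in> T" "h + (\<alpha> - 2 * m) \<in> T" for h
    using h(1)
  proof (rule T_cases)
    fix j assume j: "j \<in> T1" "h = 2 * j"
    then have "h + (\<alpha> - 2 * m) = \<alpha> + 2 * (j - m)" "h - 2 * m = 2 * (j - m)" by auto
    then show ?thesis using h odd_mem even_mem by metis
  next
    fix j assume "j \<in> T1" "h = \<alpha> + 2 * j"
    then show ?thesis using even_mem by simp
  qed
  show "ulrich (supp_in T) (gen (supp_in T) [tpow (2 * m), tpow \<alpha> :: 'k::field fls])"
    "mu (supp_in T) (gen (supp_in T) [tpow (2 * m), tpow \<alpha> :: 'k fls]) = 2"
    by (rule ulrich_monomial_pair[OF 1 2 3 4 alpha_pos]; assumption)+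
qed

theorem monomial_ulrich_ideals:
  "{I. ulrich (supp_in T) I \<and> mu (supp_in T) I = 2
      \<and> (\<exists>S. S \<subseteq> range (\<lambda>n. fls_X ^ n) \<and> I = gen_set (supp_in T) S)}
   = {gen (supp_in T) [tpow (2 * m), tpow \<alpha> :: 'k::field fls] | m. m \<in> T1 \<and> 0 < m \<and> \<alpha> - 2 * m \<in> T1}"
proof (intro equalityI subsetI)
  fix I :: "'k fls set"
  assume "I \<in> {I. ulrich (supp_in T) I \<and> mu (supp_in T) I = 2
      \<and> (\<exists>S. S \<subseteq> range (\<lambda>n. fls_X ^ n) \<and> I = gen_set (supp_in T) S)}"
  then obtain S where I: "ulrich (supp_in T) I" "mu (supp_in T) I = 2"
    and S: "S \<subseteq> range (\<lambda>n. fls_X ^ n)" "I = gen_set (supp_in T) S" by blast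
  obtain a xs where "ulrich_ideal T I a xs" using ulrich_imp_ulrich_ideal[OF I(1)] by blast
  then interpret U: ulrich_ideal T I a xs .
  obtain e0 e1 where e: "e0 \<in> T" "e0 \<noteq> 0" "e1 \<in> T" "e0 < e1" "e1 - e0 \<notin> T" "2 * (e1 - e0) \<in> T"
    and E: "{n. tpow n \<in> I} = {n. n - e0 \<in> T \<or> n - e1 \<in> T}"
    "\<And>h. h \<in> T \<Longrightarrow> h + (e1 - e0) \<in> T \<Longrightarrow> h \<in> {n. tpow n \<in> I}"
    using U.monomial_two_generated[OF U.monomial_ideal[OF S] I(2)] by blast
  obtain m where m: "m \<in> T1" "0 < m" "\<alpha> - 2 * m \<in> T1" "e0 = 2 * m" "e1 = \<alpha>"
    using monomial_pair_classification[OF e] E by blast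
  have "I = gen (supp_in T) [tpow e0, tpow e1]"
    unfolding gen_tpow_pair E(1)[symmetric] by (rule U.monomial_ideal[OF S])
  then show "I \<in> {gen (supp_in T) [tpow (2 * m), tpow \<alpha>] | m. m \<in> T1 \<and> 0 < m \<and> \<alpha> - 2 * m \<in> T1}"
    using m by blast
next
  fix I :: "'k fls set"
  assume "I \<in> {gen (supp_in T) [tpow (2 * m), tpow \<alpha>] | m. m \<in> T1 \<and> 0 < m \<and> \<alpha> - 2 * m \<in> T1}"
  then obtain m where m: "m \<in> T1" "0 < m" "\<alpha> - 2 * m \<in> T1"
    and I: "I = gen (supp_in T) [tpow (2 * m), tpow \<alpha>]" by blast
  have "set [tpow (2 * m), tpow \<alpha> :: 'k fls] \<subseteq> range (\<lambda>n. fls_X ^ n)"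
  proof -
    have "tpow n \<in> range (\<lambda>n. fls_X ^ n :: 'k fls)" if "0 \<le> n" for n
      using that by (intro image_eqI[of _ _ "nat n"]) (simp_all add: fls_X_power_eq_tpow)
    then show ?thesis using m(2) alpha_pos by simp
  qed
  moreover have "I = gen_set (supp_in T) (set [tpow (2 * m), tpow \<alpha>])" unfolding I by (rule gen_set_eq_gen[symmetric])
  ultimately show "I \<in> {I. ulrich (supp_in T) I \<and> mu (supp_in T) I = 2
      \<and> (\<exists>S. S \<subseteq> range (\<lambda>n. fls_X ^ n) \<and> I = gen_set (supp_in T) S)}"
    using ulrich_pair[OF m, where 'k = 'k] unfolding I by blast
qed

end

theorem theorem4p14:
  fixes as :: "nat list" and \<alpha> :: nat and K :: "'k::field fls set"
  defines "H1 \<equiv> sg_gen as"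
      and "H \<equiv> sg_gen (map (\<lambda>a. 2 * a) as @ [\<alpha>])"
  defines "R1 \<equiv> (sg_ring H1 :: 'k fls set)"
      and "R \<equiv> (sg_ring H :: 'k fls set)"
  defines "\<cc> \<equiv> colon R (ring_adj R K)"
  assumes "min_gens_numsg as"
      and "0 < \<alpha>" and "\<alpha> \<in> H1" and "odd \<alpha>" and "\<alpha> \<notin> set as"
      and "canonical_fractional_ideal R K"
      and "almost_gor_not_gor R1"
  shows "(\<forall>I. ulrich R I \<longrightarrow> mu R I = 2 \<or> I = \<cc>)
     \<and> {I. ulrich R I \<and> mu R I = 2
          \<and> (\<exists>S. S \<subseteq> range (\<lambda>n. fls_X ^ n) \<and> I = gen_set R S)}
       = {gen R [fls_X ^ (2 * m), fls_X ^ \<alpha>] | m.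
           0 < m \<and> m \<in> H1 \<and> m \<le> \<alpha> \<and> \<alpha> - m \<in> H1 \<and> 2 * m \<le> \<alpha> \<and> 2 * (\<alpha> - 2 * m) \<in> H}"
proof -
  note alpha = \<open>0 < \<alpha>\<close> \<open>\<alpha> \<in> H1\<close> \<open>odd \<alpha>\<close> \<open>\<alpha> \<notin> set as\<close>
  define T1 T where "T1 = int ` H1" and "T = int ` H"
  have R1: "R1 = supp_in T1" and R: "R = supp_in T" by (simp_all add: R1_def R_def T1_def T_def sg_ring_eq_supp_in)
  have as: "as \<noteq> []" "\<And>a. a \<in> set as \<Longrightarrow> 0 < a" "Gcd (set as) = 1"
    using \<open>min_gens_numsg as\<close> unfolding min_gens_numsg_def by auto
  interpret base: num_semigroup T1 unfolding T1_def H1_def by (rule num_semigroup_sg_gen[OF as(2,3)])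
  have H: "H = (\<lambda>s. 2 * s) ` H1 \<union> (\<lambda>s. \<alpha> + 2 * s) ` H1"
  proof (intro equalityI subsetI)
    fix x assume "x \<in> H"
    then obtain s c where x: "x = 2 * s + c * \<alpha>" "s \<in> H1"
      unfolding H_def sg_gen_snoc sg_gen_double H1_def by blast
    \<comment> \<open>An even number of copies of \<alpha> is twice an element of \<open>H1\<close>,
      so at most one copy of \<alpha> remains.\<close>
    define q where "q = c div 2"
    have sq: "s + q * \<alpha> \<in> H1" using x(2) alpha(2) unfolding H1_def by (intro sg_gen_add sg_gen_scale)
    have "c = 2 * q \<or> c = 2 * q + 1" unfolding q_def by linarith
    then have "x = 2 * (s + q * \<alpha>) \<or> x = \<alpha> + 2 * (s + q * \<alpha>)" using x(1) by (auto simp: algebra_simps)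
    then show "x \<in> (\<lambda>s. 2 * s) ` H1 \<union> (\<lambda>s. \<alpha> + 2 * s) ` H1" using sq by blast
  next
    fix x assume "x \<in> (\<lambda>s. 2 * s) ` H1 \<union> (\<lambda>s. \<alpha> + 2 * s) ` H1"
    then obtain s where s: "s \<in> H1" "x = 2 * s + 0 * \<alpha> \<or> x = 2 * s + 1 * \<alpha>" by auto
    then show "x \<in> H" unfolding H_def sg_gen_snoc sg_gen_double H1_def by blast
  qed
  interpret double_semigroup T1 "int \<alpha>" T
  proof
    show "int \<alpha> \<in> T1" using alpha by (simp add: T1_def)
    show "odd (int \<alpha>)" using alpha by simp
    show "T = (\<lambda>j. 2 * j) ` T1 \<union> (\<lambda>j. int \<alpha> + 2 * j) ` T1"
      unfolding T_def H T1_def by (simp add: image_Un image_image)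
  qed
  obtain F where F: "F \<notin> T1" "\<And>n. F < n \<Longrightarrow> n \<in> T1" using base.frobenius_number by blast
  have ag: "almost_gor_not_gor (supp_in T1 :: 'k fls set)" using \<open>almost_gor_not_gor R1\<close> R1 by simp
  obtain f where f: "f \<notin> T1" "F - f \<notin> T1" using base.almost_gor_not_gor_semigroup(2)[OF ag F] by blast
  define b where "b = Min (set as)"
  have b: "b \<in> set as" "\<And>a. a \<in> set as \<Longrightarrow> b \<le> a" using as(1) by (simp_all add: b_def)
  \<comment> \<open>Since \<alpha> is in \<open>H1\<close> but is no generator, it has at least two
    summands; being odd, it is not \<open>2 * b\<close>.\<close>
  have "2 * b \<le> \<alpha>" using sg_gen_not_generator[of as b \<alpha>] b(2) alpha H1_def by auto
  then have b\<alpha>: "2 * b < \<alpha>" using alpha(3) by (metis dvd_triv_left le_neq_implies_less)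
  interpret almost_symmetric_double T1 "int \<alpha>" T F f "int b"
  proof
    show "F \<notin> T1" "\<And>n. F < n \<Longrightarrow> n \<in> T1" "f \<notin> T1" "F - f \<notin> T1" using F f by auto
    show "\<And>h k. h \<in> T1 \<Longrightarrow> h \<noteq> 0 \<Longrightarrow> F - k \<notin> T1 \<Longrightarrow> h + k \<in> T1"
      using base.almost_gor_not_gor_semigroup(1)[OF ag F] by blast
    show "int b \<in> T1" using b(1) sg_gen_superset[of as] unfolding T1_def H1_def by blast
    show "int b \<noteq> 0" using as(2)[OF b(1)] by simp
    show "2 * int b < int \<alpha>" using b\<alpha> by linarith
  qed
  have K: "canonical_fractional_ideal (supp_in T) K" using \<open>canonical_fractional_ideal R K\<close> R by simp
  have memT1: "int n \<in> T1 \<longleftrightarrow> n \<in> H1" for n by (auto simp: T1_def)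
  have memT: "int n \<in> T \<longleftrightarrow> n \<in> H" for n by (auto simp: T_def)
  have "{gen R [tpow (2 * m), tpow (int \<alpha>)] | m. m \<in> T1 \<and> 0 < m \<and> int \<alpha> - 2 * m \<in> T1}
    = {gen R [fls_X ^ (2 * m), fls_X ^ \<alpha>] | m.
        0 < m \<and> m \<in> H1 \<and> m \<le> \<alpha> \<and> \<alpha> - m \<in> H1 \<and> 2 * m \<le> \<alpha> \<and> 2 * (\<alpha> - 2 * m) \<in> H}" (is "?A = ?B")
  proof (intro equalityI subsetI)
    fix I assume "I \<in> ?A"
    then obtain m' where m': "m' \<in> T1" "0 < m'" "int \<alpha> - 2 * m' \<in> T1" "I = gen R [tpow (2 * m'), tpow (int \<alpha>)]"
      by blast
    define m where "m = nat m'"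
    have m: "m' = int m" using m'(2) by (simp add: m_def)
    have le: "2 * m \<le> \<alpha>" using base.nonneg[OF m'(3)] m by linarith
    have d: "\<alpha> - 2 * m \<in> H1" using m'(3) le memT1[of "\<alpha> - 2 * m"] by (simp add: m of_nat_diff)
    have mH: "m \<in> H1" "0 < m" using m' memT1 m by auto
    \<comment> \<open>The condition on \<open>\<alpha> - m\<close> follows from the one on
      \<open>\<alpha> - 2 * m\<close> by adding \<open>m\<close>.\<close>
    have "(\<alpha> - 2 * m) + m \<in> H1" using sg_gen_add d mH H1_def by blast
    then have "\<alpha> - m \<in> H1" using le by simp
    moreover have "2 * (\<alpha> - 2 * m) \<in> H" using d H by blast
    moreover have "I = gen R [fls_X ^ (2 * m), fls_X ^ \<alpha>]" using m'(4) m by (simp add: fls_X_power_eq_tpow)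
    ultimately show "I \<in> ?B" using mH le by force
  next
    fix I assume "I \<in> ?B"
    then obtain m where m: "0 < m" "m \<in> H1" "2 * m \<le> \<alpha>" "2 * (\<alpha> - 2 * m) \<in> H"
      "I = gen R [fls_X ^ (2 * m), fls_X ^ \<alpha>]" by blast
    have "2 * (int \<alpha> - 2 * int m) \<in> T" using m(3,4) memT[of "2 * (\<alpha> - 2 * m)"] by (simp add: of_nat_diff)
    then have "int \<alpha> - 2 * int m \<in> T1" using even_mem by blast
    moreover have "I = gen R [tpow (2 * int m), tpow (int \<alpha>)]" using m(5) by (simp add: fls_X_power_eq_tpow)
    ultimately show "I \<in> ?A" using m memT1 by (intro CollectI exI[of _ "int m"]) auto
  qed
  then show ?thesis
    using ulrich_ideals[OF K] monomial_ulrich_ideals[where 'k = 'k] unfolding R[symmetric] \<cc>_def by simp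
qed

end
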